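(* Fix constants $k\ge1$ and a finite set of node labels. There is an FOM-computable function which maps a $k$-ordered tree $\mathcal{T}$ of size $n$ to a hierarchical definition $(\mathcal{T},P)$ in normal form where $P$ has depth $O(\log n)$ and $O(n/\log n)$ inequivalent patterns.
   Context: A $k$-ordered tree is a structure $(V,(E_i)_{1\le i\le k},(P_a)_{a\in A})$ such that $(V,\bigcup_iE_i)$ is a rooted tree, the $E_i$ are pairwise disjoint, and each node has at most one $i$-th child for each $i$; it is given in ancestor representation. Patterns: a subtree pattern is a node $v$, covering all descendants of $v$ (including $v$); a context pattern is a pair $(v,w)$ with $w$ a proper descendant of $v$, covering all descendants of $v$ that are not descendants of $w$. $V[p]$ is the set of covered nodes, $\mathcal{T}[p]$ the induced subtree, and the root of $p$ is the root of $\mathcal{T}[p]$; $q\le p$ iff $V[q]\subseteq V[p]$. A hierarchical definition of $\mathcal{T}$ is a set $P$ of patterns containing the root of $\mathcal{T}$ such that any two patterns of $P$ are disjoint or comparable; represented as the structure $(\mathcal{T},P\cap V,P\cap V^2)$. Direct subpatterns of $p$ are the $q\in P$ with $q<p$ and no $r\in P$ strictly between; the pattern tree has node set $P$ with children the direct subpatterns, and the depth of $P$ is its height. The boundary is $\partial p=V[p]\setminus\bigcup_{q\text{ direct subpattern of }p}V[q]$. $(\mathcal{T},P)$ is in normal form if every $p\in P$ satisfies one of: (1) with $u$ the root of $p$, $\partial p=\{u\}$ and every direct subpattern of $p$ is a subtree pattern; or (2) $p$ has exactly two direct subpatterns $p_1,p_2$ and $V[p]$ is the disjoint union of $V[p_1]$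 and $V[p_2]$. For $p\in P$ let $P[p]=\{q\in P\mid q\le p\}$; $p_1,p_2\in P$ are equivalent if $(\mathcal{T}[p_1],P[p_1])$ and $(\mathcal{T}[p_2],P[p_2])$ are isomorphic. Structures have domain $\{1,\dots,n\}$ with built-in $<$ and $\mathrm{BIT}$; FOM-computable functions are those given by first-order interpretations with majority quantifiers (equivalently DLOGTIME-uniform $\mathrm{TC}^0$). *)

theory Defs
  imports Complex_Main "HOL-Library.Landau_Symbols"
begin

section \<open>First-order logic with majority quantifiers\<close>

text \<open>A vocabulary maps each of its relation symbols to its arity; symbols mapped to
  \<^const>\<open>None\<close> do not belong to the vocabulary.  A structure of size \<open>n\<close> has the domain
  \<open>{1..n}\<close>, and relations are sets of tuples, written as lists.\<close>

type_synonym 'r vocabulary = "'r \<Rightarrow> nat option"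

record 'r struc =
  usize :: nat
  rels :: "'r \<Rightarrow> nat list set"

definition universe :: "'r struc \<Rightarrow> nat set" where
  "universe S = {1..usize S}"

definition STRUC :: "'r vocabulary \<Rightarrow> 'r struc set" where
  "STRUC \<sigma> = {S. usize S \<ge> 1 \<and>
     (\<forall>R. case \<sigma> R of
        None \<Rightarrow> rels S R = {}
      | Some r \<Rightarrow> rels S R \<subseteq> {xs. length xs = r \<and> set xs \<subseteq> universe S})}"

text \<open>Variables are natural numbers.\<close>

datatype 'r fom =
    Rel 'r "nat list"
  | Eq nat nat
  | Less nat nat
  | Bit nat nat
  | Neg "'r fom"
  | Conj "'r fom" "'r fom"
  | Exists nat "'r fom"
  | Majority nat "'r fom"

text \<open>The predicate \<open>BIT(i, j)\<close> says that the \<open>j\<close>-th bit of \<open>i\<close> is 1.  Positions range over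
  the domain and hence are counted from 1, which is the least significant bit.  The majority
  quantifier asks for more than half of the elements of the domain.\<close>

primrec sat :: "'r struc \<Rightarrow> (nat \<Rightarrow> nat) \<Rightarrow> 'r fom \<Rightarrow> bool" where
  "sat S e (Rel R xs) \<longleftrightarrow> map e xs \<in> rels S R"
| "sat S e (Eq x y) \<longleftrightarrow> e x = e y"
| "sat S e (Less x y) \<longleftrightarrow> e x < e y"
| "sat S e (Bit x y) \<longleftrightarrow> bit (e x) (e y - 1)"
| "sat S e (Neg \<phi>) \<longleftrightarrow> \<not> sat S e \<phi>"
| "sat S e (Conj \<phi> \<psi>) \<longleftrightarrow> sat S e \<phi> \<and> sat S e \<psi>"
| "sat S e (Exists x \<phi>) \<longleftrightarrow> (\<exists>a\<in>universe S. sat S (e(x := a)) \<phi>)"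
| "sat S e (Majority x \<phi>) \<longleftrightarrow>
     2 * card {a \<in> universe S. sat S (e(x := a)) \<phi>} > card (universe S)"

primrec fv :: "'r fom \<Rightarrow> nat set" where
  "fv (Rel R xs) = set xs"
| "fv (Eq x y) = {x, y}"
| "fv (Less x y) = {x, y}"
| "fv (Bit x y) = {x, y}"
| "fv (Neg \<phi>) = fv \<phi>"
| "fv (Conj \<phi> \<psi>) = fv \<phi> \<union> fv \<psi>"
| "fv (Exists x \<phi>) = fv \<phi> - {x}"
| "fv (Majority x \<phi>) = fv \<phi> - {x}"

primrec fom_over :: "'r vocabulary \<Rightarrow> 'r fom \<Rightarrow> bool" where
  "fom_over \<sigma> (Rel R xs) \<longleftrightarrow> \<sigma> R = Some (length xs)"
| "fom_over \<sigma> (Eq x y) \<longleftrightarrow> True"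
| "fom_over \<sigma> (Less x y) \<longleftrightarrow> True"
| "fom_over \<sigma> (Bit x y) \<longleftrightarrow> True"
| "fom_over \<sigma> (Neg \<phi>) \<longleftrightarrow> fom_over \<sigma> \<phi>"
| "fom_over \<sigma> (Conj \<phi> \<psi>) \<longleftrightarrow> fom_over \<sigma> \<phi> \<and> fom_over \<sigma> \<psi>"
| "fom_over \<sigma> (Exists x \<phi>) \<longleftrightarrow> fom_over \<sigma> \<phi>"
| "fom_over \<sigma> (Majority x \<phi>) \<longleftrightarrow> fom_over \<sigma> \<phi>"


subsection \<open>Interpretations\<close>

text \<open>A \<open>d\<close>-dimensional interpretation represents the elements of the output structure by those
  \<open>d\<close>-tuples of input elements that satisfy the domain formula, with free variables
  \<open>0, \<dots>, d - 1\<close>.  An \<open>r\<close>-ary output relation is given by a formula with free variables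
  \<open>0, \<dots>, r * d - 1\<close>, evaluated on the concatenation of \<open>r\<close> such tuples.\<close>

record ('r, 's) fom_interp =
  dimension :: nat
  dom_formula :: "'r fom"
  rel_formula :: "'s \<Rightarrow> 'r fom"

definition fom_interpretation ::
    "'r vocabulary \<Rightarrow> 's vocabulary \<Rightarrow> ('r, 's) fom_interp \<Rightarrow> bool" where
  "fom_interpretation \<sigma> \<tau> I \<longleftrightarrow>
     dimension I \<ge> 1 \<and>
     fom_over \<sigma> (dom_formula I) \<and> fv (dom_formula I) \<subseteq> {..<dimension I} \<and>
     (\<forall>R r. \<tau> R = Some r \<longrightarrow>
        fom_over \<sigma> (rel_formula I R) \<and> fv (rel_formula I R) \<subseteq> {..<r * dimension I})"

definition interp_tuples :: "('r, 's) fom_interp \<Rightarrow> 'r struc \<Rightarrow> nat list set" where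
  "interp_tuples I S =
     {xs. length xs = dimension I \<and> set xs \<subseteq> universe S \<and> sat S (nth xs) (dom_formula I)}"

text \<open>To obtain a structure with domain \<open>{1..m}\<close> again, the tuples are numbered in
  lexicographic order.\<close>

definition tuple_index :: "('r, 's) fom_interp \<Rightarrow> 'r struc \<Rightarrow> nat list \<Rightarrow> nat" where
  "tuple_index I S xs = Suc (card {ys \<in> interp_tuples I S. (ys, xs) \<in> lex less_than})"

definition interp_struc ::
    "'s vocabulary \<Rightarrow> ('r, 's) fom_interp \<Rightarrow> 'r struc \<Rightarrow> 's struc" where
  "interp_struc \<tau> I S =
     \<lparr>usize = card (interp_tuples I S),
      rels = (\<lambda>R. case \<tau> R of
          None \<Rightarrow> {}
        | Some r \<Rightarrow> {map (tuple_index I S) xss | xss.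
             length xss = r \<and> set xss \<subseteq> interp_tuples I S \<and>
             sat S (nth (concat xss)) (rel_formula I R)})\<rparr>"

text \<open>Computability of a function that is only considered on the class \<open>K\<close> of input structures.\<close>

definition FOM_computable ::
    "'r vocabulary \<Rightarrow> 's vocabulary \<Rightarrow> 'r struc set \<Rightarrow> ('r struc \<Rightarrow> 's struc) \<Rightarrow> bool" where
  "FOM_computable \<sigma> \<tau> K f \<longleftrightarrow>
     K \<subseteq> STRUC \<sigma> \<and> f ` K \<subseteq> STRUC \<tau> \<and>
     (\<exists>I. fom_interpretation \<sigma> \<tau> I \<and> (\<forall>S\<in>K. f S = interp_struc \<tau> I S))"


section \<open>Ordered trees\<close>

definition rooted_tree :: "'v set \<Rightarrow> ('v \<times> 'v) set \<Rightarrow> 'v \<Rightarrow> bool" where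
  "rooted_tree V E r \<longleftrightarrow>
     E \<subseteq> V \<times> V \<and> r \<in> V \<and> (\<forall>u. (u, r) \<notin> E) \<and>
     (\<forall>v\<in>V - {r}. \<exists>!u. (u, v) \<in> E) \<and>
     (\<forall>v\<in>V. (r, v) \<in> E\<^sup>*)"

text \<open>In the ancestor representation the structure also contains the (reflexive) ancestor
  relation.\<close>

datatype 'a tree_sym = Edge nat | Anc | Label 'a

definition tree_vocabulary :: "nat \<Rightarrow> 'a set \<Rightarrow> 'a tree_sym vocabulary" where
  "tree_vocabulary k A s = (case s of
       Edge i \<Rightarrow> if 1 \<le> i \<and> i \<le> k then Some 2 else None
     | Anc \<Rightarrow> Some 2
     | Label a \<Rightarrow> if a \<in> A then Some 1 else None)"

definition edges :: "'a tree_sym struc \<Rightarrow> nat \<Rightarrow> (nat \<times> nat) set" where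
  "edges T i = {(u, v). [u, v] \<in> rels T (Edge i)}"

text \<open>On \<^term>\<open>STRUC (tree_vocabulary k A)\<close> only the indices in \<open>{1..k}\<close> contribute.\<close>

definition tree_edges :: "'a tree_sym struc \<Rightarrow> (nat \<times> nat) set" where
  "tree_edges T = (\<Union>i. edges T i)"

definition ordered_trees :: "nat \<Rightarrow> 'a set \<Rightarrow> 'a tree_sym struc set" where
  "ordered_trees k A = {T \<in> STRUC (tree_vocabulary k A).
     (\<exists>r. rooted_tree (universe T) (tree_edges T) r) \<and>
     (\<forall>i\<in>{1..k}. \<forall>j\<in>{1..k}. i \<noteq> j \<longrightarrow> edges T i \<inter> edges T j = {}) \<and>
     (\<forall>i\<in>{1..k}. \<forall>u v w. (u, v) \<in> edges T i \<longrightarrow> (u, w) \<in> edges T i \<longrightarrow> v = w) \<and>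
     rels T Anc = {[u, v] | u v. u \<in> universe T \<and> v \<in> universe T \<and> (u, v) \<in> (tree_edges T)\<^sup>*}}"

definition tree_root :: "'a tree_sym struc \<Rightarrow> nat" where
  "tree_root T = (THE r. rooted_tree (universe T) (tree_edges T) r)"

definition descendants :: "'a tree_sym struc \<Rightarrow> nat \<Rightarrow> nat set" where
  "descendants T v = {w. [v, w] \<in> rels T Anc}"


section \<open>Patterns and hierarchical definitions\<close>

datatype 'v pattern = Subtree 'v | Context 'v 'v

primrec is_pattern :: "'a tree_sym struc \<Rightarrow> nat pattern \<Rightarrow> bool" where
  "is_pattern T (Subtree v) \<longleftrightarrow> v \<in> universe T"
| "is_pattern T (Context v w) \<longleftrightarrow> v \<in> universe T \<and> w \<in> descendants T v \<and> w \<noteq> v"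

primrec covered :: "'a tree_sym struc \<Rightarrow> nat pattern \<Rightarrow> nat set" where
  "covered T (Subtree v) = descendants T v"
| "covered T (Context v w) = descendants T v - descendants T w"

primrec pattern_root :: "'v pattern \<Rightarrow> 'v" where
  "pattern_root (Subtree v) = v"
| "pattern_root (Context v w) = v"

primrec is_subtree_pattern :: "'v pattern \<Rightarrow> bool" where
  "is_subtree_pattern (Subtree v) \<longleftrightarrow> True"
| "is_subtree_pattern (Context v w) \<longleftrightarrow> False"

definition pattern_le :: "'a tree_sym struc \<Rightarrow> nat pattern \<Rightarrow> nat pattern \<Rightarrow> bool" where
  "pattern_le T q p \<longleftrightarrow> covered T q \<subseteq> covered T p"

definition pattern_less :: "'a tree_sym struc \<Rightarrow> nat pattern \<Rightarrow> nat pattern \<Rightarrow> bool" where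
  "pattern_less T q p \<longleftrightarrow> pattern_le T q p \<and> q \<noteq> p"

definition hierarchical_definition :: "'a tree_sym struc \<Rightarrow> nat pattern set \<Rightarrow> bool" where
  "hierarchical_definition T P \<longleftrightarrow>
     (\<forall>p\<in>P. is_pattern T p) \<and>
     Subtree (tree_root T) \<in> P \<and>
     (\<forall>p\<in>P. \<forall>q\<in>P. covered T p \<inter> covered T q = {} \<or> pattern_le T p q \<or> pattern_le T q p)"

datatype 'a hier_sym = Tree_Rel "'a tree_sym" | Subtree_Patterns | Context_Patterns

definition hier_vocabulary :: "nat \<Rightarrow> 'a set \<Rightarrow> 'a hier_sym vocabulary" where
  "hier_vocabulary k A s = (case s of
       Tree_Rel t \<Rightarrow> tree_vocabulary k A t
     | Subtree_Patterns \<Rightarrow> Some 1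
     | Context_Patterns \<Rightarrow> Some 2)"

definition hier_struc :: "'a tree_sym struc \<Rightarrow> nat pattern set \<Rightarrow> 'a hier_sym struc" where
  "hier_struc T P =
     \<lparr>usize = usize T,
      rels = (\<lambda>s. case s of
          Tree_Rel t \<Rightarrow> rels T t
        | Subtree_Patterns \<Rightarrow> {[v] | v. Subtree v \<in> P}
        | Context_Patterns \<Rightarrow> {[v, w] | v w. Context v w \<in> P})\<rparr>"

definition direct_subpatterns ::
    "'a tree_sym struc \<Rightarrow> nat pattern set \<Rightarrow> nat pattern \<Rightarrow> nat pattern set" where
  "direct_subpatterns T P p =
     {q \<in> P. pattern_less T q p \<and> \<not> (\<exists>r\<in>P. pattern_less T q r \<and> pattern_less T r p)}"

definition pattern_tree ::
    "'a tree_sym struc \<Rightarrow> nat pattern set \<Rightarrow> (nat pattern \<times> nat pattern) set" where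
  "pattern_tree T P = {(p, q). p \<in> P \<and> q \<in> direct_subpatterns T P p}"

text \<open>The height of a rooted tree: the maximal number of edges on a path from the root.\<close>

definition tree_height :: "('v \<times> 'v) set \<Rightarrow> 'v \<Rightarrow> nat" where
  "tree_height E r = Max {m. \<exists>v. (r, v) \<in> E ^^ m}"

definition hier_depth :: "'a tree_sym struc \<Rightarrow> nat pattern set \<Rightarrow> nat" where
  "hier_depth T P = tree_height (pattern_tree T P) (Subtree (tree_root T))"

definition boundary :: "'a tree_sym struc \<Rightarrow> nat pattern set \<Rightarrow> nat pattern \<Rightarrow> nat set" where
  "boundary T P p = covered T p - (\<Union>q\<in>direct_subpatterns T P p. covered T q)"

definition normal_form :: "'a tree_sym struc \<Rightarrow> nat pattern set \<Rightarrow> bool" where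
  "normal_form T P \<longleftrightarrow> (\<forall>p\<in>P.
     boundary T P p = {pattern_root p} \<and>
       (\<forall>q\<in>direct_subpatterns T P p. is_subtree_pattern q) \<or>
     (\<exists>p1 p2. p1 \<noteq> p2 \<and> direct_subpatterns T P p = {p1, p2} \<and>
       covered T p = covered T p1 \<union> covered T p2 \<and> covered T p1 \<inter> covered T p2 = {}))"

definition subpatterns ::
    "'a tree_sym struc \<Rightarrow> nat pattern set \<Rightarrow> nat pattern \<Rightarrow> nat pattern set" where
  "subpatterns T P p = {q \<in> P. pattern_le T q p}"

text \<open>An isomorphism of the induced subtrees that carries the patterns below \<open>p1\<close> onto those
  below \<open>p2\<close>.  If \<open>p1 = Context v w\<close>, then \<open>w\<close> is not covered by \<open>p1\<close> but occurs in patterns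
  below \<open>p1\<close>, e.g. in \<open>p1\<close> itself, so \<open>h\<close> also matters at \<open>w\<close>.  The equation between
  the sets of patterns forces \<open>p2\<close> to be a context pattern too, and \<open>h\<close> to send \<open>w\<close> to its
  second component.\<close>

definition pattern_iso ::
    "'a tree_sym struc \<Rightarrow> nat pattern set \<Rightarrow> nat pattern \<Rightarrow> nat pattern \<Rightarrow> (nat \<Rightarrow> nat) \<Rightarrow> bool"
  where
  "pattern_iso T P p1 p2 h \<longleftrightarrow>
     bij_betw h (covered T p1) (covered T p2) \<and>
     (\<forall>s xs. set xs \<subseteq> covered T p1 \<longrightarrow> (xs \<in> rels T s \<longleftrightarrow> map h xs \<in> rels T s)) \<and>
     map_pattern h ` subpatterns T P p1 = subpatterns T P p2"

definition equivalent_patterns ::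
    "'a tree_sym struc \<Rightarrow> nat pattern set \<Rightarrow> (nat pattern \<times> nat pattern) set" where
  "equivalent_patterns T P = {(p1, p2). p1 \<in> P \<and> p2 \<in> P \<and> (\<exists>h. pattern_iso T P p1 p2 h)}"

definition num_inequivalent :: "'a tree_sym struc \<Rightarrow> nat pattern set \<Rightarrow> nat" where
  "num_inequivalent T P = card (P // equivalent_patterns T P)"

end

(*
  Decompose the tree into heavy paths: every inner node is continued to its largest child, all other
  children are light.  A pattern is a segment of a heavy path together with all light subtrees hanging
  from it.  Give every node x of a heavy path the interval of numbers between the size of its heavy
  child (exclusive) and its own size (inclusive); these intervals partition an initial segment of the
  numbers.  The priority of x is the largest exponent e such that its interval contains a multiple of
  2^e.  Between two nodes of equal priority there is one of higher priority, so each segment has a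
  unique node of maximal priority (its peak), and the segment is cut just above and just below it.

  A segment whose peak has priority e covers fewer than 2^(e+1) nodes, and the priority of the peak
  decreases along a path while each light edge halves the size, so the depth is logarithmic.  Each
  node is the peak of at most three patterns, and only O(n / 2^e) nodes have priority at least e; this
  bounds the number of patterns with at least c * log n nodes.  In a normal form, smaller patterns are
  determined up to isomorphism by words of linear length over a fixed alphabet, so there are at most
  sqrt n of them up to equivalence.

  Which segments arise can be read off locally from sizes and priorities, without following the
  recursion.  Sizes are compared with majority quantifiers, and divisibility by powers of two with BIT.
*)
theory Submission
  imports Defs "HOL-Library.Discrete_Functions"
begin

section \<open>Descendants\<close>

text \<open>Cutting a path at its weighted middle and recursing would also give logarithmic depth,
  but a fixed formula cannot follow logarithmically many rounds. With priorities the successive cuts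
  form a Cartesian tree, so whether a pair of nodes becomes a pattern depends only on the peak of
  its segment and on the priorities of the two path nodes just outside it (\<open>P0_iff\<close>).
  The delicate point is the number of nodes of priority at least e. Counting multiples of 2^e path
  by path only gives n * log n / 2^e, because the subtree at the top of one heavy path contains
  those of many others. The logarithm is saved by charging: such a node is charged either to a
  segment whose bags are all small, and these segments are disjoint, or to a nearby node with a
  large bag. As degrees are at most k, a large bag contains a light subtree of proportional size,
  and large light subtrees can be charged to disjoint subtrees. This is why k enters the
  bound.\<close>

locale finite_tree =
  fixes V :: "nat set" and E :: "(nat \<times> nat) set" and r :: nat
  assumes fin: "finite V" and tree: "rooted_tree V E r" and zero: "0 \<notin> V"
begin

definition D :: "nat \<Rightarrow> nat set" where
  "D v = {y. v \<in> V \<and> y \<in> V \<and> (v, y) \<in> E\<^sup>*}"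

abbreviation sz :: "nat \<Rightarrow> nat" where
  "sz v \<equiv> card (D v)"

lemma V_nz: "x \<in> V \<Longrightarrow> x \<noteq> 0"
  using zero by metis

lemma E_V: "(x, y) \<in> E \<Longrightarrow> x \<in> V" "(x, y) \<in> E \<Longrightarrow> y \<in> V"
  using tree by (auto simp: rooted_tree_def)

lemma r_V: "r \<in> V"
  using tree by (auto simp: rooted_tree_def)

lemma r_top: "(x, r) \<notin> E"
  using tree by (auto simp: rooted_tree_def)

lemma r_reach: "v \<in> V \<Longrightarrow> (r, v) \<in> E\<^sup>*"
  using tree by (auto simp: rooted_tree_def)

lemma parent_unique: "(x, z) \<in> E \<Longrightarrow> (y, z) \<in> E \<Longrightarrow> x = y"
  using tree E_V unfolding rooted_tree_def by blast

text \<open>\<open>rooted_tree\<close> does not postulate acyclicity. A cycle through z also passes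
  through the only parent of z, so by induction along the path from the root it would pass through
  the root, which has no incoming edge.\<close>

lemma tree_acyclic: "(x, x) \<notin> E\<^sup>+"
proof -
  have "(y, y) \<notin> E\<^sup>+" if "(r, y) \<in> E\<^sup>*" for y
    using that
  proof (induction rule: rtrancl_induct)
    case base
    show ?case using r_top by (metis tranclE)
  next
    case (step y z)
    show ?case
    proof
      assume "(z, z) \<in> E\<^sup>+"
      then obtain u where "(z, u) \<in> E\<^sup>*" "(u, z) \<in> E"
        by (metis tranclD2)
      with step.hyps parent_unique have "(y, y) \<in> E\<^sup>+"
        by (metis rtrancl_into_trancl2)
      with step.IH show False ..
    qed
  qed
  then show ?thesis using r_reach E_V
    by (metis tranclD)
qed

lemma anc_antisym: "(x, y) \<in> E\<^sup>* \<Longrightarrow> (y, x) \<in> E\<^sup>* \<Longrightarrow> x = y"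
  using tree_acyclic by (metis rtranclD trancl_rtrancl_trancl)

lemma anc_linear:
  assumes "(x, z) \<in> E\<^sup>*" "(y, z) \<in> E\<^sup>*"
  shows "(x, y) \<in> E\<^sup>* \<or> (y, x) \<in> E\<^sup>*"
proof -
  have "single_valued (E\<inverse>)"
    using parent_unique by (auto simp: single_valued_def)
  moreover have "(z, x) \<in> (E\<inverse>)\<^sup>*" "(z, y) \<in> (E\<inverse>)\<^sup>*"
    using assms by (simp_all add: rtrancl_converse)
  ultimately have "(x, y) \<in> (E\<inverse>)\<^sup>* \<or> (y, x) \<in> (E\<inverse>)\<^sup>*"
    by (rule single_valued_confluent)
  then show ?thesis by (auto simp: rtrancl_converse)
qed

lemma D_subset_V: "D v \<subseteq> V"
  by (auto simp: D_def)

lemma finite_D [simp]: "finite (D v)"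
  using D_subset_V fin by (rule finite_subset)

lemma D_self: "v \<in> V \<Longrightarrow> v \<in> D v"
  by (simp add: D_def)

lemma D_empty: "v \<notin> V \<Longrightarrow> D v = {}"
  by (simp add: D_def)

lemma D_zero [simp]: "D 0 = {}"
  using zero by (rule D_empty)

lemma zero_notin_D [simp]: "0 \<notin> D v"
  using zero D_subset_V by blast

lemma D_mono: "y \<in> D v \<Longrightarrow> D y \<subseteq> D v"
  by (auto simp: D_def)

lemma D_antisym: "y \<in> D v \<Longrightarrow> v \<in> D y \<Longrightarrow> y = v"
  by (auto simp: D_def intro: anc_antisym)

lemma D_linear: "x \<in> D u \<Longrightarrow> x \<in> D v \<Longrightarrow> u \<in> D v \<or> v \<in> D u"
  using anc_linear by (auto simp: D_def)

lemma D_trans: "x \<in> D y \<Longrightarrow> y \<in> D v \<Longrightarrow> x \<in> D v"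
  using D_mono by blast

lemma edge_D: "(v, u) \<in> E \<Longrightarrow> u \<in> D v"
  using E_V by (auto simp: D_def)

lemma edge_not_D: "(v, u) \<in> E \<Longrightarrow> v \<notin> D u"
  using tree_acyclic by (auto simp: D_def dest: rtrancl_into_trancl2)

lemma D_child: "x \<in> D v \<Longrightarrow> x \<noteq> v \<Longrightarrow> \<exists>u. (v, u) \<in> E \<and> x \<in> D u"
  unfolding D_def using E_V by (metis (mono_tags, lifting) converse_rtranclE mem_Collect_eq)

lemma D_parent: "x \<in> D v \<Longrightarrow> x \<noteq> v \<Longrightarrow> \<exists>u. (u, x) \<in> E \<and> u \<in> D v"
  unfolding D_def using E_V by (metis (mono_tags, lifting) rtranclE mem_Collect_eq)

lemma parent_in_D: "(u, x) \<in> E \<Longrightarrow> x \<in> D v \<Longrightarrow> x \<noteq> v \<Longrightarrow> u \<in> D v"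
  using D_parent parent_unique by blast

lemma siblings_disjoint:
  assumes "(v, u) \<in> E" "(v, u') \<in> E" "u \<noteq> u'"
  shows "D u \<inter> D u' = {}"
proof -
  have *: False if "(v, a) \<in> E" "(v, b) \<in> E" "a \<noteq> b" "a \<in> D b" for a b
    using parent_in_D[OF that(1) that(4) that(3)] edge_not_D[OF that(2)] by simp
  show ?thesis
  proof (rule ccontr)
    assume "D u \<inter> D u' \<noteq> {}"
    then obtain x where "x \<in> D u" "x \<in> D u'" by blast
    then show False using D_linear * assms by metis
  qed
qed

lemma sz_mono: "y \<in> D v \<Longrightarrow> sz y \<le> sz v"
  by (simp add: D_mono card_mono)

lemma sz_strict: "y \<in> D v \<Longrightarrow> y \<noteq> v \<Longrightarrow> sz y < sz v"
  using D_mono D_antisym D_self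
  by (metis D_empty psubsetI psubset_card_mono finite_D empty_iff)

lemma sz_pos: "v \<in> V \<Longrightarrow> sz v > 0"
  using D_self finite_D card_gt_0_iff by blast

lemma sz_le: "sz v \<le> card V"
  by (simp add: D_subset_V card_mono fin)

lemma D_root: "D r = V"
  using r_V r_reach by (auto simp: D_def)


section \<open>Heavy paths\<close>

text \<open>Ties go to the smaller node: the built-in order makes the choice unique and definable by
  a formula.\<close>

definition heavy :: "nat \<Rightarrow> nat \<Rightarrow> bool" where
  "heavy v u \<longleftrightarrow> (v, u) \<in> E \<and>
     (\<forall>u'. (v, u') \<in> E \<longrightarrow> sz u' < sz u \<or> (sz u' = sz u \<and> u \<le> u'))"

text \<open>The value \<open>0\<close>, which is not a node, stands for the missing heavy child of a leaf and,
  as \<open>D 0\<close> is empty, for the missing hole of a subtree pattern.\<close>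

definition hc :: "nat \<Rightarrow> nat" where
  "hc v = (if \<exists>u. heavy v u then THE u. heavy v u else 0)"

lemma heavy_unique:
  assumes "heavy v u" "heavy v u'" shows "u = u'"
proof -
  have "sz u' < sz u \<or> (sz u' = sz u \<and> u \<le> u')" "sz u < sz u' \<or> (sz u = sz u' \<and> u' \<le> u)"
    using assms unfolding heavy_def by blast+
  then show ?thesis by linarith
qed

lemma heavy_exists:
  assumes "(v, u) \<in> E" shows "\<exists>u. heavy v u"
proof -
  let ?C = "{u. (v, u) \<in> E}"
  have f: "finite ?C" by (rule finite_subset[OF _ fin]) (auto intro: E_V)
  define s where "s = Max (sz ` ?C)"
  define u0 where "u0 = Min {u \<in> ?C. sz u = s}"
  have ne: "{u \<in> ?C. sz u = s} \<noteq> {}"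
    using Max_in[of "sz ` ?C"] f assms unfolding s_def by fastforce
  have "u0 \<in> {u \<in> ?C. sz u = s}"
    using Min_in[OF _ ne] f unfolding u0_def by simp
  moreover have "sz u' \<le> s" if "(v, u') \<in> E" for u'
    unfolding s_def using f that by (intro Max_ge) auto
  moreover have "u0 \<le> u'" if "(v, u') \<in> E" "sz u' = s" for u'
    unfolding u0_def using f that by (intro Min_le) auto
  ultimately have "heavy v u0"
    unfolding heavy_def by (auto simp: le_less)
  then show ?thesis ..
qed

lemma hc_heavy: "heavy v u \<longleftrightarrow> hc v = u \<and> u \<noteq> 0"
proof
  assume h: "heavy v u"
  then have "hc v = u" using heavy_unique by (auto simp: hc_def)
  moreover have "u \<noteq> 0" using h V_nz E_V(2) unfolding heavy_def by blast
  ultimately show "hc v = u \<and> u \<noteq> 0" by simp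
next
  assume "hc v = u \<and> u \<noteq> 0"
  then show "heavy v u"
    by (metis hc_def heavy_unique theI)
qed

lemma hc_edge: "hc v \<noteq> 0 \<Longrightarrow> (v, hc v) \<in> E"
  using hc_heavy heavy_def by blast

lemma hc_zero: "hc v = 0 \<Longrightarrow> (v, u) \<notin> E"
  by (metis hc_heavy heavy_exists)

lemma hc_max: "(v, u) \<in> E \<Longrightarrow> sz u \<le> sz (hc v)"
proof -
  assume e: "(v, u) \<in> E"
  then have "heavy v (hc v)" using hc_heavy hc_zero by blast
  then show ?thesis using e unfolding heavy_def by (metis less_imp_le order_refl)
qed

lemma hc_outside: "v \<notin> V \<Longrightarrow> hc v = 0"
  using hc_edge E_V by blast

lemma hc_inj: "hc x = hc y \<Longrightarrow> hc x \<noteq> 0 \<Longrightarrow> x = y"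
  by (metis hc_edge parent_unique)

lemma hc_D: "D (hc v) \<subseteq> D v"
  by (metis D_zero D_mono edge_D empty_subsetI hc_edge)

lemma self_notin_hc: "v \<notin> D (hc v)"
  by (metis D_zero edge_not_D empty_iff hc_edge)

lemma hc_neq: "v \<in> V \<Longrightarrow> hc v \<noteq> v"
  by (metis self_notin_hc D_self)

definition light :: "nat \<Rightarrow> nat set" where
  "light v = {u. (v, u) \<in> E \<and> u \<noteq> hc v}"

lemma light_V: "u \<in> light v \<Longrightarrow> u \<in> V"
  by (auto simp: light_def intro: E_V)

lemma finite_light [simp]: "finite (light v)"
  by (rule finite_subset[OF _ fin]) (auto intro: light_V)

lemma light_not_hc: "u \<in> light v \<Longrightarrow> hc x \<noteq> u"
proof
  assume u: "u \<in> light v" and h: "hc x = u"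
  then have "u \<noteq> 0" using light_V V_nz by blast
  then have "(x, u) \<in> E" using h hc_edge by blast
  then have "x = v" using u parent_unique by (auto simp: light_def)
  then show False using u h by (simp add: light_def)
qed

text \<open>The contribution of v to its heavy path. The bags along a path partition what the path
  covers, so the interval of v has length \<open>weight v\<close>.\<close>

definition bag :: "nat \<Rightarrow> nat set" where
  "bag v = D v - D (hc v)"

abbreviation weight :: "nat \<Rightarrow> nat" where
  "weight v \<equiv> sz v - sz (hc v)"

lemma bag_self: "v \<in> V \<Longrightarrow> v \<in> bag v"
  using D_self self_notin_hc by (simp add: bag_def)

lemma bag_eq: "v \<in> V \<Longrightarrow> bag v = insert v (\<Union>u\<in>light v. D u)"
proof (intro set_eqI iffI)
  fix x assume v: "v \<in> V" and "x \<in> bag v"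
  then have x: "x \<in> D v" "x \<notin> D (hc v)" by (auto simp: bag_def)
  then show "x \<in> insert v (\<Union>u\<in>light v. D u)"
    using D_child[of x v] by (auto simp: light_def)
next
  fix x assume v: "v \<in> V" and x: "x \<in> insert v (\<Union>u\<in>light v. D u)"
  show "x \<in> bag v"
  proof (cases "x = v")
    case True then show ?thesis using v by (simp add: bag_self)
  next
    case False
    then obtain u where u: "u \<in> light v" "x \<in> D u" using x by blast
    then have "x \<in> D v" using edge_D D_trans by (auto simp: light_def)
    moreover have "x \<notin> D (hc v)"
    proof (cases "hc v = 0")
      case False
      then show ?thesis
        using siblings_disjoint[of v u "hc v"] u hc_edge by (auto simp: light_def)
    qed simp
    ultimately show ?thesis by (simp add: bag_def)
  qed
qed

lemma light_bag: "u \<in> light v \<Longrightarrow> D u \<subseteq> bag v"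
  using bag_eq[of v] E_V by (auto simp: light_def)

lemma self_notin_light: "u \<in> light v \<Longrightarrow> v \<notin> D u"
  using edge_not_D by (auto simp: light_def)

lemma card_bag: "card (bag v) = weight v"
  unfolding bag_def by (simp add: card_Diff_subset hc_D)

lemma light_disjoint: "u \<in> light v \<Longrightarrow> u' \<in> light v \<Longrightarrow> u \<noteq> u' \<Longrightarrow> D u \<inter> D u' = {}"
  using siblings_disjoint by (auto simp: light_def)

lemma weight_eq: "v \<in> V \<Longrightarrow> weight v = 1 + (\<Sum>u\<in>light v. sz u)"
proof -
  assume v: "v \<in> V"
  have "card (\<Union>u\<in>light v. D u) = (\<Sum>u\<in>light v. sz u)"
    using light_disjoint by (intro card_UN_disjoint) auto
  moreover have "v \<notin> (\<Union>u\<in>light v. D u)" using self_notin_light by blast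
  ultimately show ?thesis
    using v card_bag[of v] by (simp add: bag_eq)
qed

lemma light_less_weight: "u \<in> light v \<Longrightarrow> sz u < weight v"
proof -
  assume u: "u \<in> light v"
  then have v: "v \<in> V" by (auto simp: light_def intro: E_V)
  have "sz u \<le> (\<Sum>u\<in>light v. sz u)" using u by (intro member_le_sum) auto
  then show ?thesis using weight_eq[OF v] by simp
qed

text \<open>The heavy child is at least as large as u and disjoint from it.\<close>

lemma light_half: "u \<in> light v \<Longrightarrow> 2 * sz u < sz v"
proof -
  assume u: "u \<in> light v"
  then have "sz u \<le> sz (hc v)" using hc_max by (simp add: light_def)
  then show ?thesis using light_less_weight[OF u] by linarith
qed

section \<open>The relation of heavy edges\<close>

text \<open>Every leaf gets an edge to the dummy 0, so that a path that is not cut off ends at 0 and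
  subtree patterns need no separate treatment. Upward arguments have to exclude 0, where all heavy
  paths meet.\<close>

definition H :: "(nat \<times> nat) set" where
  "H = {(x, hc x) | x. x \<in> V}"

lemma H_iff: "(x, y) \<in> H \<longleftrightarrow> x \<in> V \<and> y = hc x"
  by (auto simp: H_def)

lemma H_D: "(x, y) \<in> H\<^sup>* \<Longrightarrow> D y \<subseteq> D x"
  by (induction rule: rtrancl_induct) (use hc_D in \<open>auto simp: H_iff\<close>)

lemma H_plus_V: "(x, y) \<in> H\<^sup>+ \<Longrightarrow> x \<in> V"
  by (metis H_iff tranclD)

lemma H_plus_D: "(x, y) \<in> H\<^sup>+ \<Longrightarrow> x \<notin> D y"
  by (metis H_D H_iff self_notin_hc subsetD tranclD)

lemma H_acyclic: "(x, x) \<notin> H\<^sup>+"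
  using H_plus_D H_plus_V D_self by blast

lemma H_plus_sz: "(x, y) \<in> H\<^sup>+ \<Longrightarrow> sz y < sz x"
  using H_plus_D H_plus_V D_self H_D
  by (metis finite_D psubsetI psubset_card_mono trancl_into_rtrancl)

lemma H_star_sz: "(x, y) \<in> H\<^sup>* \<Longrightarrow> sz y \<le> sz x"
  by (simp add: H_D card_mono)

lemma H_plus_hc: "(x, y) \<in> H\<^sup>+ \<longleftrightarrow> x \<in> V \<and> (hc x, y) \<in> H\<^sup>*"
  by (metis H_iff rtrancl_into_trancl2 tranclD)

lemma H_star_V: "(x, y) \<in> H\<^sup>* \<Longrightarrow> y \<noteq> 0 \<Longrightarrow> x \<in> V \<Longrightarrow> y \<in> V"
  by (metis E_V(2) H_iff hc_edge rtranclE)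

lemma H_down: "(x, y) \<in> H\<^sup>* \<Longrightarrow> (x, z) \<in> H\<^sup>* \<Longrightarrow> (y, z) \<in> H\<^sup>* \<or> (z, y) \<in> H\<^sup>*"
  by (rule single_valued_confluent) (auto simp: single_valued_def H_iff)

lemma H_up:
  assumes "(x, z) \<in> H\<^sup>*" "(y, z) \<in> H\<^sup>*" "z \<noteq> 0"
  shows "(x, y) \<in> H\<^sup>* \<or> (y, x) \<in> H\<^sup>*"
  using assms(1,2,3)
proof (induction arbitrary: y rule: rtrancl_induct)
  case base then show ?case by blast
next
  case (step a b)
  from step.prems(1) show ?case
  proof (cases rule: rtranclE)
    case base
    then show ?thesis using step.hyps by (meson rtrancl.rtrancl_into_rtrancl)
  next
    case (step c)
    then have "c = a" using \<open>(a, b) \<in> H\<close> \<open>b \<noteq> 0\<close> by (auto simp: H_iff intro: hc_inj)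
    moreover have "a \<noteq> 0" using \<open>(a, b) \<in> H\<close> V_nz by (metis H_iff)
    ultimately show ?thesis using step.IH step(1) by blast
  qed
qed

lemma H_to_zero: "v \<in> V \<Longrightarrow> (v, 0) \<in> H\<^sup>+"
proof (induction "sz v" arbitrary: v rule: less_induct)
  case less
  show ?case
  proof (cases "hc v = 0")
    case True
    then show ?thesis using less.prems by (metis H_iff r_into_trancl)
  next
    case False
    then have "hc v \<in> V" using hc_edge E_V by blast
    moreover have "sz (hc v) < sz v"
      using False hc_edge edge_D edge_not_D D_self less.prems by (metis sz_strict)
    ultimately show ?thesis
      using less by (metis H_plus_hc trancl_into_rtrancl)
  qed
qed

lemma H_into_light: "(x, u) \<in> H\<^sup>* \<Longrightarrow> u \<in> light v \<Longrightarrow> x = u"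
  by (metis H_iff light_not_hc rtranclE)

lemma H_star_E: "(x, y) \<in> H\<^sup>* \<Longrightarrow> y \<noteq> 0 \<Longrightarrow> (x, y) \<in> E\<^sup>*"
proof (induction rule: rtrancl_induct)
  case (step y z)
  then have "(y, z) \<in> E" "y \<noteq> 0" using hc_edge V_nz by (metis H_iff)+
  then show ?case using step by (meson rtrancl.rtrancl_into_rtrancl)
qed simp

lemma H_star_in_D: "(x, y) \<in> H\<^sup>* \<Longrightarrow> y \<noteq> 0 \<Longrightarrow> x \<in> V \<Longrightarrow> y \<in> D x"
  using H_star_E H_star_V by (auto simp: D_def)

text \<open>Replaces the transitive closure by a first-order condition: every node strictly below v
  on the tree path to y is somebody's heavy child, which by uniqueness of parents means that of the
  preceding node. The formula \<open>fPath\<close> rests on this.\<close>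

lemma H_star_iff:
  assumes "v \<in> V" "y \<noteq> 0"
  shows "(v, y) \<in> H\<^sup>* \<longleftrightarrow> y \<in> D v \<and> (\<forall>x. x \<in> D v \<and> x \<noteq> v \<and> y \<in> D x \<longrightarrow> (\<exists>u. hc u = x))"
proof
  assume vy: "(v, y) \<in> H\<^sup>*"
  have "\<exists>u. hc u = x" if "x \<in> D v" "x \<noteq> v" "y \<in> D x" for x
    using vy assms(2) that
  proof (induction arbitrary: rule: rtrancl_induct)
    case base
    then show ?case using D_antisym by blast
  next
    case (step a b)
    have e: "b = hc a" using step.hyps by (simp add: H_iff)
    show ?case
    proof (cases "x = b")
      case True then show ?thesis using e by blast
    next
      case False
      have ab: "(a, b) \<in> E" using e step.prems hc_edge by metis
      then have "a \<in> D x" using parent_in_D False step.prems by metis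
      moreover have "a \<noteq> 0" using ab V_nz E_V by blast
      ultimately show ?thesis using step by blast
    qed
  qed
  then show "y \<in> D v \<and> (\<forall>x. x \<in> D v \<and> x \<noteq> v \<and> y \<in> D x \<longrightarrow> (\<exists>u. hc u = x))"
    using H_star_in_D[OF vy] assms by blast
next
  assume R: "y \<in> D v \<and> (\<forall>x. x \<in> D v \<and> x \<noteq> v \<and> y \<in> D x \<longrightarrow> (\<exists>u. hc u = x))"
  have "(v, y) \<in> E\<^sup>*" using R by (simp add: D_def)
  then show "(v, y) \<in> H\<^sup>*" using R
  proof (induction rule: rtrancl_induct)
    case base then show ?case by simp
  next
    case (step a b)
    have bV: "b \<in> V" "a \<in> V" using step.hyps E_V by auto
    have bne: "b \<noteq> v"
      using step.hyps tree_acyclic by (metis rtrancl_into_trancl1)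
    then obtain u where u: "hc u = b" using step.prems D_self bV by blast
    then have "u = a" using step.hyps hc_edge zero bV parent_unique by metis
    then have "(a, b) \<in> H" using u bV by (simp add: H_iff)
    moreover have "(v, a) \<in> H\<^sup>*"
    proof (rule step.IH, intro conjI allI impI)
      show "a \<in> D v" using step.hyps assms bV by (simp add: D_def)
      fix x assume "x \<in> D v \<and> x \<noteq> v \<and> a \<in> D x"
      then show "\<exists>u. hc u = x"
        using step.prems step.hyps edge_D D_trans by blast
    qed
    ultimately show ?case by (meson rtrancl.rtrancl_into_rtrancl)
  qed
qed

section \<open>Splitting a heavy path\<close>

text \<open>Half open, with v inside and z outside, so that a cut at m splits it into two disjoint
  segments; z = 0 gives all of the path from v on.\<close>

definition seg :: "nat \<Rightarrow> nat \<Rightarrow> nat set" where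
  "seg v z = {x. (v, x) \<in> H\<^sup>* \<and> (x, z) \<in> H\<^sup>+}"

text \<open>A node \<open>x\<close> of a heavy path occupies the numbers from \<open>sz (hc x) + 1\<close> to \<open>sz x\<close>, and these
  intervals partition the positive numbers up to the size of the top of the path.  The priority
  \<open>ev x\<close> is the largest 2-adic valuation of a number in the interval of \<open>x\<close>.\<close>

definition has_mult :: "nat \<Rightarrow> nat \<Rightarrow> bool" where
  "has_mult e x \<longleftrightarrow> (\<exists>c. sz (hc x) < c * 2 ^ e \<and> c * 2 ^ e \<le> sz x)"

definition ev :: "nat \<Rightarrow> nat" where
  "ev x = Max {e. has_mult e x}"

lemma has_mult_le: "has_mult e x \<Longrightarrow> 2 ^ e \<le> sz x"
proof -
  assume "has_mult e x"
  then obtain c where "sz (hc x) < c * 2 ^ e" "c * 2 ^ e \<le> sz x"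
    by (auto simp: has_mult_def)
  moreover from this have "c \<noteq> 0" by (metis less_zeroE mult_0)
  then have "(2::nat) ^ e \<le> c * 2 ^ e" by simp
  ultimately show ?thesis by linarith
qed

lemma finite_has_mult: "finite {e. has_mult e x}"
proof (rule finite_subset)
  show "{e. has_mult e x} \<subseteq> {..sz x}"
  proof
    fix e assume "e \<in> {e. has_mult e x}"
    then have "2 ^ e \<le> sz x" using has_mult_le by simp
    moreover have "e < (2::nat) ^ e" by (rule less_exp)
    ultimately have "e \<le> sz x" by linarith
    then show "e \<in> {..sz x}" by simp
  qed
qed simp

lemma has_mult_zero: "x \<in> V \<Longrightarrow> has_mult 0 x"
proof -
  assume "x \<in> V"
  then have "sz (hc x) < sz x" by (metis H_iff H_plus_sz r_into_trancl)
  then show ?thesis unfolding has_mult_def by (intro exI[of _ "sz x"]) simp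
qed

lemma has_mult_ev: "x \<in> V \<Longrightarrow> has_mult (ev x) x"
  using Max_in[OF finite_has_mult] has_mult_zero unfolding ev_def by blast

lemma has_mult_le_ev: "has_mult e x \<Longrightarrow> e \<le> ev x"
  unfolding ev_def using finite_has_mult by (intro Max_ge) auto

lemma has_mult_antimono:
  assumes "has_mult e x" "e' \<le> e" shows "has_mult e' x"
proof -
  obtain c where c: "sz (hc x) < c * 2 ^ e" "c * 2 ^ e \<le> sz x"
    using assms(1) by (auto simp: has_mult_def)
  have "c * 2 ^ e = (c * 2 ^ (e - e')) * 2 ^ e'"
    using assms(2) by (simp add: power_add[symmetric])
  then show ?thesis unfolding has_mult_def using c by metis
qed

lemma has_mult_iff: "x \<in> V \<Longrightarrow> has_mult e x \<longleftrightarrow> e \<le> ev x"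
  using has_mult_ev has_mult_antimono has_mult_le_ev by blast

lemma ev_le: "x \<in> V \<Longrightarrow> 2 ^ ev x \<le> sz x"
  by (simp add: has_mult_ev has_mult_le)

lemma seg_V: "x \<in> seg v z \<Longrightarrow> x \<in> V"
  by (auto simp: seg_def dest: H_plus_V)

lemma finite_seg: "finite (seg v z)"
  using seg_V fin by (meson finite_subset subsetI)

lemma seg_self: "(v, z) \<in> H\<^sup>+ \<Longrightarrow> v \<in> seg v z"
  by (simp add: seg_def)

text \<open>The interval of a node ends where that of its predecessor on the path begins, so the
  intervals of a segment tile the numbers above \<open>sz z\<close> up to
  \<open>sz v\<close>.\<close>

lemma seg_locate:
  assumes "(v, z) \<in> H\<^sup>+" "sz z < c" "c \<le> sz v"
  shows "\<exists>x\<in>seg v z. sz (hc x) < c \<and> c \<le> sz x"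
  using assms
proof (induction rule: converse_trancl_induct)
  case (base v)
  then have "z = hc v" "v \<in> seg v z" by (auto simp: H_iff seg_def)
  then show ?case using base by blast
next
  case (step v y)
  have y: "y = hc v" using step by (simp add: H_iff)
  have sub: "seg y z \<subseteq> seg v z" "v \<in> seg v z"
    using step.hyps by (auto simp: seg_def)
  show ?case
  proof (cases "c \<le> sz y")
    case True then show ?thesis using step sub by blast
  next
    case False then show ?thesis using step.prems sub y by (meson not_le)
  qed
qed

lemma seg_locate_ev:
  assumes "(v, z) \<in> H\<^sup>+" "sz z < c * 2 ^ e" "c * 2 ^ e \<le> sz v"
  shows "\<exists>x\<in>seg v z. e \<le> ev x"
  using seg_locate[OF assms] has_mult_le_ev unfolding has_mult_def by blast

text \<open>Between two multiples of \<open>2\<^sup>e\<close> that are not multiples of \<open>2 * 2\<^sup>e\<close> there is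
  a multiple of \<open>2 * 2\<^sup>e\<close>.\<close>

lemma ev_between:
  assumes xy: "(x, y) \<in> H\<^sup>+" and y: "y \<in> V" and eq: "ev x = ev y"
  shows "\<exists>u. (x, u) \<in> H\<^sup>+ \<and> (u, y) \<in> H\<^sup>+ \<and> ev x < ev u"
proof -
  define e where "e = ev x"
  have x: "x \<in> V" using xy by (rule H_plus_V)
  have notx: "\<not> has_mult (Suc e) x" and noty: "\<not> has_mult (Suc e) y"
    using x y eq by (simp_all add: has_mult_iff e_def)
  obtain a where a: "sz (hc y) < a * 2 ^ e" "a * 2 ^ e \<le> sz y"
    using has_mult_ev[OF y] eq by (auto simp: has_mult_def e_def)
  obtain b where b: "sz (hc x) < b * 2 ^ e" "b * 2 ^ e \<le> sz x"
    using has_mult_ev[OF x] by (auto simp: has_mult_def e_def)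
  have hxy: "(hc x, y) \<in> H\<^sup>*" using xy by (simp add: H_plus_hc)
  then have "sz y \<le> sz (hc x)" by (rule H_star_sz)
  then have "a * 2 ^ e < b * 2 ^ e" using a b by linarith
  then have "a < b" by simp
  have "odd a"
  proof
    assume "even a"
    then obtain a' where "a * 2 ^ e = a' * 2 ^ Suc e" by (auto elim: evenE)
    then show False using noty a unfolding has_mult_def by metis
  qed
  then have ev1: "even (a + 1)" by simp
  then obtain c where c0: "a + 1 = 2 * c" by (elim evenE)
  have c: "(a + 1) * 2 ^ e = c * 2 ^ Suc e" unfolding c0 by simp
  have le: "(a + 1) * 2 ^ e \<le> b * 2 ^ e"
    using \<open>a < b\<close> by (intro mult_right_mono) auto
  \<comment> \<open>The next multiple (a + 1) * 2^e is divisible by 2^(e+1). The priorities of y and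
    x are too low for it to lie in either of their intervals, so it lies in between, in the interval
    of some u.\<close>
  have 1: "sz y < (a + 1) * 2 ^ e"
  proof (rule ccontr)
    assume "\<not> sz y < (a + 1) * 2 ^ e"
    moreover have "sz (hc y) < (a + 1) * 2 ^ e" using a(1) by (simp add: trans_less_add2)
    ultimately show False using noty c unfolding has_mult_def by (metis not_less)
  qed
  have 2: "(a + 1) * 2 ^ e \<le> sz (hc x)"
  proof (rule ccontr)
    assume "\<not> (a + 1) * 2 ^ e \<le> sz (hc x)"
    moreover have "(a + 1) * 2 ^ e \<le> sz x" using le b(2) by linarith
    ultimately show False using notx c unfolding has_mult_def by (metis not_less)
  qed
  have "hc x \<noteq> y" using 1 2 by auto
  then have hp: "(hc x, y) \<in> H\<^sup>+" using hxy by (meson rtranclD)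
  obtain u where u: "u \<in> seg (hc x) y" "Suc e \<le> ev u"
    using seg_locate_ev[OF hp] 1 2 c by metis
  have "(x, u) \<in> H\<^sup>+" using u(1) x by (auto simp: seg_def H_plus_hc)
  then show ?thesis using u by (auto simp: seg_def e_def)
qed

section \<open>Peaks of segments\<close>

definition peak :: "nat \<Rightarrow> nat \<Rightarrow> nat" where
  "peak v z = (SOME m. m \<in> seg v z \<and> (\<forall>x\<in>seg v z. x \<noteq> m \<longrightarrow> ev x < ev m))"

lemma peak_exists:
  assumes "(v, z) \<in> H\<^sup>+"
  shows "\<exists>m. m \<in> seg v z \<and> (\<forall>x\<in>seg v z. x \<noteq> m \<longrightarrow> ev x < ev m)"
proof -
  have "finite (ev ` seg v z)" "ev ` seg v z \<noteq> {}" using finite_seg seg_self[OF assms] by auto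
  then have "Max (ev ` seg v z) \<in> ev ` seg v z" by (rule Max_in)
  then obtain m where m: "m \<in> seg v z" "ev m = Max (ev ` seg v z)" by auto
  have le: "ev x \<le> ev m" if "x \<in> seg v z" for x
    using that finite_seg m(2) by simp
  \<comment> \<open>Segments are convex, so the node of higher priority between a and b would again
    belong to the segment.\<close>
  have between: False if "a \<in> seg v z" "b \<in> seg v z" "ev a = ev m" and *: "b \<in> V" "(a, b) \<in> H\<^sup>+" "ev a = ev b" for a b
  proof -
    obtain u where u: "(a, u) \<in> H\<^sup>+" "(u, b) \<in> H\<^sup>+" "ev a < ev u"
      using ev_between[OF *(2,1,3)] by blast
    have "u \<in> seg v z" using u that by (auto simp: seg_def)
    then show False using le[of u] u(3) that(3) by linarith
  qed
  have "ev x < ev m" if x: "x \<in> seg v z" "x \<noteq> m" for x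
  proof (rule ccontr)
    assume "\<not> ev x < ev m"
    then have "ev x = ev m" using le x by (simp add: le_antisym)
    moreover have "(x, m) \<in> H\<^sup>+ \<or> (m, x) \<in> H\<^sup>+"
      using H_down[of v x m] x m(1) by (auto simp: seg_def dest: rtranclD)
    ultimately show False using between[of x m] between[of m x] x m seg_V by metis
  qed
  then show ?thesis using m(1) by blast
qed

lemma peak_props:
  assumes "(v, z) \<in> H\<^sup>+"
  shows "peak v z \<in> seg v z" "\<And>x. x \<in> seg v z \<Longrightarrow> x \<noteq> peak v z \<Longrightarrow> ev x < ev (peak v z)"
  using someI_ex[OF peak_exists[OF assms]] unfolding peak_def[symmetric] by blast+

lemma peak_max:
  assumes "(v, z) \<in> H\<^sup>+" "x \<in> seg v z" shows "ev x \<le> ev (peak v z)"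
  using peak_props(2)[OF assms] by (cases "x = peak v z") auto

lemma peak_eqI:
  assumes "m \<in> seg v z" "\<And>x. x \<in> seg v z \<Longrightarrow> x \<noteq> m \<Longrightarrow> ev x < ev m"
  shows "peak v z = m"
proof -
  have "(v, z) \<in> H\<^sup>+" using assms(1) by (auto simp: seg_def)
  then show ?thesis using peak_props assms by (metis less_asym)
qed

lemma seg_hc: "v \<in> V \<Longrightarrow> seg v (hc v) = {v}"
proof (intro set_eqI iffI)
  fix x assume v: "v \<in> V" and "x \<in> seg v (hc v)"
  then have x: "(v, x) \<in> H\<^sup>*" "(x, hc v) \<in> H\<^sup>+" by (auto simp: seg_def)
  show "x \<in> {v}"
  proof (rule ccontr)
    assume "x \<notin> {v}"
    then have "(v, x) \<in> H\<^sup>+" using x by (auto dest: rtranclD)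
    then have "(hc v, x) \<in> H\<^sup>*" by (simp add: H_plus_hc)
    then show False using x H_acyclic by (meson rtrancl_trancl_trancl)
  qed
qed (auto simp: seg_def H_iff intro: r_into_trancl)

lemma peak_hc: "v \<in> V \<Longrightarrow> peak v (hc v) = v"
  by (rule peak_eqI) (auto simp: seg_hc)

text \<open>A pair \<open>(v, z)\<close> of nodes on a heavy path stands for the context pattern \<open>(v, z)\<close>, and
  \<open>(v, 0)\<close> for the subtree pattern \<open>v\<close>.\<close>

definition cov :: "nat \<times> nat \<Rightarrow> nat set" where
  "cov p = D (fst p) - D (snd p)"

text \<open>The normal form allows only binary splits, so the two cuts around the peak come one
  after the other: first above the peak, then, once the peak is the top node, below it. The second
  cut isolates the peak with its bag, whose light children start new heavy paths.\<close>

definition kids :: "nat \<times> nat \<Rightarrow> (nat \<times> nat) set" where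
  "kids p = (case p of (v, z) \<Rightarrow>
     if z = hc v then (\<lambda>u. (u, 0)) ` light v
     else if peak v z = v then {(v, hc v), (hc v, z)}
     else {(v, peak v z), (peak v z, z)})"

definition K :: "((nat \<times> nat) \<times> (nat \<times> nat)) set" where
  "K = {(p, q). q \<in> kids p}"

definition P0 :: "(nat \<times> nat) set" where
  "P0 = K\<^sup>* `` {(r, 0)}"

lemma H_plus_cases:
  assumes "(v, z) \<in> H\<^sup>+" "z \<noteq> hc v" shows "(v, hc v) \<in> H\<^sup>+" "(hc v, z) \<in> H\<^sup>+"
  using assms by (auto simp: H_plus_hc dest!: rtranclD)

lemma kids_cases:
  assumes "p \<in> H\<^sup>+"
  obtains (single) v where "v \<in> V" "p = (v, hc v)" "kids p = (\<lambda>u. (u, 0)) ` light v"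
  | (binary) v m z where "p = (v, z)" "z \<noteq> hc v" "(v, m) \<in> H\<^sup>+" "(m, z) \<in> H\<^sup>+" "m \<in> V"
      "kids p = {(v, m), (m, z)}" "m = (if peak v z = v then hc v else peak v z)"
proof -
  obtain v z where p: "p = (v, z)" by fastforce
  have vz: "(v, z) \<in> H\<^sup>+" using assms p by simp
  show ?thesis
  proof (cases "z = hc v")
    case True
    then show ?thesis using single[of v] p H_plus_V[OF vz] by (simp add: kids_def)
  next
    case False
    show ?thesis
    proof (cases "peak v z = v")
      case True
      then show ?thesis
        using binary[of v z "hc v"] p False H_plus_cases[OF vz False] H_plus_V by (simp add: kids_def)
    next
      case neq: False
      have "peak v z \<in> seg v z" by (rule peak_props(1)[OF vz])
      then have "(v, peak v z) \<in> H\<^sup>+" "(peak v z, z) \<in> H\<^sup>+"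
        using neq by (auto simp: seg_def dest: rtranclD)
      then show ?thesis
        using binary[of v z "peak v z"] p False neq H_plus_V by (simp add: kids_def)
    qed
  qed
qed

lemma kids_valid: "p \<in> H\<^sup>+ \<Longrightarrow> q \<in> kids p \<Longrightarrow> q \<in> H\<^sup>+"
  by (erule kids_cases) (auto intro: H_to_zero light_V)

lemma valid_fst_cov: "p \<in> H\<^sup>+ \<Longrightarrow> fst p \<in> cov p"
  by (cases p) (simp add: cov_def D_self H_plus_D H_plus_V)

lemma finite_cov [simp]: "finite (cov p)"
  by (simp add: cov_def)

lemma cov_single: "cov (v, hc v) = bag v"
  by (simp add: cov_def bag_def)

lemma cov_light: "cov (u, 0) = D u"
  by (simp add: cov_def)

lemma cov_binary:
  assumes "(v, m) \<in> H\<^sup>+" "(m, z) \<in> H\<^sup>+"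
  shows "cov (v, z) = cov (v, m) \<union> cov (m, z)" "cov (v, m) \<inter> cov (m, z) = {}"
  using H_D[of v m] H_D[of m z] assms by (auto simp: cov_def dest: trancl_into_rtrancl)

lemma kids_disjoint:
  assumes "p \<in> H\<^sup>+" "q \<in> kids p" "q' \<in> kids p" "q \<noteq> q'"
  shows "cov q \<inter> cov q' = {}"
  using assms(1)
proof (cases rule: kids_cases)
  case (single v)
  then obtain u u' where "u \<in> light v" "u' \<in> light v" "q = (u, 0)" "q' = (u', 0)" using assms by auto
  then show ?thesis using assms light_disjoint[of u v u'] by (simp add: cov_light)
next
  case (binary v m z)
  then show ?thesis using assms cov_binary(2)[of v m z] by auto
qed

lemma kids_psubset:
  assumes "p \<in> H\<^sup>+" "q \<in> kids p"
  shows "cov q \<subset> cov p"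
  using assms(1)
proof (cases rule: kids_cases)
  case (single v)
  then obtain u where u: "u \<in> light v" "q = (u, 0)" using assms by auto
  then have "D u \<subseteq> bag v" "v \<notin> D u" using light_bag self_notin_light by auto
  then show ?thesis using u single bag_self by (auto simp: cov_light cov_single)
next
  case (binary v m z)
  have "v \<in> cov (v, m)" "m \<in> cov (m, z)" using binary valid_fst_cov by fastforce+
  then show ?thesis
    using assms binary cov_binary[of v m z] by auto
qed

section \<open>The patterns form a laminar family\<close>

lemma K_valid: "(p, q) \<in> K\<^sup>* \<Longrightarrow> p \<in> H\<^sup>+ \<Longrightarrow> q \<in> H\<^sup>+"
  by (induction rule: rtrancl_induct) (auto simp: K_def intro: kids_valid)

lemma P0_valid: "p \<in> P0 \<Longrightarrow> p \<in> H\<^sup>+"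
  using K_valid H_to_zero r_V by (auto simp: P0_def)

lemma K_cov: "(p, q) \<in> K\<^sup>* \<Longrightarrow> p \<in> H\<^sup>+ \<Longrightarrow> cov q \<subseteq> cov p"
proof (induction rule: rtrancl_induct)
  case (step q q')
  then have "cov q' \<subset> cov q" using K_valid kids_psubset by (auto simp: K_def)
  then show ?case using step by blast
qed simp

text \<open>Follow both derivations from s. While they choose the same child nothing is decided; at
  the first difference they enter disjoint sets and never leave them.\<close>

lemma walk:
  assumes "(s, p) \<in> K\<^sup>*" "(s, q) \<in> K\<^sup>*" "s \<in> H\<^sup>+"
  shows "(p, q) \<in> K\<^sup>* \<or> (q, p) \<in> K\<^sup>* \<or> cov p \<inter> cov q = {}"
  using assms
proof (induction rule: converse_rtrancl_induct)
  case base then show ?case by blast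
next
  case (step s s1)
  have s1: "s1 \<in> H\<^sup>+" using step by (meson K_valid r_into_rtrancl)
  from step.prems(1) show ?case
  proof (cases rule: converse_rtranclE)
    case base
    then show ?thesis using step.hyps by (meson converse_rtrancl_into_rtrancl)
  next
    case (step s2)
    have s2: "s2 \<in> H\<^sup>+" using step(1) \<open>s \<in> H\<^sup>+\<close> by (meson K_valid r_into_rtrancl)
    show ?thesis
    proof (cases "s1 = s2")
      case True then show ?thesis using step.IH step s1 by blast
    next
      case False
      have "cov s1 \<inter> cov s2 = {}"
        using kids_disjoint[OF \<open>s \<in> H\<^sup>+\<close>, of s1 s2] False step(1) \<open>(s, s1) \<in> K\<close> by (simp add: K_def)
      then show ?thesis using K_cov[OF \<open>(s1, p) \<in> K\<^sup>*\<close> s1] K_cov[OF step(2) s2] by blast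
    qed
  qed
qed

lemma P0_walk:
  assumes "p \<in> P0" "q \<in> P0"
  shows "(p, q) \<in> K\<^sup>* \<or> (q, p) \<in> K\<^sup>* \<or> cov p \<inter> cov q = {}"
  using walk[of "(r, 0)" p q] assms H_to_zero r_V by (auto simp: P0_def)

lemma P0_K: "p \<in> P0 \<Longrightarrow> (p, q) \<in> K\<^sup>* \<Longrightarrow> q \<in> P0"
  by (auto simp: P0_def)

text \<open>Proper descendants cover strictly less and no covered set is empty, so inclusion can be
  read off the recursion.\<close>

lemma P0_subset_iff:
  assumes "p \<in> P0" "q \<in> P0"
  shows "cov q \<subseteq> cov p \<longleftrightarrow> (p, q) \<in> K\<^sup>*"
proof
  assume sub: "cov q \<subseteq> cov p"
  have q: "q \<in> H\<^sup>+" using assms P0_valid by simp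
  have "cov q \<noteq> {}" using valid_fst_cov[OF q] by blast
  then consider "(p, q) \<in> K\<^sup>*" | "(q, p) \<in> K\<^sup>*" using P0_walk[OF assms] sub by blast
  then show "(p, q) \<in> K\<^sup>*"
  proof cases
    case 2
    show ?thesis
    proof (cases "q = p")
      case False
      then obtain q' where "(q, q') \<in> K" "(q', p) \<in> K\<^sup>*" using 2 by (metis converse_rtranclE)
      then have "cov p \<subset> cov q"
        using kids_psubset[OF q, of q'] K_cov[of q' p] kids_valid[OF q, of q'] by (auto simp: K_def)
      then show ?thesis using sub by blast
    qed simp
  qed
next
  assume "(p, q) \<in> K\<^sup>*"
  then show "cov q \<subseteq> cov p" using K_cov assms P0_valid by blast
qed

text \<open>\<open>pattern_less\<close> excludes equal patterns, not equal covered sets; injectivity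
  turns it into proper inclusion.\<close>

lemma P0_cov_inj: "p \<in> P0 \<Longrightarrow> q \<in> P0 \<Longrightarrow> cov p = cov q \<Longrightarrow> p = q"
proof -
  assume pq: "p \<in> P0" "q \<in> P0" "cov p = cov q"
  then have "(p, q) \<in> K\<^sup>*" using P0_subset_iff by blast
  then show ?thesis
  proof (cases rule: converse_rtranclE)
    case (step p')
    have p: "p \<in> H\<^sup>+" using pq P0_valid by simp
    have "cov p' \<subset> cov p" using step(1) kids_psubset[OF p] by (simp add: K_def)
    moreover have "cov q \<subseteq> cov p'"
      using step kids_valid[OF p] by (intro K_cov) (auto simp: K_def)
    ultimately show ?thesis using pq by blast
  qed simp
qed

lemma kids_direct:
  assumes p: "p \<in> P0"
  shows "{q \<in> P0. cov q \<subset> cov p \<and> \<not> (\<exists>x\<in>P0. cov q \<subset> cov x \<and> cov x \<subset> cov p)} = kids p"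
proof (intro set_eqI iffI)
  fix q assume "q \<in> {q \<in> P0. cov q \<subset> cov p \<and> \<not> (\<exists>x\<in>P0. cov q \<subset> cov x \<and> cov x \<subset> cov p)}"
  then have q: "q \<in> P0" "cov q \<subset> cov p" and no: "\<And>x. x \<in> P0 \<Longrightarrow> cov q \<subset> cov x \<Longrightarrow> \<not> cov x \<subset> cov p"
    by blast+
  have "(p, q) \<in> K\<^sup>*" "p \<noteq> q" using P0_subset_iff p q by blast+
  then obtain q' where q': "(p, q') \<in> K" "(q', q) \<in> K\<^sup>*" by (metis converse_rtranclE)
  have "q' \<in> P0" using p q' P0_K by blast
  moreover have "cov q' \<subset> cov p" using kids_psubset p P0_valid q' by (auto simp: K_def)
  ultimately have "\<not> cov q \<subset> cov q'" using no by blast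
  then have "cov q = cov q'" using K_cov q' \<open>q' \<in> P0\<close> P0_valid by blast
  then have "q = q'" using q(1) \<open>q' \<in> P0\<close> by (rule P0_cov_inj[rotated 2])
  then show "q \<in> kids p" using q'(1) by (simp add: K_def)
next
  fix q assume q: "q \<in> kids p"
  then have "(p, q) \<in> K\<^sup>*" by (auto simp: K_def)
  then have qP: "q \<in> P0" by (rule P0_K[OF p])
  have qp: "cov q \<subset> cov p" using kids_psubset p P0_valid q by blast
  moreover have "\<not> (cov q \<subset> cov x \<and> cov x \<subset> cov p)" if x: "x \<in> P0" for x
  proof
    assume a: "cov q \<subset> cov x \<and> cov x \<subset> cov p"
    then have "(p, x) \<in> K\<^sup>*" "p \<noteq> x" using P0_subset_iff p x by blast+
    then obtain q' where q': "(p, q') \<in> K" "(q', x) \<in> K\<^sup>*" by (metis converse_rtranclE)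
    have q'P: "q' \<in> P0" using p q' P0_K by blast
    have "cov x \<subseteq> cov q'" using K_cov q' q'P P0_valid by blast
    moreover have "cov q \<noteq> {}" using valid_fst_cov qP P0_valid by blast
    ultimately have "\<not> cov q \<inter> cov q' = {}" using a by blast
    then have "q = q'"
      using kids_disjoint[OF P0_valid[OF p] q, of q'] q'(1) by (auto simp: K_def)
    then show False using \<open>cov x \<subseteq> cov q'\<close> a by blast
  qed
  ultimately show "q \<in> {q \<in> P0. cov q \<subset> cov p \<and> \<not> (\<exists>x\<in>P0. cov q \<subset> cov x \<and> cov x \<subset> cov p)}"
    using qP by blast
qed

section \<open>A first-order characterization of the patterns\<close>

text \<open>z is the first path node below the segment. Cuts are made in the order of decreasing
  priority, so a cut at z that precedes the one at m requires this inequality; z = 0 is the natural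
  end of the path.\<close>

definition zmax :: "nat \<Rightarrow> nat \<Rightarrow> bool" where
  "zmax z m \<longleftrightarrow> z = 0 \<or> ev m \<le> ev z"

text \<open>The same condition for the path node just above v; it is vacuous if v is the root or a
  light child.\<close>

definition vmax :: "nat \<Rightarrow> nat \<Rightarrow> bool" where
  "vmax v m \<longleftrightarrow> (\<forall>x. hc x = v \<longrightarrow> ev m \<le> ev x)"

text \<open>Three kinds of patterns have peak m: m with its bag alone, the part from m on that
  remains after the cut above the peak, and an untouched segment bounded on both sides.\<close>

definition shape :: "nat \<Rightarrow> nat \<Rightarrow> nat \<Rightarrow> bool" where
  "shape v z m \<longleftrightarrow> (v = m \<and> z = hc m) \<or> (zmax z m \<and> (v = m \<or> vmax v m))"

lemma seg_lower: "(v, x) \<in> H\<^sup>* \<Longrightarrow> seg x z \<subseteq> seg v z"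
  by (auto simp: seg_def)

lemma seg_upper: "(m, z) \<in> H\<^sup>* \<Longrightarrow> seg v m \<subseteq> seg v z"
  by (auto simp: seg_def)

lemma peak_lower:
  assumes "(v, z) \<in> H\<^sup>+" shows "peak (peak v z) z = peak v z"
proof (rule peak_eqI)
  have m: "peak v z \<in> seg v z" using peak_props(1)[OF assms] .
  then show "peak v z \<in> seg (peak v z) z" by (auto simp: seg_def)
  fix x assume "x \<in> seg (peak v z) z" "x \<noteq> peak v z"
  moreover from this have "x \<in> seg v z" using seg_lower[of v "peak v z" z] m by (auto simp: seg_def)
  ultimately show "ev x < ev (peak v z)" using peak_props(2)[OF assms] by blast
qed

lemma full_light: "u \<in> light v \<Longrightarrow> zmax 0 (peak u 0) \<and> vmax u (peak u 0)"
  using light_not_hc by (auto simp: zmax_def vmax_def)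

lemma full_hc:
  assumes "(v, z) \<in> H\<^sup>+" "z \<noteq> hc v" "peak v z = v" "zmax z v"
  shows "zmax z (peak (hc v) z) \<and> vmax (hc v) (peak (hc v) z)"
proof -
  have vz: "(hc v, z) \<in> H\<^sup>+" using H_plus_cases assms by blast
  define m where "m = peak (hc v) z"
  have m: "m \<in> seg (hc v) z" using peak_props(1)[OF vz] by (simp add: m_def)
  have v: "(v, hc v) \<in> H\<^sup>+" using H_plus_cases assms by blast
  have "m \<noteq> v" using m v H_acyclic unfolding seg_def
    by (metis (no_types, lifting) mem_Collect_eq trancl_rtrancl_trancl)
  moreover have "m \<in> seg v z" using m v seg_lower by (meson subsetD trancl_into_rtrancl)
  ultimately have "ev m < ev v" using peak_props(2)[OF assms(1)] assms(3) by metis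
  moreover have "x = v" if "hc x = hc v" for x
    using that hc_inj H_plus_V[OF vz] V_nz by metis
  ultimately have "vmax (hc v) m" by (auto simp: vmax_def dest: less_imp_le)
  then show ?thesis using assms(4) \<open>ev m < ev v\<close> unfolding m_def[symmetric] by (auto simp: zmax_def)
qed

lemma full_peak:
  assumes "(v, z) \<in> H\<^sup>+" "peak v z \<noteq> v" "vmax v (peak v z)"
  shows "zmax (peak v z) (peak v (peak v z)) \<and> vmax v (peak v (peak v z))"
proof -
  define m where "m = peak v z"
  have m: "m \<in> seg v z" using peak_props(1)[OF assms(1)] by (simp add: m_def)
  then have vm: "(v, m) \<in> H\<^sup>+" using assms(2) by (auto simp: seg_def m_def dest: rtranclD)
  have m': "peak v m \<in> seg v m" using peak_props(1)[OF vm] .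
  then have "peak v m \<noteq> m" using H_acyclic by (auto simp: seg_def)
  moreover have "peak v m \<in> seg v z" using m' m seg_upper[of m z v] by (auto simp: seg_def)
  ultimately have "ev (peak v m) < ev m" using peak_props(2)[OF assms(1)] m_def by metis
  then show ?thesis using assms(3) unfolding m_def[symmetric] by (fastforce simp: zmax_def vmax_def)
qed

text \<open>An invariant of the recursion: a new end of a segment arises next to a peak, which
  dominates everything that remains, and a light subtree is a whole path with no neighbours
  outside.\<close>

lemma P0_shape: "(v, z) \<in> P0 \<Longrightarrow> shape v z (peak v z)"
proof -
  have "case p of (v, z) \<Rightarrow> shape v z (peak v z)" if "((r, 0), p) \<in> K\<^sup>*" for p
    using that
  proof (induction rule: rtrancl_induct)
    case base
    have "hc x \<noteq> r" for x using r_top hc_edge r_V V_nz by metis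
    then show ?case by (auto simp: shape_def zmax_def vmax_def)
  next
    case (step p q)
    have p: "p \<in> H\<^sup>+" using step.hyps(1) K_valid H_to_zero r_V by blast
    have q: "q \<in> kids p" using step.hyps(2) by (simp add: K_def)
    from p show ?case
    proof (cases rule: kids_cases)
      case (single v)
      then obtain u where "u \<in> light v" "q = (u, 0)" using q by auto
      then show ?thesis using full_light by (simp add: shape_def)
    next
      case (binary v m z)
      have vz: "(v, z) \<in> H\<^sup>+" using p binary by simp
      have sh: "zmax z (peak v z) \<and> (v = peak v z \<or> vmax v (peak v z))"
        using step.IH binary by (auto simp: shape_def)
      show ?thesis
      proof (cases "peak v z = v")
        case True
        then have "m = hc v" "zmax z v" using binary sh by auto
        then have "zmax z (peak (hc v) z) \<and> vmax (hc v) (peak (hc v) z)" "peak v (hc v) = v"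
          using full_hc[OF vz binary(2) True] peak_hc H_plus_V[OF vz] by auto
        then show ?thesis using q binary(6) \<open>m = hc v\<close> by (auto simp: shape_def)
      next
        case False
        then have m: "m = peak v z" using binary by simp
        have "vmax v (peak v z)" using sh False by auto
        then have "zmax m (peak v m) \<and> vmax v (peak v m)" using full_peak[OF vz False] m by simp
        moreover have "peak m z = m" using peak_lower[OF vz] m by simp
        ultimately show ?thesis using q binary(6) sh m by (auto simp: shape_def)
      qed
    qed
  qed
  then show "(v, z) \<in> P0 \<Longrightarrow> shape v z (peak v z)" by (auto simp: P0_def)
qed

text \<open>If z came before z', it would be an inner node of the longer segment, so its priority
  would be below that of the peak m, against \<open>zmax\<close>.\<close>

lemma lower_end_unique:
  assumes "(m, z) \<in> H\<^sup>+" "(m, z') \<in> H\<^sup>+" "peak m z = m" "peak m z' = m" "zmax z m" "zmax z' m"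
  shows "z = z'"
proof -
  have *: False if "(m, a) \<in> H\<^sup>+" "(m, b) \<in> H\<^sup>+" "(a, b) \<in> H\<^sup>+" "peak m b = m" "zmax a m" for a b
  proof -
    have "a \<in> seg m b" using that by (auto simp: seg_def)
    moreover have "a \<noteq> m" using that(1) H_acyclic by blast
    ultimately have "ev a < ev m" using peak_props(2)[OF that(2)] that(4) by metis
    moreover have "a \<noteq> 0" using H_plus_V[OF that(3)] V_nz by blast
    ultimately show False using that(5) by (simp add: zmax_def)
  qed
  have "(m, z) \<in> H\<^sup>*" "(m, z') \<in> H\<^sup>*" using assms(1,2) by auto
  then have "(z, z') \<in> H\<^sup>* \<or> (z', z) \<in> H\<^sup>*" by (rule H_down)
  then show ?thesis using * assms by (metis rtranclD)
qed

text \<open>Mirror image: the node just above the lower of two different starts would lie in the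
  other segment.\<close>

lemma upper_end_unique:
  assumes "m \<in> seg v z" "m \<in> seg v' z'" "peak v z = m" "peak v' z' = m" "vmax v m" "vmax v' m"
  shows "v = v'"
proof -
  have *: False if ab: "(a, b) \<in> H\<^sup>+" and peak: "peak a c = m" "m \<in> seg a c" and m: "m \<in> seg b d" and "vmax b m" for a b c d
  proof -
    obtain x where x: "(a, x) \<in> H\<^sup>*" "b = hc x" "x \<in> V" using ab by (metis H_iff tranclD2)
    have bm: "(b, m) \<in> H\<^sup>*" using m by (simp add: seg_def)
    then have xm: "(x, m) \<in> H\<^sup>+" using x by (simp add: H_plus_hc)
    then have "x \<in> seg a c" using x peak(2) by (auto simp: seg_def)
    moreover have "x \<noteq> m" using xm H_acyclic by blast
    moreover have "(a, c) \<in> H\<^sup>+" using peak(2) by (auto simp: seg_def)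
    ultimately have "ev x < ev m" using peak_props(2) peak(1) by metis
    then show False using that(5) x by (auto simp: vmax_def)
  qed
  have "(v, m) \<in> H\<^sup>*" "(v', m) \<in> H\<^sup>*" "m \<noteq> 0"
    using assms(1,2) seg_V V_nz by (auto simp: seg_def)
  then have "(v, v') \<in> H\<^sup>* \<or> (v', v) \<in> H\<^sup>*" by (rule H_up)
  then show ?thesis using * assms by (metis rtranclD)
qed

text \<open>Descend from an untouched pattern towards m. If its peak a differs from m, then m lies
  above a, below a light child of a, or further down the path, and each of these parts is again an
  untouched, smaller pattern. Once a = m, uniqueness of the ends leaves only the three patterns
  around this peak.\<close>

lemma shape_in_P0_aux:
  assumes "(v, z) \<in> P0" "zmax z (peak v z)" "vmax v (peak v z)" "m \<in> cov (v, z)"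
    "(v', z') \<in> H\<^sup>+" "peak v' z' = m" "shape v' z' m"
  shows "(v', z') \<in> P0"
  using assms
proof (induction "card (cov (v, z))" arbitrary: v z rule: less_induct)
  case less
  define a where "a = peak v z"
  have vz: "(v, z) \<in> H\<^sup>+" using less.prems(1) P0_valid by blast
  have a: "a \<in> seg v z" using peak_props(1)[OF vz] by (simp add: a_def)
  have aV: "a \<in> V" using a seg_V by blast
  have az: "(a, z) \<in> H\<^sup>+" and va: "v \<noteq> a \<Longrightarrow> (v, a) \<in> H\<^sup>+"
    using a by (auto simp: seg_def dest: rtranclD)
  have ama: "peak a z = a" using peak_lower[OF vz] by (simp add: a_def)
  have vkids: "(v, a) \<in> kids (v, z) \<and> (a, z) \<in> kids (v, z)" if "v \<noteq> a"
  proof -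
    have "z \<noteq> hc v"
      using that peak_hc[OF H_plus_V[OF vz]] by (auto simp: a_def)
    then show ?thesis using that by (auto simp: kids_def a_def)
  qed
  have azP: "(a, z) \<in> P0"
  proof (cases "v = a")
    case False
    then show ?thesis using vkids P0_K[OF less.prems(1)] by (auto simp: K_def)
  qed (use less.prems in simp)
  have ahP: "(a, hc a) \<in> P0"
  proof (cases "z = hc a")
    case False
    then have "(a, hc a) \<in> kids (a, z)" using ama by (auto simp: kids_def)
    then show ?thesis using P0_K[OF azP] by (auto simp: K_def)
  qed (use azP in simp)
  have sub: "cov (a, z) \<subseteq> cov (v, z)" "cov (a, hc a) \<subseteq> cov (a, z)"
    using H_D[of v a] a H_D[of "hc a" z] az by (auto simp: cov_def seg_def H_plus_hc)
  show ?case
  proof (cases "m = a")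
    case True
    have m': "m \<in> seg v' z'" using peak_props(1)[OF less.prems(5)] less.prems(6) by simp
    show ?thesis
    proof (cases "v' = m \<and> z' = hc m")
      case True then show ?thesis using ahP \<open>m = a\<close> by simp
    next
      case False
      then have sh: "zmax z' m" "v' = m \<or> vmax v' m" using less.prems(7) by (auto simp: shape_def)
      have "peak m z' = m" using peak_lower[OF less.prems(5)] less.prems(6) by simp
      moreover have "(m, z') \<in> H\<^sup>+" using m' by (simp add: seg_def)
      ultimately have zz: "z = z'"
        using lower_end_unique[of m z z'] az \<open>m = a\<close> sh ama less.prems(2) a_def by metis
      show ?thesis
      proof (cases "v' = m")
        case True then show ?thesis using azP zz \<open>m = a\<close> by simp
      next
        case False
        then have "v' = v"
          using upper_end_unique[of m v' z' v z] sh m' a \<open>m = a\<close> less.prems(3,6) a_def by metis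
        then show ?thesis using less.prems(1) zz by simp
      qed
    qed
  next
    case neq: False
    have IH: "(v', z') \<in> P0" if "(x, y) \<in> P0" "cov (x, y) \<subset> cov (v, z)" "m \<in> cov (x, y)"
      "zmax y (peak x y) \<and> vmax x (peak x y)" for x y
      using less.hyps[of x y] that less.prems(5-7) by (simp add: psubset_card_mono)
    consider "m \<in> cov (v, a)" | "m \<in> cov (a, z)"
      using less.prems(4) by (auto simp: cov_def)
    then show ?thesis
    proof cases
      case 1
      then have ne: "v \<noteq> a" by (auto simp: cov_def)
      show ?thesis
      proof (rule IH[OF _ _ 1])
        show "(v, a) \<in> P0" using vkids[OF ne] P0_K[OF less.prems(1)] by (auto simp: K_def)
        show "cov (v, a) \<subset> cov (v, z)" using kids_psubset[OF vz] vkids[OF ne] by blast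
        show "zmax a (peak v a) \<and> vmax v (peak v a)"
          using full_peak[OF vz] ne less.prems(3) by (simp add: a_def)
      qed
    next
      case 2
      show ?thesis
      proof (cases "m \<in> bag a")
        case True
        then obtain u where u: "u \<in> light a" "m \<in> D u" using neq aV by (auto simp: bag_eq)
        show ?thesis
        proof (rule IH)
          have k: "(u, 0) \<in> kids (a, hc a)" using u by (auto simp: kids_def)
          then show "(u, 0) \<in> P0" using P0_K[OF ahP] by (auto simp: K_def)
          show "cov (u, 0) \<subset> cov (v, z)"
            using kids_psubset[OF P0_valid[OF ahP] k] sub by blast
          show "m \<in> cov (u, 0)" using u by (simp add: cov_light)
          show "zmax 0 (peak u 0) \<and> vmax u (peak u 0)" using full_light u by blast
        qed
      next
        case False
        then have m: "m \<in> cov (hc a, z)" using 2 by (auto simp: cov_def bag_def)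
        then have nz: "z \<noteq> hc a" by (auto simp: cov_def)
        have k: "(hc a, z) \<in> kids (a, z)" using ama nz by (auto simp: kids_def)
        show ?thesis
        proof (rule IH[OF _ _ m])
          show "(hc a, z) \<in> P0" using P0_K[OF azP] k by (auto simp: K_def)
          show "cov (hc a, z) \<subset> cov (v, z)" using kids_psubset[OF az k] sub by blast
          show "zmax z (peak (hc a) z) \<and> vmax (hc a) (peak (hc a) z)"
            using full_hc[OF az nz ama] less.prems(2) by (simp add: a_def)
        qed
      qed
    qed
  qed
qed

text \<open>The descent can start at (r, 0), which covers every possible peak and satisfies both end
  conditions vacuously. The right-hand side bears no trace of the recursion.\<close>

lemma P0_iff: "(v, z) \<in> P0 \<longleftrightarrow> (v, z) \<in> H\<^sup>+ \<and> shape v z (peak v z)"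
proof
  assume "(v, z) \<in> H\<^sup>+ \<and> shape v z (peak v z)"
  moreover have "(r, 0) \<in> P0" by (simp add: P0_def)
  moreover have "hc x \<noteq> r" for x using r_top hc_edge r_V V_nz by metis
  then have "zmax 0 (peak r 0)" "vmax r (peak r 0)" by (auto simp: zmax_def vmax_def)
  moreover have "peak v z \<in> cov (r, 0)" if "(v, z) \<in> H\<^sup>+"
    using peak_props(1)[OF that] seg_V by (simp add: cov_def D_root)
  ultimately show "(v, z) \<in> P0" using shape_in_P0_aux by blast
qed (use P0_valid P0_shape in blast)

text \<open>Here the peak is quantified instead of chosen, as a formula requires.\<close>

lemma P0_iff_ex:
  "(v, z) \<in> P0 \<longleftrightarrow> (\<exists>m\<in>seg v z. (\<forall>x\<in>seg v z. x \<noteq> m \<longrightarrow> ev x < ev m) \<and> shape v z m)"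
proof
  assume "(v, z) \<in> P0"
  then show "\<exists>m\<in>seg v z. (\<forall>x\<in>seg v z. x \<noteq> m \<longrightarrow> ev x < ev m) \<and> shape v z m"
    using P0_iff peak_props by blast
next
  assume "\<exists>m\<in>seg v z. (\<forall>x\<in>seg v z. x \<noteq> m \<longrightarrow> ev x < ev m) \<and> shape v z m"
  then obtain m where m: "m \<in> seg v z" "\<And>x. x \<in> seg v z \<Longrightarrow> x \<noteq> m \<Longrightarrow> ev x < ev m" "shape v z m" by blast
  then have "peak v z = m" by (intro peak_eqI) auto
  then show "(v, z) \<in> P0" using m P0_iff by (auto simp: seg_def)
qed


section \<open>Depth\<close>

text \<open>Cutting at the node of maximal priority lowers the first summand, and passing to a light child
  lowers the second one; the last summand counts the steps in between, hence the factors 3.\<close>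

definition pot :: "nat \<times> nat \<Rightarrow> nat" where
  "pot p = (case p of (v, z) \<Rightarrow> 3 * ev (peak v z) + 3 * floor_log (sz v) +
     (if z = hc v then 0 else if peak v z = v then 1 else 2))"

lemma pot_kids:
  assumes "p \<in> H\<^sup>+" "q \<in> kids p" shows "pot q < pot p"
  using assms(1)
proof (cases rule: kids_cases)
  case (single v)
  then obtain u where u: "u \<in> light v" "q = (u, 0)" using assms(2) by auto
  have uV: "u \<in> V" using u light_V by blast
  let ?m = "peak u 0"
  let ?e = "ev ?m"
  have m: "?m \<in> seg u 0" using peak_props(1) H_to_zero uV by blast
  then have "2 ^ ?e \<le> sz ?m" using ev_le seg_V by blast
  also have "sz ?m \<le> sz u" using m H_star_sz by (auto simp: seg_def)
  also have "sz u < weight v" using light_less_weight u by blast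
  finally have wv: "2 ^ ?e < weight v" .
  \<comment> \<open>The interval of v has length \<open>weight v\<close>, which exceeds 2^e for the
    priority e of the peak below the light edge. Hence it contains a multiple of 2^e, and the first
    summand does not grow along the edge.\<close>
  define c where "c = sz v div 2 ^ ?e"
  have c: "c * 2 ^ ?e \<le> sz v" "sz v < c * 2 ^ ?e + 2 ^ ?e"
    unfolding c_def using dividend_less_div_times[of "2 ^ ?e" "sz v"] by (simp_all add: add.commute)
  then have "sz (hc v) < c * 2 ^ ?e" using wv by linarith
  then have "has_mult ?e v" using c unfolding has_mult_def by blast
  then have e: "?e \<le> ev v" by (rule has_mult_le_ev)
  \<comment> \<open>Halving the size lowers the logarithm by one, and the 3 gained pay for the at
    most 2 in the last summand.\<close>
  have "floor_log (2 * sz u) \<le> floor_log (sz v)"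
    using light_half[OF u(1)] by (intro floor_log_le_iff) simp
  moreover have "floor_log (2 * sz u) = Suc (floor_log (sz u))"
    using sz_pos[OF uV] by (rule floor_log_twice[OF less_imp_neq[symmetric]])
  moreover have "pot q \<le> 3 * ?e + 3 * floor_log (sz u) + 2" using u by (simp add: pot_def)
  moreover have "pot p = 3 * ev v + 3 * floor_log (sz v)" using single peak_hc by (simp add: pot_def)
  ultimately show ?thesis using e by linarith
next
  case (binary v m z)
  have vz: "(v, z) \<in> H\<^sup>+" using assms binary by simp
  let ?a = "peak v z"
  have a: "?a \<in> seg v z" using peak_props(1)[OF vz] .
  have mono: "floor_log (sz m) \<le> floor_log (sz v)"
    using binary(3) by (intro floor_log_le_iff H_star_sz trancl_into_rtrancl)
  \<comment> \<open>The half without the peak loses at least 3 in the first summand. The half with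
    the peak goes down in the last one, from 2 to at most 1 or from 1 to 0.\<close>
  have less: "ev (peak x y) < ev ?a" if "(x, y) \<in> H\<^sup>+" "seg x y \<subseteq> seg v z" "?a \<notin> seg x y" for x y
    using peak_props(1)[OF that(1)] that by (intro peak_props(2)[OF vz]) auto
  show ?thesis
  proof (cases "?a = v")
    case True
    then have m: "m = hc v" using binary by simp
    have "v \<notin> seg m z"
      using binary(3) H_acyclic unfolding seg_def by (metis (no_types, lifting) mem_Collect_eq trancl_rtrancl_trancl)
    then have "ev (peak m z) < ev ?a"
      using less[OF binary(4) seg_lower[OF trancl_into_rtrancl[OF binary(3)]]] True by simp
    moreover have "peak v m = v" using m peak_hc H_plus_V[OF vz] by simp
    ultimately show ?thesis using assms(2) binary mono True m by (auto simp: pot_def)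
  next
    case False
    then have m: "m = ?a" using binary by simp
    have "m \<notin> seg v m" using H_acyclic by (auto simp: seg_def)
    then have "ev (peak v m) < ev ?a"
      using less[OF binary(3) seg_upper[OF trancl_into_rtrancl[OF binary(4)]]] m by simp
    moreover have "peak m z = m" using peak_lower[OF vz] m by simp
    ultimately show ?thesis using assms(2) binary mono False m by (auto simp: pot_def)
  qed
qed

lemma pot_path: "(p, q) \<in> K ^^ j \<Longrightarrow> p \<in> H\<^sup>+ \<Longrightarrow> j + pot q \<le> pot p"
proof (induction j arbitrary: q)
  case (Suc j)
  then obtain x where x: "(p, x) \<in> K ^^ j" "(x, q) \<in> K" by auto
  then have "x \<in> H\<^sup>+" using K_valid Suc.prems(2) by (metis relpow_imp_rtrancl)
  then have "pot q < pot x" using x(2) pot_kids by (simp add: K_def)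
  then show ?case using Suc.IH[OF x(1) Suc.prems(2)] by simp
qed simp

lemma pot_root: "pot (r, 0) \<le> 6 * floor_log (card V) + 2"
proof -
  have "peak r 0 \<in> V" using peak_props(1) H_to_zero r_V seg_V by blast
  then have "2 ^ ev (peak r 0) \<le> card V" using ev_le sz_le by (meson order_trans)
  then have "floor_log (2 ^ ev (peak r 0)) \<le> floor_log (card V)" by (rule floor_log_le_iff)
  then have "ev (peak r 0) \<le> floor_log (card V)" by simp
  moreover have "pot (r, 0) \<le> 3 * ev (peak r 0) + 3 * floor_log (card V) + 2"
    by (simp add: pot_def D_root)
  ultimately show ?thesis by linarith
qed


section \<open>Counting the large patterns\<close>

text \<open>With e the priority of the peak, 2^(e+1) consecutive numbers would include a multiple of
  2^(e+1), which lies in the interval of a node of the segment with higher priority.\<close>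

lemma card_cov_less:
  assumes "(v, z) \<in> H\<^sup>+" shows "card (cov (v, z)) < 2 ^ Suc (ev (peak v z))"
proof (rule ccontr)
  let ?d = "2 ^ Suc (ev (peak v z)) :: nat"
  assume "\<not> card (cov (v, z)) < ?d"
  moreover have "card (cov (v, z)) = sz v - sz z"
    using H_D[of v z] trancl_into_rtrancl[OF assms] by (simp add: cov_def card_Diff_subset)
  moreover have "sz v div ?d * ?d \<le> sz v" "sz v < sz v div ?d * ?d + ?d"
    using dividend_less_div_times[of ?d "sz v"] by (simp_all add: add.commute)
  moreover have "0 < ?d" by simp
  ultimately have "sz z < sz v div ?d * ?d" "sz v div ?d * ?d \<le> sz v" by linarith+
  then obtain x where "x \<in> seg v z" "Suc (ev (peak v z)) \<le> ev x" using seg_locate_ev[OF assms] by blast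
  then show False using peak_max[OF assms] by force
qed

text \<open>Every large light child is charged to the lowest large node on its heavy path.\<close>

lemma card_light:
  "card {u. (\<exists>v. u \<in> light v) \<and> t \<le> sz u} * t \<le> card V"
proof (cases "t = 0")
  case False
  let ?L = "{u. (\<exists>v. u \<in> light v) \<and> t \<le> sz u}"
  have "\<exists>x. (u, x) \<in> H\<^sup>* \<and> x \<in> V \<and> sz (hc x) < t \<and> t \<le> sz x" if "u \<in> ?L" for u
  proof -
    have "u \<in> V" "t \<le> sz u" using that light_V by blast+
    then obtain x where "x \<in> seg u 0" "sz (hc x) < t" "t \<le> sz x"
      using seg_locate[of u 0 t] False H_to_zero by auto
    then show ?thesis using seg_V unfolding seg_def by blast
  qed
  then have "\<forall>u\<in>?L. \<exists>x. (u, x) \<in> H\<^sup>* \<and> x \<in> V \<and> sz (hc x) < t \<and> t \<le> sz x" by blast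
  from bchoice[OF this] obtain g where
    g: "\<And>u. u \<in> ?L \<Longrightarrow> (u, g u) \<in> H\<^sup>* \<and> g u \<in> V \<and> sz (hc (g u)) < t \<and> t \<le> sz (g u)"
    by blast
  \<comment> \<open>The charged nodes have size at least t but only smaller children, so they are
    incomparable and their subtrees are disjoint. Two light children charged to the same node would
    both be the top of its path.\<close>
  have same: "a = b" if *: "sz (hc b) < t" "t \<le> sz a" "a \<in> D b" for a b
  proof (rule ccontr)
    assume "a \<noteq> b"
    then obtain c where "(b, c) \<in> E" "a \<in> D c" using D_child[OF *(3)] by blast
    then have "sz a \<le> sz (hc b)" using sz_mono hc_max by (meson order_trans)
    then show False using * by simp
  qed
  have inj: "u = u'" if *: "u \<in> ?L" "u' \<in> ?L" "D (g u) \<inter> D (g u') \<noteq> {}" for u u'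
  proof -
    obtain x where "x \<in> D (g u)" "x \<in> D (g u')" using *(3) by blast
    then have "g u \<in> D (g u') \<or> g u' \<in> D (g u)" by (rule D_linear)
    then have eq: "g u = g u'" using same[of "g u'" "g u"] same[of "g u" "g u'"] g[OF *(1)] g[OF *(2)] by auto
    have "(u, u') \<in> H\<^sup>* \<or> (u', u) \<in> H\<^sup>*"
      using H_up[of u "g u" u'] g[OF *(1)] g[OF *(2)] eq V_nz by auto
    then show ?thesis using H_into_light * by blast
  qed
  have finL: "finite ?L" by (rule finite_subset[OF _ fin]) (auto intro: light_V)
  have "card ?L * t = (\<Sum>u\<in>?L. t)" by simp
  also have "\<dots> \<le> (\<Sum>u\<in>?L. sz (g u))" using g by (intro sum_mono) auto
  also have "\<dots> = card (\<Union>u\<in>?L. D (g u))"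
    using finL inj by (intro card_UN_disjoint[symmetric]) auto
  also have "\<dots> \<le> card V" using D_subset_V fin by (intro card_mono) auto
  finally show ?thesis .
qed simp

text \<open>A bag of t nodes consists of its top and at most k light subtrees, one of which has at
  least (t - 1) div k nodes. Distinct tops give distinct light children, so
  \<open>card_light\<close> applies.\<close>

lemma card_heavy_bags:
  assumes deg: "\<And>v. card {u. (v, u) \<in> E} \<le> k" and k: "k \<ge> 1"
  shows "card {i \<in> V. t \<le> weight i} * ((t - 1) div k) \<le> card V"
proof (cases "(t - 1) div k = 0")
  case False
  define \<tau> where "\<tau> = (t - 1) div k"
  let ?B = "{i \<in> V. t \<le> weight i}"
  let ?L = "{u. (\<exists>v. u \<in> light v) \<and> \<tau> \<le> sz u}"
  have kt: "k * \<tau> \<le> t - 1" by (simp add: \<tau>_def)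
  have "\<exists>u\<in>light i. \<tau> \<le> sz u" if i: "i \<in> ?B" for i
  proof (rule ccontr)
    assume "\<not> (\<exists>u\<in>light i. \<tau> \<le> sz u)"
    then have "(\<Sum>u\<in>light i. sz u) \<le> of_nat (card (light i)) * (\<tau> - 1)"
      by (intro sum_bounded_above) force
    moreover have "finite {u. (i, u) \<in> E}" by (rule finite_subset[OF _ fin]) (auto intro: E_V)
    then have "card (light i) \<le> card {u. (i, u) \<in> E}" by (intro card_mono) (auto simp: light_def)
    then have "card (light i) \<le> k" using deg[of i] by linarith
    then have "card (light i) * (\<tau> - 1) \<le> k * (\<tau> - 1)" by (rule mult_right_mono) simp
    ultimately have "(\<Sum>u\<in>light i. sz u) \<le> k * (\<tau> - 1)" unfolding of_nat_id by (rule order_trans)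
    also have "\<dots> < k * \<tau>" using k False by (simp add: \<tau>_def)
    finally have "(\<Sum>u\<in>light i. sz u) < t - 1" using kt by linarith
    then show False using i weight_eq by auto
  qed
  then have "\<forall>i\<in>?B. \<exists>u. u \<in> light i \<and> \<tau> \<le> sz u" by blast
  from bchoice[OF this] obtain g where g: "\<And>i. i \<in> ?B \<Longrightarrow> g i \<in> light i \<and> \<tau> \<le> sz (g i)" by blast
  have finL: "finite ?L" by (rule finite_subset[OF _ fin]) (auto intro: light_V)
  have "card ?B \<le> card ?L"
  proof (rule card_inj_on_le)
    show "inj_on g ?B"
      using g parent_unique by (intro inj_onI) (metis (no_types, lifting) light_def mem_Collect_eq)
    show "g ` ?B \<subseteq> ?L" using g by blast
  qed (rule finL)
  then have "card ?B * \<tau> \<le> card ?L * \<tau>" by simp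
  also have "\<dots> \<le> card V" by (rule card_light)
  finally show ?thesis by (simp add: \<tau>_def)
qed simp

lemma cov_bag: "(v, z) \<in> H\<^sup>+ \<Longrightarrow> y \<in> cov (v, z) \<Longrightarrow> \<exists>x\<in>seg v z. y \<in> bag x"
proof (induction rule: converse_trancl_induct)
  case (base v)
  then show ?case by (auto simp: H_iff cov_single seg_hc)
next
  case (step v x)
  have x: "x = hc v" "v \<in> V" using step by (auto simp: H_iff)
  have "v \<in> seg v z" "seg x z \<subseteq> seg v z"
    using step.hyps by (auto intro!: seg_self seg_lower)
  moreover have "y \<in> bag v \<or> y \<in> cov (x, z)" using step.prems x by (auto simp: cov_def bag_def)
  ultimately show ?case using step.IH by blast
qed

text \<open>A common node lies in the bag of some x on one path and of some x' on the other, and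
  both are its ancestors. If one is properly below the other, it is below a light child u of it; as
  no heavy path enters u from above, the whole segment of the lower node lies below u.\<close>

lemma segs_meet:
  assumes "(v, z) \<in> H\<^sup>+" "(v', z') \<in> H\<^sup>+" "cov (v, z) \<inter> cov (v', z') \<noteq> {}"
  shows "seg v z \<inter> seg v' z' \<noteq> {} \<or> (\<exists>x\<in>seg v z. \<exists>u\<in>light x. cov (v', z') \<subseteq> D u) \<or>
    (\<exists>x\<in>seg v' z'. \<exists>u\<in>light x. cov (v, z) \<subseteq> D u)"
proof -
  obtain y where y: "y \<in> cov (v, z)" "y \<in> cov (v', z')" using assms(3) by blast
  obtain x where x: "x \<in> seg v z" "y \<in> bag x" using cov_bag assms y by blast
  obtain x' where x': "x' \<in> seg v' z'" "y \<in> bag x'" using cov_bag assms y by blast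
  have nested: "\<exists>u\<in>light a. cov (c, d) \<subseteq> D u"
    if *: "b \<in> D a" "b \<noteq> a" "y \<in> bag a" "y \<in> bag b" "b \<in> seg c d" for a b c d
  proof -
    have aV: "a \<in> V" using that D_empty by blast
    have "b \<notin> D (hc a)" using that D_trans by (auto simp: bag_def)
    then have "b \<in> bag a" using that by (simp add: bag_def)
    then obtain u where u: "u \<in> light a" "b \<in> D u" using *(2) aV by (auto simp: bag_eq)
    have cb: "(c, b) \<in> H\<^sup>*" and bV: "b \<in> V" and cV: "c \<in> V"
      using that(5) seg_V by (auto simp: seg_def dest: H_plus_V rtrancl_trancl_trancl)
    then have "b \<in> D c" using H_star_in_D V_nz by blast
    then have "c \<in> D u \<or> u \<in> D c" using D_linear u by blast
    moreover have "u = c" if "u \<in> D c"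
    proof (rule ccontr)
      assume "u \<noteq> c"
      then have "\<exists>a. hc a = u"
        using H_star_iff[of c b] cb cV that u V_nz[OF bV] by blast
      then show False using light_not_hc u by blast
    qed
    ultimately have "D c \<subseteq> D u" using D_mono by blast
    then show ?thesis using u by (auto simp: cov_def)
  qed
  have "y \<in> D x" "y \<in> D x'" using x x' by (auto simp: bag_def)
  then consider "x = x'" | "x \<in> D x'" "x \<noteq> x'" | "x' \<in> D x" "x' \<noteq> x" using D_linear by blast
  then show ?thesis
  proof cases
    case 1 then show ?thesis using x x' by blast
  next
    case 2 then show ?thesis using nested[of x x'] x x' by blast
  next
    case 3 then show ?thesis using nested[of x' x] x x' by blast
  qed
qed

lemma card_disjoint_large:
  assumes "finite I" "\<And>i. i \<in> I \<Longrightarrow> A i \<subseteq> V" "\<And>i. i \<in> I \<Longrightarrow> t \<le> card (A i)"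
    "\<And>i j. i \<in> I \<Longrightarrow> j \<in> I \<Longrightarrow> i \<noteq> j \<Longrightarrow> A i \<inter> A j = {}"
  shows "card I * t \<le> card V"
proof -
  have "card I * t = (\<Sum>i\<in>I. t)" by simp
  also have "\<dots> \<le> (\<Sum>i\<in>I. card (A i))" using assms(3) by (rule sum_mono)
  also have "\<dots> = card (\<Union>i\<in>I. A i)"
    using assms fin by (intro card_UN_disjoint[symmetric]) (auto dest: finite_subset)
  also have "\<dots> \<le> card V" using assms(2) fin by (intro card_mono) auto
  finally show ?thesis .
qed

text \<open>The least multiple of \<open>2\<^sup>e\<close> in the interval of \<open>m\<close>.\<close>

definition low_mult :: "nat \<Rightarrow> nat \<Rightarrow> nat" where
  "low_mult e m = (sz (hc m) div 2 ^ e + 1) * 2 ^ e"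

lemma low_mult_gt: "sz (hc m) < low_mult e m"
  unfolding low_mult_def using dividend_less_div_times[of "2 ^ e" "sz (hc m)"] by simp

lemma low_mult_le:
  assumes "m \<in> V" "e \<le> ev m" shows "low_mult e m \<le> sz m"
proof -
  obtain c where c: "sz (hc m) < c * 2 ^ e" "c * 2 ^ e \<le> sz m"
    using assms has_mult_iff unfolding has_mult_def by blast
  have "sz (hc m) div 2 ^ e < c" using c(1) by (simp add: div_less_iff_less_mult)
  then have "low_mult e m \<le> c * 2 ^ e" unfolding low_mult_def by (intro mult_right_mono) auto
  then show ?thesis using c(2) by linarith
qed

text \<open>The intervals are disjoint, so these are different multiples of 2^e.\<close>

lemma low_mult_gap:
  assumes "(m', m) \<in> H\<^sup>+" "m \<in> V" "e \<le> ev m"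
  shows "low_mult e m + 2 ^ e \<le> low_mult e m'"
proof -
  have "(hc m', m) \<in> H\<^sup>*" using assms by (simp add: H_plus_hc)
  then have "low_mult e m \<le> sz (hc m')" using H_star_sz low_mult_le assms by (meson order_trans)
  then have "low_mult e m < low_mult e m'" using low_mult_gt order_le_less_trans by blast
  then have "Suc (sz (hc m) div 2 ^ e + 1) \<le> sz (hc m') div 2 ^ e + 1"
    unfolding low_mult_def by (simp del: add_Suc_right)
  then have "Suc (sz (hc m) div 2 ^ e + 1) * 2 ^ e \<le> (sz (hc m') div 2 ^ e + 1) * 2 ^ e"
    by (rule mult_right_mono) simp
  then show ?thesis unfolding low_mult_def by simp
qed

text \<open>Charging scheme: of the \<open>2 * 2 ^ F\<close> positions below the multiple, some belong to a node with a
  bag of size \<open>2 ^ F\<close>, which is charged at most twice, or else they make up a segment, and all segments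
  that arise in this way are disjoint.\<close>

definition charged :: "nat \<Rightarrow> nat \<Rightarrow> bool" where
  "charged F m \<longleftrightarrow> (\<exists>i. (m, i) \<in> H\<^sup>* \<and> i \<in> V \<and> 2 ^ F \<le> weight i \<and>
     low_mult (F + 2) m < sz i + 2 * 2 ^ F)"

text \<open>A node i is charged by itself and by at most one node above it: the multiples of two
  such nodes differ by at least 4 * 2^F, whereas both would have to lie above \<open>sz i\<close>
  and less than 2 * 2^F away from it.\<close>

lemma card_charged:
  "card {m \<in> V. F + 2 \<le> ev m \<and> charged F m} \<le> 2 * card {i \<in> V. 2 ^ F \<le> weight i}"
proof -
  let ?M = "{m \<in> V. F + 2 \<le> ev m \<and> charged F m}" and ?B = "{i \<in> V. 2 ^ F \<le> weight i}"
  have "\<forall>m\<in>?M. \<exists>i. (m, i) \<in> H\<^sup>* \<and> i \<in> ?B \<and> low_mult (F + 2) m < sz i + 2 * 2 ^ F"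
    by (auto simp: charged_def)
  from bchoice[OF this] obtain g where
    g: "\<And>m. m \<in> ?M \<Longrightarrow> (m, g m) \<in> H\<^sup>* \<and> g m \<in> ?B \<and> low_mult (F + 2) m < sz (g m) + 2 * 2 ^ F"
    by blast
  have no: False if *: "m \<in> ?M" "m' \<in> ?M" "g m = g m'" "g m \<noteq> m" "(m', m) \<in> H\<^sup>+" for m m'
  proof -
    have "(m, g m) \<in> H\<^sup>+" using g[OF *(1)] *(4) by (metis rtranclD)
    then have "(hc m, g m) \<in> H\<^sup>*" by (simp add: H_plus_hc)
    then have "sz (g m) \<le> sz (hc m)" by (rule H_star_sz)
    then have "sz (g m) < low_mult (F + 2) m" using low_mult_gt le_less_trans by blast
    moreover have "low_mult (F + 2) m + 2 ^ (F + 2) \<le> low_mult (F + 2) m'"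
      using low_mult_gap * by blast
    moreover have "low_mult (F + 2) m' < sz (g m) + 2 * 2 ^ F" using g[OF *(2)] *(3) by simp
    ultimately show False by simp
  qed
  have finB: "finite ?B" and finM: "finite ?M" using fin by auto
  have "card {m \<in> ?M. g m = m} \<le> card ?B"
    using g by (intro card_mono finB) force
  moreover have "card {m \<in> ?M. g m \<noteq> m} \<le> card ?B"
  proof (rule card_inj_on_le[where f = g])
    show "inj_on g {m \<in> ?M. g m \<noteq> m}"
    proof (rule inj_onI)
      fix m m' assume *: "m \<in> {m \<in> ?M. g m \<noteq> m}" "m' \<in> {m \<in> ?M. g m \<noteq> m}" "g m = g m'"
      have "(m, g m) \<in> H\<^sup>*" "(m', g m) \<in> H\<^sup>*" "g m \<in> V"
        using g[of m] g[of m'] * by auto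
      then have "(m, g m) \<in> H\<^sup>*" "(m', g m) \<in> H\<^sup>*" "g m \<noteq> 0" using V_nz by auto
      then have "(m, m') \<in> H\<^sup>* \<or> (m', m) \<in> H\<^sup>*" by (rule H_up)
      then show "m = m'" using no[of m m'] no[of m' m] * by (auto dest!: rtranclD)
    qed
    show "g ` {m \<in> ?M. g m \<noteq> m} \<subseteq> ?B" using g by blast
  qed (rule finB)
  moreover have "card ?M \<le> card {m \<in> ?M. g m = m} + card {m \<in> ?M. g m \<noteq> m}"
    by (rule order_trans[OF card_mono card_Un_le]) (use fin in auto)
  ultimately show ?thesis by linarith
qed

text \<open>Cut just below the node x whose interval contains the lowest of the 2 * 2^F positions.
  All nodes from m down to x are close enough to be charged if their bags were large, so their bags
  are small.\<close>

lemma uncharged_seg: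
  assumes m: "m \<in> V" "F + 2 \<le> ev m" "\<not> charged F m"
  shows "\<exists>z. (m, z) \<in> H\<^sup>+ \<and> 2 * 2 ^ F \<le> card (cov (m, z)) \<and>
    (\<forall>i\<in>seg m z. weight i < 2 ^ F \<and> low_mult (F + 2) m < sz i + 2 * 2 ^ F)"
proof -
  let ?q = "low_mult (F + 2) m"
  \<comment> \<open>The positions from c to the multiple, both included, are 2 * 2^F in
    number.\<close>
  define c where "c = ?q + 1 - 2 * 2 ^ F"
  have q: "4 * 2 ^ F \<le> ?q" by (simp add: low_mult_def)
  have c: "0 < c" "c \<le> sz m" "c + 2 * 2 ^ F = ?q + 1"
    using q low_mult_le[OF m(1,2)] one_le_power[of "2::nat" F] unfolding c_def by linarith+
  obtain x where x: "x \<in> seg m 0" "sz (hc x) < c" "c \<le> sz x"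
    using seg_locate[of m 0 c] H_to_zero m c by auto
  have mx: "(m, x) \<in> H\<^sup>*" and xV: "x \<in> V" using x seg_V by (auto simp: seg_def)
  have mz: "(m, hc x) \<in> H\<^sup>+" using mx xV by (metis H_iff rtrancl_into_trancl1)
  have "card (cov (m, hc x)) = sz m - sz (hc x)"
    using H_D[of m "hc x"] trancl_into_rtrancl[OF mz] by (simp add: cov_def card_Diff_subset)
  then have "2 * 2 ^ F \<le> card (cov (m, hc x))"
    using c x low_mult_le[OF m(1,2)] by linarith
  moreover have "weight i < 2 ^ F \<and> ?q < sz i + 2 * 2 ^ F" if i: "i \<in> seg m (hc x)" for i
  proof -
    have mi: "(m, i) \<in> H\<^sup>*" "(i, hc x) \<in> H\<^sup>+" using i by (auto simp: seg_def)
    have "(i, x) \<in> H\<^sup>*"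
    proof (rule ccontr)
      assume "(i, x) \<notin> H\<^sup>*"
      then have "(x, i) \<in> H\<^sup>+" using H_down[OF mi(1) mx] by (auto dest: rtranclD)
      then have "(hc x, i) \<in> H\<^sup>*" by (simp add: H_plus_hc)
      then show False using mi(2) H_acyclic by (meson rtrancl_trancl_trancl)
    qed
    then have "sz x \<le> sz i" by (rule H_star_sz)
    then have "?q < sz i + 2 * 2 ^ F" using x c by linarith
    moreover from this have "weight i < 2 ^ F"
      using m(3) mi(1) H_plus_V[OF mi(2)] unfolding charged_def by (meson not_le)
    ultimately show ?thesis by simp
  qed
  ultimately show ?thesis using mz by blast
qed

text \<open>No such segment fits below a light child hanging from another one, as that one has bags
  of fewer than 2^F nodes. If two share a path node, the upper one contains the top m of the lower
  one; then the multiples of the two tops differ by less than 3 * 2^F. This contradicts the gap of 4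
  * 2^F, which is the reason for the offset 2 in F + 2.\<close>

lemma card_uncharged:
  "card {m \<in> V. F + 2 \<le> ev m \<and> \<not> charged F m} * (2 * 2 ^ F) \<le> card V"
proof -
  let ?M = "{m \<in> V. F + 2 \<le> ev m \<and> \<not> charged F m}"
  have "\<forall>m\<in>?M. \<exists>z. (m, z) \<in> H\<^sup>+ \<and> 2 * 2 ^ F \<le> card (cov (m, z)) \<and>
    (\<forall>i\<in>seg m z. weight i < 2 ^ F \<and> low_mult (F + 2) m < sz i + 2 * 2 ^ F)"
    using uncharged_seg by blast
  from bchoice[OF this] obtain g where g: "\<And>m. m \<in> ?M \<Longrightarrow> (m, g m) \<in> H\<^sup>+ \<and>
    2 * 2 ^ F \<le> card (cov (m, g m)) \<and>
    (\<forall>i\<in>seg m (g m). weight i < 2 ^ F \<and> low_mult (F + 2) m < sz i + 2 * 2 ^ F)" by blast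
  have nest: False if *: "m \<in> ?M" "m' \<in> ?M" "x \<in> seg m (g m)" "u \<in> light x" "cov (m', g m') \<subseteq> D u"
    for m m' x u
  proof -
    have "card (cov (m', g m')) \<le> sz u" using *(5) by (intro card_mono) auto
    also have "\<dots> < weight x" using light_less_weight *(4) by blast
    also have "\<dots> < 2 ^ F" using g *(1,3) by blast
    finally show False using g[OF *(2)] by simp
  qed
  have up: False if *: "m \<in> ?M" "m' \<in> ?M" "x \<in> seg m (g m)" "x \<in> seg m' (g m')" "(m', m) \<in> H\<^sup>+" for m m' x
  proof -
    have mV: "m \<in> V" "F + 2 \<le> ev m" using *(1) by auto
    have "(m, g m') \<in> H\<^sup>+" using *(3,4) by (auto simp: seg_def)
    then have "m \<in> seg m' (g m')" using *(5) by (simp add: seg_def trancl_into_rtrancl)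
    then have "weight m < 2 ^ F" "low_mult (F + 2) m' < sz m + 2 * 2 ^ F" using g[OF *(2)] by auto
    moreover have "low_mult (F + 2) m + 2 ^ (F + 2) \<le> low_mult (F + 2) m'"
      using low_mult_gap[OF *(5) mV] .
    moreover have "sz (hc m) < low_mult (F + 2) m" by (rule low_mult_gt)
    moreover have "sz (hc m) \<le> sz m" by (simp add: card_mono hc_D)
    moreover have "(2::nat) ^ (F + 2) = 4 * 2 ^ F" by simp
    ultimately show False by linarith
  qed
  show ?thesis
  proof (rule card_disjoint_large[where A = "\<lambda>m. cov (m, g m)"])
    show "finite ?M" using fin by simp
    show "cov (m, g m) \<subseteq> V" for m using D_subset_V by (auto simp: cov_def)
    show "2 * 2 ^ F \<le> card (cov (m, g m))" if "m \<in> ?M" for m using g[OF that] by blast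
    show "cov (m, g m) \<inter> cov (m', g m') = {}" if m: "m \<in> ?M" "m' \<in> ?M" "m \<noteq> m'" for m m'
    proof (rule ccontr)
      assume "cov (m, g m) \<inter> cov (m', g m') \<noteq> {}"
      then consider x where "x \<in> seg m (g m)" "x \<in> seg m' (g m')"
        | x u where "x \<in> seg m (g m)" "u \<in> light x" "cov (m', g m') \<subseteq> D u"
        | x u where "x \<in> seg m' (g m')" "u \<in> light x" "cov (m, g m) \<subseteq> D u"
        using segs_meet[of m "g m" m' "g m'"] g m(1,2) by blast
      then show False
      proof cases
        case 1
        then have "(m, m') \<in> H\<^sup>* \<or> (m', m) \<in> H\<^sup>*"
          using H_up[of m x m'] seg_V[of x] V_nz[of x] by (auto simp: seg_def)
        then show False using up[OF m(1,2) 1] up[OF m(2,1) 1(2,1)] m(3) by (auto dest!: rtranclD)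
      qed (use nest m in blast)+
    qed
  qed
qed

lemma card_high_ev:
  assumes deg: "\<And>v. card {u. (v, u) \<in> E} \<le> k" and k: "k \<ge> 1"
  shows "card {m \<in> V. F + 2 \<le> ev m} * ((2 ^ F - 1) div k) \<le> 3 * card V"
proof -
  let ?A = "{m \<in> V. F + 2 \<le> ev m \<and> charged F m}"
    and ?U = "{m \<in> V. F + 2 \<le> ev m \<and> \<not> charged F m}"
    and ?B = "{i \<in> V. 2 ^ F \<le> weight i}" and ?t = "(2 ^ F - 1) div k"
  have "?t \<le> 2 * 2 ^ F" by (rule order_trans[OF div_le_dividend]) simp
  then have "card ?U * ?t \<le> card ?U * (2 * 2 ^ F)" by (rule mult_left_mono) simp
  also have "\<dots> \<le> card V" by (rule card_uncharged)
  finally have U: "card ?U * ?t \<le> card V" .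
  have "card ?A * ?t \<le> 2 * card ?B * ?t" using card_charged by (rule mult_right_mono) simp
  also have "\<dots> \<le> 2 * card V" using card_heavy_bags[OF assms, of "2 ^ F"] by simp
  finally have A: "card ?A * ?t \<le> 2 * card V" .
  have "card {m \<in> V. F + 2 \<le> ev m} \<le> card (?A \<union> ?U)" using fin by (intro card_mono) auto
  also have "\<dots> \<le> card ?A + card ?U" by (rule card_Un_le)
  finally have "card {m \<in> V. F + 2 \<le> ev m} * ?t \<le> (card ?A + card ?U) * ?t" by (rule mult_right_mono) simp
  then show ?thesis using A U by (simp add: add_mult_distrib)
qed

text \<open>A node has the maximal priority in at most three patterns.\<close>

lemma card_P0_le:
  assumes "\<And>v z. (v, z) \<in> Q \<Longrightarrow> (v, z) \<in> P0 \<and> peak v z \<in> M" "M \<subseteq> V"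
  shows "card Q \<le> 3 * card M"
proof -
  \<comment> \<open>The code consists of the peak and the kind of the pattern in the sense of
    \<open>shape\<close>; uniqueness of the ends recovers the pattern from it.\<close>
  define f where "f p = (peak (fst p) (snd p),
    if p = (peak (fst p) (snd p), hc (peak (fst p) (snd p))) then 0
    else if fst p = peak (fst p) (snd p) then 1 else (2::nat))" for p
  have three: "(a \<longleftrightarrow> a') \<and> (\<not> a \<longrightarrow> (b \<longleftrightarrow> b'))"
    if "(if a then 0 else if b then 1 else (2::nat)) = (if a' then 0 else if b' then 1 else 2)"
    for a b a' b' using that by (auto split: if_splits)
  have finM: "finite M" using assms(2) fin by (rule finite_subset)
  have inj: "inj_on f Q"
  proof (rule inj_onI)
    fix p p' assume Q: "p \<in> Q" "p' \<in> Q" and f: "f p = f p'"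
    obtain v z v' z' where p: "p = (v, z)" "p' = (v', z')" by fastforce
    define m where "m = peak v z"
    have m: "peak v z = m" "peak v' z' = m" using f p by (simp_all add: f_def m_def)
    have "f p = (m, if p = (m, hc m) then 0 else if v = m then 1 else 2)"
      "f p' = (m, if p' = (m, hc m) then 0 else if v' = m then 1 else 2)"
      unfolding f_def p fst_conv snd_conv m by blast+
    then have e: "(if p = (m, hc m) then 0 else if v = m then 1 else (2::nat)) =
      (if p' = (m, hc m) then 0 else if v' = m then 1 else 2)" using f by (simp only: prod.inject)
    have code: "p = (m, hc m) \<longleftrightarrow> p' = (m, hc m)"
      and code2: "p \<noteq> (m, hc m) \<Longrightarrow> v = m \<longleftrightarrow> v' = m"
      using three[OF e] by blast+
    have P: "(v, z) \<in> P0" "(v', z') \<in> P0" using Q p assms(1) by auto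
    then have H: "(v, z) \<in> H\<^sup>+" "(v', z') \<in> H\<^sup>+" by (auto dest: P0_valid)
    have sh: "shape v z m" "shape v' z' m" using P P0_shape m by metis+
    have sm: "m \<in> seg v z" "m \<in> seg v' z'" using peak_props(1) H m by metis+
    show "p = p'"
    proof (cases "p = (m, hc m)")
      case True
      then show ?thesis using code by simp
    next
      case False
      then have n: "p' \<noteq> (m, hc m)" using code by simp
      have "zmax z m" "zmax z' m" using False n sh p by (auto simp: shape_def)
      moreover have "peak m z = m" "peak m z' = m" using peak_lower H m by metis+
      moreover have "(m, z) \<in> H\<^sup>+" "(m, z') \<in> H\<^sup>+" using sm by (auto simp: seg_def)
      ultimately have z: "z = z'" using lower_end_unique by blast
      have "v = m \<longleftrightarrow> v' = m" using code2 False by simp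
      moreover have "v = v'" if "v \<noteq> m" "v' \<noteq> m"
        using that sh sm m upper_end_unique[of m v z v' z'] by (auto simp: shape_def)
      ultimately have "v = v'" by blast
      then show ?thesis using z p by simp
    qed
  qed
  have "f ` Q \<subseteq> M \<times> {0, 1, 2}"
  proof
    fix x assume "x \<in> f ` Q"
    then obtain v z where vz: "(v, z) \<in> Q" and x: "x = f (v, z)" by auto
    have "(if a then 0 else if b then 1 else 2) \<in> {0, 1, 2::nat}" for a b by simp
    then have "snd x \<in> {0, 1, 2}" unfolding x f_def snd_conv .
    moreover have "fst x \<in> M" using assms(1)[OF vz] by (simp add: x f_def)
    ultimately show "x \<in> M \<times> {0, 1, 2}" by (simp only: mem_Times_iff)
  qed
  then have "card Q \<le> card (M \<times> {0, 1, 2::nat})" using inj finM by (intro card_inj_on_le) auto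
  then show ?thesis by (simp add: card_cartesian_product mult.commute)
qed

lemma card_P0: "card P0 \<le> 3 * card V"
proof (rule card_P0_le)
  fix v z assume p: "(v, z) \<in> P0"
  then show "(v, z) \<in> P0 \<and> peak v z \<in> V" using peak_props(1)[OF P0_valid[OF p]] seg_V by blast
qed simp

lemma finite_P0: "finite P0"
proof (rule finite_subset)
  show "P0 \<subseteq> V \<times> insert 0 V"
  proof
    fix p assume "p \<in> P0"
    then have "(fst p, snd p) \<in> H\<^sup>+" using P0_valid by simp
    then have "fst p \<in> V" "(fst p, snd p) \<in> H\<^sup>*" by (rule H_plus_V, rule trancl_into_rtrancl)
    moreover from this have "snd p \<in> insert 0 V" using H_star_V[of "fst p" "snd p"] by blast
    ultimately have "fst p \<in> V" "snd p \<in> insert 0 V" by simp_all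
    then show "p \<in> V \<times> insert 0 V" by (simp add: mem_Times_iff)
  qed
qed (use fin in simp)

text \<open>By \<open>card_cov_less\<close>, a pattern with 2^(F+2) nodes has a peak of priority at
  least F + 2.\<close>

lemma card_large_patterns:
  assumes deg: "\<And>v. card {u. (v, u) \<in> E} \<le> k" and k: "k \<ge> 1"
  shows "card {p \<in> P0. 4 * 2 ^ F \<le> card (cov p)} * ((2 ^ F - 1) div k) \<le> 9 * card V"
proof -
  have "card {p \<in> P0. 4 * 2 ^ F \<le> card (cov p)} \<le> 3 * card {m \<in> V. F + 2 \<le> ev m}"
  proof (rule card_P0_le)
    fix v z assume "(v, z) \<in> {p \<in> P0. 4 * 2 ^ F \<le> card (cov p)}"
    then have p: "(v, z) \<in> P0" "2 ^ (F + 2) \<le> card (cov (v, z))" by auto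
    have vz: "(v, z) \<in> H\<^sup>+" using p P0_valid by blast
    have "(2::nat) ^ (F + 2) < 2 ^ Suc (ev (peak v z))"
      using p(2) card_cov_less[OF vz] by (rule le_less_trans)
    then have "F + 2 < Suc (ev (peak v z))" by (rule power_less_imp_less_exp[rotated]) simp
    then show "(v, z) \<in> P0 \<and> peak v z \<in> {m \<in> V. F + 2 \<le> ev m}"
      using p peak_props(1)[OF vz] seg_V by simp
  qed blast
  then have "card {p \<in> P0. 4 * 2 ^ F \<le> card (cov p)} * ((2 ^ F - 1) div k)
    \<le> 3 * card {m \<in> V. F + 2 \<le> ev m} * ((2 ^ F - 1) div k)" by (rule mult_right_mono) simp
  also have "\<dots> \<le> 3 * (3 * card V)" using card_high_ev[OF assms, of F] by (simp add: mult.commute)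
  finally show ?thesis by simp
qed

end

lemma sum_powers_le: "(\<Sum>i\<le>n. c ^ i) \<le> (c + 1 :: nat) ^ n"
proof (induction n)
  case (Suc n)
  have "c ^ n \<le> (c + 1) ^ n" by (rule power_mono) simp_all
  then have "c * c ^ n \<le> c * (c + 1) ^ n" by (rule mult_left_mono) simp
  then have "(\<Sum>i\<le>n. c ^ i) + c * c ^ n \<le> (c + 1) ^ n + c * (c + 1) ^ n"
    using Suc.IH by (rule add_mono[rotated])
  then show ?case by simp
qed simp

text \<open>On S the function f factors through g. It is applied with words as g and equivalence
  classes as f.\<close>

lemma card_image_via:
  assumes fin: "finite (g ` S)" and "\<And>x y. x \<in> S \<Longrightarrow> y \<in> S \<Longrightarrow> g x = g y \<Longrightarrow> f x = f y"
  shows "card (f ` S) \<le> card (g ` S)"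
proof -
  have "f ` S \<subseteq> (\<lambda>c. f (SOME x. x \<in> S \<and> g x = c)) ` (g ` S)"
  proof
    fix y assume "y \<in> f ` S"
    then obtain x where x: "x \<in> S" "y = f x" by blast
    have "(SOME x'. x' \<in> S \<and> g x' = g x) \<in> S \<and> g (SOME x'. x' \<in> S \<and> g x' = g x) = g x"
      by (rule someI[of _ x]) (simp add: x)
    then have "f (SOME x'. x' \<in> S \<and> g x' = g x) = y" using assms(2) x by blast
    then show "y \<in> (\<lambda>c. f (SOME x. x \<in> S \<and> g x = c)) ` (g ` S)" using x by blast
  qed
  then show ?thesis using fin by (rule surj_card_le[rotated])
qed

lemma rooted_tree_unique: "rooted_tree V E r \<Longrightarrow> rooted_tree V E r' \<Longrightarrow> r = r'"
  unfolding rooted_tree_def by (metis DiffI singletonD)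

lemma image_restrict:
  assumes "X \<subseteq> f ` A" "\<And>q. q \<in> A \<Longrightarrow> f q \<in> X \<longleftrightarrow> q \<in> S" "S \<subseteq> A"
  shows "X = f ` S"
  using assms by blast

section \<open>Ordered trees: from pairs of nodes to patterns\<close>

locale ord_tree =
  fixes k :: nat and A :: "'a set" and T :: "'a tree_sym struc"
  assumes T_in: "T \<in> ordered_trees k A"
begin

lemma T_struc: "T \<in> STRUC (tree_vocabulary k A)"
  using T_in by (simp add: ordered_trees_def)

lemma T_rooted: "rooted_tree (universe T) (tree_edges T) (tree_root T)"
proof -
  obtain r where r: "rooted_tree (universe T) (tree_edges T) r"
    using T_in by (auto simp: ordered_trees_def)
  then have "tree_root T = r"
    unfolding tree_root_def by (rule the_equality) (rule rooted_tree_unique[OF _ r])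
  then show ?thesis using r by simp
qed

sublocale finite_tree "universe T" "tree_edges T" "tree_root T"
proof
  show "rooted_tree (universe T) (tree_edges T) (tree_root T)" by (rule T_rooted)
qed (simp_all add: universe_def)

lemma D_eq: "D v = descendants T v"
  using T_in by (auto simp: D_def descendants_def ordered_trees_def)

lemma rels_arity:
  assumes "xs \<in> rels T s"
  shows "\<exists>r. tree_vocabulary k A s = Some r \<and> length xs = r"
  using T_struc assms unfolding STRUC_def by (fastforce split: option.splits)

lemma edges_sub: "(u, v) \<in> edges T i \<Longrightarrow> (u, v) \<in> tree_edges T"
  by (auto simp: tree_edges_def)

lemma edges_range: "(u, v) \<in> edges T i \<Longrightarrow> i \<in> {1..k}"
  using rels_arity by (fastforce simp: edges_def tree_vocabulary_def split: if_splits)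

lemma tree_edges_index: "(u, v) \<in> tree_edges T \<Longrightarrow> \<exists>i\<in>{1..k}. (u, v) \<in> edges T i"
  using edges_range unfolding tree_edges_def by blast

lemma edges_index_unique: "(u, v) \<in> edges T i \<Longrightarrow> (u, v) \<in> edges T j \<Longrightarrow> i = j"
proof (rule ccontr)
  assume e: "(u, v) \<in> edges T i" "(u, v) \<in> edges T j" "i \<noteq> j"
  have "\<forall>i\<in>{1..k}. \<forall>j\<in>{1..k}. i \<noteq> j \<longrightarrow> edges T i \<inter> edges T j = {}"
    using T_in by (simp add: ordered_trees_def)
  then have "edges T i \<inter> edges T j = {}" using e edges_range by blast
  then show False using e by blast
qed

lemma edges_functional:
  assumes e: "(u, v) \<in> edges T i" "(u, v') \<in> edges T i" shows "v = v'"
proof -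
  have "\<forall>i\<in>{1..k}. \<forall>u v v2. (u, v) \<in> edges T i \<longrightarrow> (u, v2) \<in> edges T i \<longrightarrow> v = v2"
    using T_in by (simp add: ordered_trees_def)
  then show ?thesis using e edges_range[OF e(1)] by meson
qed

lemma degree: "card {u. (v, u) \<in> tree_edges T} \<le> k"
proof -
  have "{u. (v, u) \<in> tree_edges T} \<subseteq> (\<lambda>i. THE u. (v, u) \<in> edges T i) ` {1..k}"
  proof
    fix u assume "u \<in> {u. (v, u) \<in> tree_edges T}"
    then obtain i where i: "i \<in> {1..k}" "(v, u) \<in> edges T i" using tree_edges_index by blast
    then have "(THE u. (v, u) \<in> edges T i) = u" using edges_functional by blast
    then show "u \<in> (\<lambda>i. THE u. (v, u) \<in> edges T i) ` {1..k}" using i by force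
  qed
  then have "card {u. (v, u) \<in> tree_edges T} \<le> card {1..k}" by (rule surj_card_le[rotated]) simp
  then show ?thesis by simp
qed

definition mk :: "nat \<times> nat \<Rightarrow> nat pattern" where
  "mk p = (if snd p = 0 then Subtree (fst p) else Context (fst p) (snd p))"

definition P :: "nat pattern set" where
  "P = mk ` P0"

lemma mk_inj: "mk p = mk q \<Longrightarrow> p = q"
  by (cases p; cases q) (auto simp: mk_def split: if_splits)

lemma covered_mk: "covered T (mk p) = cov p"
  by (cases p) (auto simp: mk_def cov_def D_eq[symmetric])

lemma mk_pattern: "p \<in> H\<^sup>+ \<Longrightarrow> is_pattern T (mk p)"
proof -
  assume p: "p \<in> H\<^sup>+"
  obtain v z where vz: "p = (v, z)" by fastforce
  have v: "v \<in> universe T" using p vz H_plus_V by blast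
  have "z \<in> D v \<and> z \<noteq> v" if "z \<noteq> 0"
    using that p vz v H_star_in_D[of v z] H_acyclic by (auto dest: trancl_into_rtrancl)
  then show ?thesis using v vz by (auto simp: mk_def D_eq[symmetric])
qed

lemma pattern_le_mk: "pattern_le T (mk q) (mk p) \<longleftrightarrow> cov q \<subseteq> cov p"
  by (simp add: pattern_le_def covered_mk)

lemma pattern_less_mk:
  "p \<in> P0 \<Longrightarrow> q \<in> P0 \<Longrightarrow> pattern_less T (mk q) (mk p) \<longleftrightarrow> cov q \<subset> cov p"
  unfolding pattern_less_def pattern_le_mk psubset_eq using mk_inj P0_cov_inj by metis

lemma root_P0: "(tree_root T, 0) \<in> P0"
  by (simp add: P0_def)

lemma P_hierarchical: "hierarchical_definition T P"
  unfolding hierarchical_definition_def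
proof (intro conjI ballI)
  show "is_pattern T p" if "p \<in> P" for p
    using that P0_valid mk_pattern by (auto simp: P_def)
  show "Subtree (tree_root T) \<in> P"
    using root_P0 by (force simp: P_def mk_def)
  fix p q assume "p \<in> P" "q \<in> P"
  then obtain p' q' where p: "p = mk p'" "p' \<in> P0" and q: "q = mk q'" "q' \<in> P0" by (auto simp: P_def)
  show "covered T p \<inter> covered T q = {} \<or> pattern_le T p q \<or> pattern_le T q p"
    using P0_walk[OF p(2) q(2)] P0_subset_iff[OF p(2) q(2)] P0_subset_iff[OF q(2) p(2)]
    unfolding p(1) q(1) covered_mk pattern_le_mk by argo
qed

lemma direct_mk:
  assumes p: "p \<in> P0" shows "direct_subpatterns T P (mk p) = mk ` kids p"
proof -
  let ?S = "{q \<in> P0. cov q \<subset> cov p \<and> \<not> (\<exists>x\<in>P0. cov q \<subset> cov x \<and> cov x \<subset> cov p)}"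
  have iff: "mk q \<in> direct_subpatterns T P (mk p) \<longleftrightarrow> q \<in> ?S" if q: "q \<in> P0" for q
  proof -
    have "(\<exists>x\<in>P0. pattern_less T (mk q) (mk x) \<and> pattern_less T (mk x) (mk p)) \<longleftrightarrow>
      (\<exists>x\<in>P0. cov q \<subset> cov x \<and> cov x \<subset> cov p)"
      using p q by (intro bex_cong) (simp_all only: pattern_less_mk)
    then show ?thesis
      using q unfolding direct_subpatterns_def P_def mem_Collect_eq pattern_less_mk[OF p q] by blast
  qed
  have "direct_subpatterns T P (mk p) \<subseteq> mk ` P0"
    unfolding direct_subpatterns_def P_def by (rule Collect_restrict)
  then have "direct_subpatterns T P (mk p) = mk ` ?S"
    by (rule image_restrict[OF _ iff]) (simp_all only: Collect_restrict)
  then show ?thesis using kids_direct[OF p] by simp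
qed

lemma P_normal: "normal_form T P"
  unfolding normal_form_def
proof
  fix p assume "p \<in> P"
  then obtain p' where p': "p = mk p'" "p' \<in> P0" by (auto simp: P_def)
  have "p' \<in> H\<^sup>+" using p' P0_valid by blast
  then show "boundary T P p = {pattern_root p} \<and>
       (\<forall>q\<in>direct_subpatterns T P p. is_subtree_pattern q) \<or>
     (\<exists>p1 p2. p1 \<noteq> p2 \<and> direct_subpatterns T P p = {p1, p2} \<and>
       covered T p = covered T p1 \<union> covered T p2 \<and> covered T p1 \<inter> covered T p2 = {})"
  proof (cases rule: kids_cases)
    case (single v)
    have d: "direct_subpatterns T P p = mk ` (\<lambda>u. (u, 0)) ` light v"
      using direct_mk p' single by simp
    have "covered T p = insert v (\<Union>u\<in>light v. D u)"
      using single p' by (simp add: covered_mk cov_single bag_eq)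
    moreover have "(\<Union>q\<in>direct_subpatterns T P p. covered T q) = (\<Union>u\<in>light v. D u)"
      by (simp add: d covered_mk cov_light)
    moreover have "pattern_root p = v" using single p' by (simp add: mk_def)
    ultimately have "boundary T P p = {pattern_root p}"
      unfolding boundary_def using self_notin_light by auto
    moreover have "\<forall>q\<in>direct_subpatterns T P p. is_subtree_pattern q"
      by (auto simp: d mk_def)
    ultimately show ?thesis by blast
  next
    case (binary v m z)
    have "direct_subpatterns T P p = {mk (v, m), mk (m, z)}"
      using direct_mk p' binary by simp
    moreover have "(v, m) \<noteq> (m, z)" using binary(3) H_acyclic by auto
    then have "mk (v, m) \<noteq> mk (m, z)" using mk_inj by blast
    moreover have "covered T p = covered T (mk (v, m)) \<union> covered T (mk (m, z))"
      "covered T (mk (v, m)) \<inter> covered T (mk (m, z)) = {}"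
      using cov_binary[OF binary(3,4)] p' binary(1) by (simp_all add: covered_mk)
    ultimately show ?thesis by blast
  qed
qed

lemma pattern_tree_path:
  "(mk (tree_root T, 0), x) \<in> pattern_tree T P ^^ j \<Longrightarrow>
   \<exists>q. x = mk q \<and> ((tree_root T, 0), q) \<in> K ^^ j"
proof (induction j arbitrary: x)
  case (Suc j)
  then obtain y where y: "(mk (tree_root T, 0), y) \<in> pattern_tree T P ^^ j" "(y, x) \<in> pattern_tree T P"
    by auto
  then obtain q where q: "y = mk q" "((tree_root T, 0), q) \<in> K ^^ j" using Suc.IH by blast
  have "q \<in> P0" using P0_K[OF root_P0] q by (meson relpow_imp_rtrancl)
  then have "x \<in> mk ` kids q" using y(2) q(1) by (simp add: pattern_tree_def direct_mk)
  then obtain q' where "x = mk q'" "q' \<in> kids q" by blast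
  moreover from this have "((tree_root T, 0), q') \<in> K ^^ Suc j"
    using q(2) by (intro relpow_Suc_I) (auto simp: K_def)
  ultimately show ?case by blast
qed simp

lemma P_depth: "hier_depth T P \<le> 6 * floor_log (usize T) + 2"
proof -
  let ?r = "Subtree (tree_root T)"
  have r: "?r = mk (tree_root T, 0)" by (simp add: mk_def)
  let ?L = "{m. \<exists>v. (?r, v) \<in> pattern_tree T P ^^ m}"
  have b: "m \<le> 6 * floor_log (usize T) + 2" if m: "m \<in> ?L" for m
  proof -
    obtain x where "(mk (tree_root T, 0), x) \<in> pattern_tree T P ^^ m" using m r by auto
    then obtain q where "((tree_root T, 0), q) \<in> K ^^ m" using pattern_tree_path by meson
    then have "m + pot q \<le> pot (tree_root T, 0)" using pot_path P0_valid[OF root_P0] by blast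
    then have "m \<le> pot (tree_root T, 0)" by simp
    then show ?thesis using pot_root by (simp add: universe_def)
  qed
  \<comment> \<open>The height is a maximum, which is meaningful only once the path lengths are
    known to be bounded.\<close>
  then have "finite ?L" by (intro finite_subset[of ?L "{..6 * floor_log (usize T) + 2}"]) auto
  moreover have "0 \<in> ?L" by (intro CollectI exI[of _ ?r]) simp
  ultimately show ?thesis
    unfolding hier_depth_def tree_height_def using b by (intro Max.boundedI) blast+
qed

section \<open>Isomorphic patterns\<close>

text \<open>Unlike \<^const>\<open>pattern_iso\<close>, this relation records how the hole hangs below the
  pattern, so that isomorphisms of two halves can be glued along the hole of the upper half.\<close>

definition siso :: "nat \<times> nat \<Rightarrow> nat \<times> nat \<Rightarrow> (nat \<Rightarrow> nat) \<Rightarrow> bool" where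
  "siso p q h \<longleftrightarrow> bij_betw h (cov p) (cov q) \<and> h 0 = 0 \<and> h (fst p) = fst q \<and> h (snd p) = snd q \<and>
     (snd p = 0 \<longleftrightarrow> snd q = 0) \<and>
     (\<forall>x\<in>cov p. \<forall>y\<in>insert (snd p) (cov p). (\<forall>i. (x, y) \<in> edges T i \<longleftrightarrow> (h x, h y) \<in> edges T i) \<and>
        (y \<in> D x \<longleftrightarrow> h y \<in> D (h x))) \<and>
     (\<forall>x\<in>cov p. \<forall>a. [x] \<in> rels T (Label a) \<longleftrightarrow> [h x] \<in> rels T (Label a)) \<and>
     map_prod h h ` (K\<^sup>* `` {p}) = K\<^sup>* `` {q}"

lemma sisoD:
  assumes "siso p q h"
  shows "bij_betw h (cov p) (cov q)" "h 0 = 0" "h (fst p) = fst q" "h (snd p) = snd q"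
    "snd p = 0 \<longleftrightarrow> snd q = 0"
    "\<And>x y i. x \<in> cov p \<Longrightarrow> y \<in> insert (snd p) (cov p) \<Longrightarrow> (x, y) \<in> edges T i \<longleftrightarrow> (h x, h y) \<in> edges T i"
    "\<And>x y. x \<in> cov p \<Longrightarrow> y \<in> insert (snd p) (cov p) \<Longrightarrow> y \<in> D x \<longleftrightarrow> h y \<in> D (h x)"
    "\<And>x a. x \<in> cov p \<Longrightarrow> [x] \<in> rels T (Label a) \<longleftrightarrow> [h x] \<in> rels T (Label a)"
    "map_prod h h ` (K\<^sup>* `` {p}) = K\<^sup>* `` {q}"
    "\<And>x. x \<in> cov p \<Longrightarrow> h x \<in> cov q"
  using assms unfolding siso_def by (simp_all add: bij_betw_def) (blast+)?

text \<open>Bounds the places at which an isomorphism matters: besides covered nodes only the dummy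
  0 and the hole of p itself, since every hole cut out within p is covered by p.\<close>

lemma K_components:
  assumes "(p, q) \<in> K\<^sup>*" "p \<in> H\<^sup>+"
  shows "fst q \<in> cov p \<and> snd q \<in> insert 0 (insert (snd p) (cov p))"
  using assms(1)
proof (induction rule: rtrancl_induct)
  case base
  then show ?case using valid_fst_cov assms(2) by simp
next
  case (step q q')
  have q: "q \<in> H\<^sup>+" using step.hyps(1) assms(2) by (rule K_valid)
  have k: "q' \<in> kids q" using step.hyps(2) by (simp add: K_def)
  have q': "q' \<in> H\<^sup>+" using kids_valid q k by blast
  have c: "cov q' \<subseteq> cov q" "cov q \<subseteq> cov p"
    using kids_psubset[OF q k] K_cov[OF step.hyps(1) assms(2)] by auto
  have f: "fst q' \<in> cov p" using valid_fst_cov[OF q'] c by blast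
  from q show ?case
  proof (cases rule: kids_cases)
    case (single v)
    then show ?thesis using f k by auto
  next
    case (binary v m z)
    have "m \<in> cov (m, z)" using valid_fst_cov[OF binary(4)] by simp
    then have "m \<in> cov q" using cov_binary(1)[OF binary(3,4)] binary(1) by blast
    then have "m \<in> cov p" using c by blast
    moreover have "snd q' = m \<or> snd q' = snd q" using k binary by auto
    ultimately show ?thesis using f step.IH by auto
  qed
qed

lemma map_prod_agree:
  assumes "p \<in> H\<^sup>+" "\<And>x. x \<in> cov p \<Longrightarrow> h x = g x" "h 0 = g 0" "h (snd p) = g (snd p)"
  shows "map_prod h h ` (K\<^sup>* `` {p}) = map_prod g g ` (K\<^sup>* `` {p})"
proof (rule image_cong[OF refl])
  fix q assume "q \<in> K\<^sup>* `` {p}"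
  then have "fst q \<in> cov p \<and> snd q \<in> insert 0 (insert (snd p) (cov p))"
    using K_components assms(1) by blast
  then have "h (fst q) = g (fst q)" "h (snd q) = g (snd q)" using assms(2-4) by auto
  then show "map_prod h h q = map_prod g g q" by (cases q) simp
qed

lemma K_star_Image: "K\<^sup>* `` {p} = insert p (\<Union>q\<in>kids p. K\<^sup>* `` {q})"
  by (auto simp: K_def elim: converse_rtranclE intro: converse_rtrancl_into_rtrancl)

lemma cov_V: "x \<in> cov p \<Longrightarrow> x \<in> universe T"
  using D_subset_V by (auto simp: cov_def)

lemma cov_nz: "x \<in> cov p \<Longrightarrow> x \<noteq> 0"
  using cov_V V_nz by blast

text \<open>Use h1 above m and h2 from m on. The only edge from the upper into the lower part (or
  its hole) leads to m, and an upper node is an ancestor of a lower one iff it is an ancestor of m.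
  Both facts are visible to h1, for which m is the hole.\<close>

lemma siso_glue:
  assumes p: "(v, m) \<in> H\<^sup>+" "(m, z) \<in> H\<^sup>+" "kids (v, z) = {(v, m), (m, z)}"
    and q: "(v', m') \<in> H\<^sup>+" "(m', z') \<in> H\<^sup>+" "kids (v', z') = {(v', m'), (m', z')}"
    and h1: "siso (v, m) (v', m') h1" and h2: "siso (m, z) (m', z') h2"
  shows "\<exists>h. siso (v, z) (v', z') h"
proof -
  define h where "h x = (if x \<in> cov (v, m) then h1 x else h2 x)" for x
  let ?C1 = "cov (v, m)" and ?C2 = "cov (m, z)" and ?C1' = "cov (v', m')" and ?C2' = "cov (m', z')"
  have C: "cov (v, z) = ?C1 \<union> ?C2" "?C1 \<inter> ?C2 = {}" using cov_binary p by blast+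
  have C': "cov (v', z') = ?C1' \<union> ?C2'" "?C1' \<inter> ?C2' = {}" using cov_binary q by blast+
  have sub: "D z \<subseteq> D m" "D z' \<subseteq> D m'" 
    using H_D[OF trancl_into_rtrancl[OF p(2)]] H_D[OF trancl_into_rtrancl[OF q(2)]] by simp_all
  have eq1: "h x = h1 x" if "x \<in> ?C1" for x using that by (simp add: h_def)
  have eq2: "h x = h2 x" if "x \<in> ?C2" for x using that C by (auto simp: h_def)
  have zC1: "z \<notin> ?C1"
  proof
    assume z: "z \<in> ?C1"
    then have "z \<in> D m" using D_self[OF cov_V[OF z]] sub by blast
    then show False using z by (simp add: cov_def)
  qed
  have hz: "h z = z'" using zC1 sisoD(4)[OF h2] by (simp add: h_def)
  have eqz: "h z = h2 z" using zC1 by (simp add: h_def)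
  have h0: "h 0 = 0" using cov_nz sisoD(2)[OF h2] by (auto simp: h_def)
  have v: "v \<in> ?C1" and mC: "m \<in> ?C2" and mC': "m' \<in> ?C2'"
    using valid_fst_cov p q by fastforce+
  have hm: "h m = m'" "h1 m = m'" using eq2[OF mC] sisoD(3)[OF h2] sisoD(4)[OF h1] by simp_all
  have bij: "bij_betw h (cov (v, z)) (cov (v', z'))"
  proof -
    have "bij_betw h ?C1 ?C1'" using sisoD(1)[OF h1] eq1 bij_betw_cong by blast
    moreover have "bij_betw h ?C2 ?C2'" using sisoD(1)[OF h2] eq2 bij_betw_cong by blast
    ultimately show ?thesis unfolding C(1) C'(1) using C'(2) by (rule bij_betw_combine)
  qed
  have below: "y = 0 \<or> y \<in> D m" if "y \<in> insert z ?C2" for y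
    using that sub D_self[of z] H_star_V[of m z] p(2) H_plus_V[OF p(2)] by (auto simp: cov_def dest: trancl_into_rtrancl)
  have below': "y = 0 \<or> y \<in> D m'" if "y \<in> insert z' ?C2'" for y
    using that sub D_self[of z'] H_star_V[of m' z'] q(2) H_plus_V[OF q(2)] by (auto simp: cov_def dest: trancl_into_rtrancl)
  have notm: "h y \<noteq> m'" if y: "y \<in> insert z ?C2" "y \<noteq> m" for y
  proof (cases "y = z")
    case True
    then show ?thesis using hz q(2) H_acyclic by auto
  next
    case False
    then have "y \<in> ?C2" using y by simp
    then show ?thesis
      using y mC eq2 hm sisoD(1)[OF h2] by (metis bij_betw_def inj_on_def)
  qed
  have hC2: "h y \<in> insert z' ?C2'" if "y \<in> insert z ?C2" for y
    using that hz eq2 sisoD(10)[OF h2] by auto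
  have noedge: "(x, y) \<notin> tree_edges T" if "x \<notin> D a" "y = 0 \<or> y \<in> D a" "y \<noteq> a" for x y a
    using that parent_in_D E_V(2) V_nz by blast
  have rel: "(\<forall>i. (x, y) \<in> edges T i \<longleftrightarrow> (h x, h y) \<in> edges T i) \<and> (y \<in> D x \<longleftrightarrow> h y \<in> D (h x))"
    if x: "x \<in> cov (v, z)" and y: "y \<in> insert z (cov (v, z))" for x y
  proof -
    consider (up) "x \<in> ?C1" "y \<in> ?C1" | (hole) "x \<in> ?C1" "y = m" | (down) "x \<in> ?C1" "y \<in> insert z ?C2" "y \<noteq> m"
      | (rise) "x \<in> ?C2" "y \<in> ?C1" | (low) "x \<in> ?C2" "y \<in> insert z ?C2"
      using x y C by blast
    then show ?thesis
    proof cases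
      case up
      then show ?thesis using sisoD(6,7)[OF h1, of x y] eq1 by simp
    next
      case hole
      then show ?thesis using sisoD(6,7)[OF h1, of x y] eq1 hm by simp
    next
      case down
      have hx: "h x = h1 x" "h1 x \<in> ?C1'" using down eq1 sisoD(10)[OF h1] by auto
      have hy: "h y \<in> insert z' ?C2'" "h y \<noteq> m'" using hC2 notm down by auto
      have xm: "x \<notin> D m" "h x \<notin> D m'" using down(1) hx by (auto simp: cov_def)
      have "(x, y) \<notin> tree_edges T" "(h x, h y) \<notin> tree_edges T"
        using noedge[OF xm(1) below[OF down(2)] down(3)] noedge[OF xm(2) below'[OF hy(1)] hy(2)] by simp_all
      then have e: "\<forall>i. (x, y) \<in> edges T i \<longleftrightarrow> (h x, h y) \<in> edges T i" using edges_sub by blast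
      have y0: "y = 0 \<longleftrightarrow> h y = 0"
      proof (cases "y = z")
        case True
        then show ?thesis using hz sisoD(5)[OF h2] by simp
      next
        case False
        then have "y \<in> ?C2" using down by simp
        then show ?thesis using cov_nz eq2 sisoD(10)[OF h2] by metis
      qed
      \<comment> \<open>A node a outside the subtree of c is an ancestor of nodes in this subtree
        iff it is an ancestor of c.\<close>
      have 1: "b \<in> D a \<longleftrightarrow> b \<noteq> 0 \<and> c \<in> D a" if "b = 0 \<or> b \<in> D c" "a \<notin> D c" for a b c
        using that D_linear D_trans zero_notin_D by metis
      have "m \<in> D x \<longleftrightarrow> m' \<in> D (h x)"
        using sisoD(7)[OF h1, of x m] down hm hx by simp
      then show ?thesis
        using e y0 1[OF below[OF down(2)] xm(1)] 1[OF below'[OF hy(1)] xm(2)] by simp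
    next
      case rise
      have hx: "h x \<in> D m'" using rise eq2 sisoD(10)[OF h2, of x] by (auto simp: cov_def)
      have hy: "h y \<notin> D m'" using rise eq1 sisoD(10)[OF h1, of y] by (auto simp: cov_def)
      have xy: "x \<in> D m" "y \<notin> D m" using rise by (auto simp: cov_def)
      have "y \<notin> D x" "h y \<notin> D (h x)" using xy hx hy D_trans by blast+
      then show ?thesis using edge_D edges_sub by blast
    next
      case low
      then show ?thesis using sisoD(6,7)[OF h2, of x y] eq2 eqz by auto
    qed
  qed
  have "map_prod h h ` (K\<^sup>* `` {(v, z)}) = K\<^sup>* `` {(v', z')}"
  proof -
    have "map_prod h h ` (K\<^sup>* `` {(v, m)}) = K\<^sup>* `` {(v', m')}"
      using map_prod_agree[OF p(1), of h h1] eq1 h0 hm sisoD(2,9)[OF h1] by simp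
    moreover have "map_prod h h ` (K\<^sup>* `` {(m, z)}) = K\<^sup>* `` {(m', z')}"
      using map_prod_agree[OF p(2), of h h2] eq2 h0 eqz sisoD(2,9)[OF h2] by simp
    moreover have "map_prod h h (v, z) = (v', z')" using eq1[OF v] hz sisoD(3)[OF h1] by simp
    ultimately show ?thesis
      unfolding K_star_Image[of "(v, z)"] K_star_Image[of "(v', z')"] p(3) q(3) by (simp add: image_Un)
  qed
  moreover have "[x] \<in> rels T (Label a) \<longleftrightarrow> [h x] \<in> rels T (Label a)" if "x \<in> cov (v, z)" for x a
    using that C eq1 eq2 sisoD(8)[OF h1] sisoD(8)[OF h2] by auto
  ultimately have "siso (v, z) (v', z') h"
    unfolding siso_def using bij h0 hz eq1[OF v] sisoD(3)[OF h1] sisoD(5)[OF h2] rel by simp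
  then show ?thesis by blast
qed

section \<open>Single nodes with their light subtrees\<close>

definition child :: "nat \<Rightarrow> nat \<Rightarrow> nat" where
  "child v i = (THE u. (v, u) \<in> edges T i)"

definition light_idx :: "nat \<Rightarrow> nat set" where
  "light_idx v = {i \<in> {1..k}. \<exists>u\<in>light v. (v, u) \<in> edges T i}"

text \<open>Empty for a leaf and a singleton otherwise. It is recorded because \<open>siso\<close>
  has to preserve the edge from v into the hole hc v.\<close>

definition heavy_idx :: "nat \<Rightarrow> nat set" where
  "heavy_idx v = {i \<in> {1..k}. (v, hc v) \<in> edges T i}"

definition labels :: "nat \<Rightarrow> 'a set" where
  "labels v = {a \<in> A. [v] \<in> rels T (Label a)}"

lemma child_eq: "(v, u) \<in> edges T i \<Longrightarrow> child v i = u"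
  unfolding child_def using edges_functional by blast

lemma child_light:
  assumes "i \<in> light_idx v" shows "child v i \<in> light v" "(v, child v i) \<in> edges T i"
  using assms child_eq unfolding light_idx_def by auto

lemma light_child: "u \<in> light v \<Longrightarrow> \<exists>i\<in>light_idx v. u = child v i"
  using tree_edges_index child_eq unfolding light_def light_idx_def by fastforce

lemma light_eq: "light v = child v ` light_idx v"
  using child_light light_child by blast

lemma child_inj: "inj_on (child v) (light_idx v)"
  using child_light(2) edges_index_unique by (intro inj_onI) metis

lemma heavy_idx_iff: "hc v = 0 \<longleftrightarrow> heavy_idx v = {}"
proof
  assume "hc v = 0"
  then show "heavy_idx v = {}" using edges_sub E_V V_nz unfolding heavy_idx_def by fastforce
next
  assume e: "heavy_idx v = {}"
  show "hc v = 0"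
  proof (rule ccontr)
    assume "hc v \<noteq> 0"
    then obtain i where "i \<in> {1..k}" "(v, hc v) \<in> edges T i"
      using hc_edge tree_edges_index by blast
    then show False using e unfolding heavy_idx_def by blast
  qed
qed

lemma labels_iff: "[v] \<in> rels T (Label a) \<longleftrightarrow> a \<in> labels v"
  using rels_arity[of "[v]" "Label a"] by (auto simp: labels_def tree_vocabulary_def split: if_splits)

lemma heavy_edge_iff: "(v, hc v) \<in> edges T i \<longleftrightarrow> i \<in> heavy_idx v"
  using edges_range by (auto simp: heavy_idx_def)

text \<open>The isomorphisms of the light subtrees are pasted together. They belong to equal child
  indices, so the edges from v match, and the hole only needs the index of its edge.\<close>

lemma siso_node:
  assumes v: "v \<in> universe T" and v': "v' \<in> universe T"
    and lab: "labels v = labels v'" and light: "light_idx v = light_idx v'"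
    and heavy: "heavy_idx v = heavy_idx v'"
    and hs: "\<And>i. i \<in> light_idx v \<Longrightarrow> siso (child v i, 0) (child v' i, 0) (g i)"
  shows "\<exists>h. siso (v, hc v) (v', hc v') h"
proof -
  let ?J = "light_idx v" and ?c = "child v" and ?c' = "child v'"
  define idx where "idx x = (SOME i. i \<in> ?J \<and> x \<in> D (?c i))" for x
  \<comment> \<open>For a leaf v the second test catches x = 0. Equal heavy indices then make v' a
    leaf too, so 0 is fixed in every case.\<close>
  define h where "h x = (if x = v then v' else if x = hc v then hc v' else
    if \<exists>i\<in>?J. x \<in> D (?c i) then g (idx x) x else 0)" for x
  have disj: "i = j" if "i \<in> ?J" "j \<in> ?J" "x \<in> D (?c i)" "x \<in> D (?c j)" for i j x
  proof (rule ccontr)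
    assume "i \<noteq> j"
    then have "?c i \<noteq> ?c j" using child_inj that(1,2) by (meson inj_onD)
    then show False using light_disjoint[OF child_light(1)[OF that(1)] child_light(1)[OF that(2)]] that(3,4) by blast
  qed
  have disj': "i = j" if ij: "i \<in> ?J" "j \<in> ?J" and x: "x \<in> D (?c' i)" "x \<in> D (?c' j)" for i j x
  proof (rule ccontr)
    assume "i \<noteq> j"
    then have "?c' i \<noteq> ?c' j" using child_inj ij light by (metis inj_onD)
    then show False using light_disjoint[of "?c' i" v' "?c' j"] child_light(1)[of _ v'] ij light x by auto
  qed
  have idx: "idx x = i" if "i \<in> ?J" "x \<in> D (?c i)" for i x
  proof -
    have "idx x \<in> ?J \<and> x \<in> D (?c (idx x))" unfolding idx_def by (rule someI[of _ i]) (use that in simp)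
    then show ?thesis using disj that by blast
  qed
  have cJ: "?c i \<in> light v" "(v, ?c i) \<in> edges T i" "?c' i \<in> light v'" "(v', ?c' i) \<in> edges T i" if "i \<in> ?J" for i
    using child_light[of i v] child_light[of i v'] that light by auto
  have vD: "v \<notin> D (?c i)" "v' \<notin> D (?c' i)" if "i \<in> ?J" for i
    using self_notin_light cJ that by auto
  have hcD: "hc v \<notin> D (?c i)" if "i \<in> ?J" for i
  proof -
    have "D (?c i) \<subseteq> bag v" using light_bag cJ that by blast
    moreover have "hc v \<notin> bag v"
      using D_self[of "hc v"] D_subset_V by (auto simp: bag_def)
    ultimately show ?thesis by blast
  qed
  have hcD': "hc v' \<notin> D (?c' i)" if "i \<in> ?J" for i
  proof -
    have "D (?c' i) \<subseteq> bag v'" using light_bag cJ that by blast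
    moreover have "hc v' \<notin> bag v'"
      using D_self[of "hc v'"] D_subset_V by (auto simp: bag_def)
    ultimately show ?thesis by blast
  qed
  have hv: "h v = v'" by (simp add: h_def)
  have hh: "h (hc v) = hc v'" using hc_neq[OF v] by (simp add: h_def)
  have hD: "h x = g i x" if "i \<in> ?J" "x \<in> D (?c i)" for i x
    using that vD(1)[OF that(1)] hcD[OF that(1)] idx by (auto simp: h_def)
  have hD': "h x \<in> D (?c' i)" if "i \<in> ?J" "x \<in> D (?c i)" for i x
    using hD[OF that] sisoD(10)[OF hs[OF that(1)], of x] that(2) by (simp add: cov_light)
  have h0: "h 0 = 0"
  proof (cases "hc v = 0")
    case True
    then have "hc v' = 0" using heavy heavy_idx_iff by simp
    then show ?thesis using True hh by simp
  next
    case False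
    then show ?thesis using V_nz[OF v] by (simp add: h_def)
  qed
  have hc0: "hc v = 0 \<longleftrightarrow> hc v' = 0" using heavy heavy_idx_iff by simp
  have C: "cov (v, hc v) = insert v (\<Union>i\<in>?J. D (?c i))"
    using bag_eq[OF v] by (simp add: cov_single light_eq)
  have C': "cov (v', hc v') = insert v' (\<Union>i\<in>?J. D (?c' i))"
    using bag_eq[OF v'] light by (simp add: cov_single light_eq)
  have img: "h ` D (?c i) = D (?c' i)" if "i \<in> ?J" for i
  proof -
    have "h ` D (?c i) = g i ` D (?c i)" using hD that by (intro image_cong) auto
    then show ?thesis using sisoD(1)[OF hs[OF that]] by (simp add: bij_betw_def cov_light)
  qed
  have injc: "inj_on h (D (?c i))" if "i \<in> ?J" for i
    using sisoD(1)[OF hs[OF that]] hD[OF that] inj_on_cong[of "D (?c i)" h "g i"]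
    by (simp add: bij_betw_def cov_light)
  have bij: "bij_betw h (cov (v, hc v)) (cov (v', hc v'))"
    unfolding bij_betw_def
  proof
    show "inj_on h (cov (v, hc v))"
    proof (rule inj_onI)
      fix x y assume xy: "x \<in> cov (v, hc v)" "y \<in> cov (v, hc v)" "h x = h y"
      have one: False if "a = v" "i \<in> ?J" "b \<in> D (?c i)" "h a = h b" for a b i
        using that hD'[OF that(2,3)] hv vD(2) by simp
      consider "x = v" "y = v" | i where "x = v" "i \<in> ?J" "y \<in> D (?c i)"
        | i where "y = v" "i \<in> ?J" "x \<in> D (?c i)"
        | i j where "i \<in> ?J" "x \<in> D (?c i)" "j \<in> ?J" "y \<in> D (?c j)"
        using xy(1,2) C by auto
      then show "x = y"
      proof cases
        case 2
        then show ?thesis using one[OF 2 xy(3)] by blast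
      next
        case 3
        then show ?thesis using one[OF 3 xy(3)[symmetric]] by blast
      next
        case 4
        then have "i = j" using disj' hD' xy(3) by metis
        then show ?thesis using injc 4 xy(3) by (meson inj_onD)
      qed simp
    qed
    show "h ` cov (v, hc v) = cov (v', hc v')"
      unfolding C C' image_insert hv image_UN using img by simp
  qed
  have top: "y = a" if "(b, y) \<in> tree_edges T" "(b, a) \<in> tree_edges T" "y \<in> D a" for a b y
    using that parent_in_D edge_not_D by blast
  have rel: "(\<forall>i. (x, y) \<in> edges T i \<longleftrightarrow> (h x, h y) \<in> edges T i) \<and> (y \<in> D x \<longleftrightarrow> h y \<in> D (h x))"
    if x: "x \<in> cov (v, hc v)" and y: "y \<in> insert (hc v) (cov (v, hc v))" for x y
  proof -
    have noloop: "(a, a) \<notin> edges T i" for a i using edge_not_D edges_sub D_self E_V by blast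
    consider (vv) "x = v" "y = v" | (vh) "x = v" "y = hc v" | (vc) j where "x = v" "j \<in> ?J" "y \<in> D (?c j)"
      | (cv) i where "i \<in> ?J" "x \<in> D (?c i)" "y = v" | (ch) i where "i \<in> ?J" "x \<in> D (?c i)" "y = hc v"
      | (cc) i j where "i \<in> ?J" "x \<in> D (?c i)" "j \<in> ?J" "y \<in> D (?c j)"
      using x y C by auto
    then show ?thesis
    proof cases
      case vv
      then show ?thesis using noloop hv D_self v v' by simp
    next
      case vh
      have "hc a \<in> D a \<longleftrightarrow> hc a \<noteq> 0" for a using hc_edge edge_D zero_notin_D by metis
      then have "hc v \<in> D v \<longleftrightarrow> hc v' \<in> D v'" using hc0 by blast
      then show ?thesis using vh hv hh heavy_edge_iff heavy by simp
    next
      case (vc j)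
      have hy: "h y \<in> D (?c' j)" using hD' vc by blast
      have jJ: "j \<in> ?J" by fact
      have cov: "?c j \<in> D (?c j)" using D_self light_V cJ(1)[OF jJ] by blast
      have yc: "y = ?c j \<longleftrightarrow> h y = ?c' j"
      proof -
        have "h (?c j) = ?c' j" using hD[OF jJ cov] sisoD(3)[OF hs[OF jJ]] by simp
        then show ?thesis using injc[OF jJ] cov vc(3) by (metis inj_onD)
      qed
      have a: "(v, y) \<in> edges T i \<longleftrightarrow> y = ?c j \<and> i = j" for i
        using top[of v y "?c j"] cJ(2)[OF jJ] edges_sub vc(3) edges_index_unique by metis
      have b: "(v', h y) \<in> edges T i \<longleftrightarrow> h y = ?c' j \<and> i = j" for i
        using top[of v' "h y" "?c' j"] cJ(4)[OF jJ] edges_sub hy edges_index_unique by metis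
      have "y \<in> D v" "h y \<in> D v'"
        using D_trans[OF vc(3)] D_trans[OF hy] edge_D edges_sub cJ(2,4)[OF jJ] by blast+
      then show ?thesis using a b yc hv vc(1) by simp
    next
      case (cv i)
      have "y \<notin> D x" using cv vD(1) D_trans by blast
      moreover have "h y \<notin> D (h x)" using cv hv vD(2) hD' D_trans by metis
      ultimately show ?thesis using edge_D edges_sub by blast
    next
      case (ch i)
      have "y \<notin> D x" using ch hcD D_trans by blast
      moreover have "h y \<notin> D (h x)" using ch hh hcD' hD' D_trans by metis
      ultimately show ?thesis using edge_D edges_sub by blast
    next
      case (cc i j)
      show ?thesis
      proof (cases "i = j")
        case True
        then show ?thesis using sisoD(6,7)[OF hs[OF cc(1)], of x y] cc hD by (simp add: cov_light)
      next
        case False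
        have "y \<notin> D x" using cc False disj D_trans by blast
        moreover have "h y \<notin> D (h x)"
          using D_trans[OF _ hD'[OF cc(1,2)]] disj'[OF cc(1,3) _ hD'[OF cc(3,4)]] False by blast
        ultimately show ?thesis using edge_D edges_sub by blast
      qed
    qed
  qed
  have maps: "map_prod h h ` (K\<^sup>* `` {(v, hc v)}) = K\<^sup>* `` {(v', hc v')}"
  proof -
    have kids: "kids (v, hc v) = (\<lambda>i. (?c i, 0)) ` ?J" "kids (v', hc v') = (\<lambda>i. (?c' i, 0)) ` ?J"
      using light by (simp_all add: kids_def light_eq image_image)
    have "map_prod h h ` (K\<^sup>* `` {(?c i, 0)}) = K\<^sup>* `` {(?c' i, 0)}" if "i \<in> ?J" for i
    proof -
      have "(?c i, 0) \<in> H\<^sup>+" using H_to_zero light_V cJ(1)[OF that] by blast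
      then show ?thesis
        using map_prod_agree[of "(?c i, 0)" h "g i"] hD[OF that] h0 sisoD(2,9)[OF hs[OF that]]
        by (simp add: cov_light)
    qed
    then show ?thesis
      unfolding K_star_Image[of "(v, hc v)"] K_star_Image[of "(v', hc v')"] kids
      using hv hh by (simp add: image_UN)
  qed
  have "[x] \<in> rels T (Label a) \<longleftrightarrow> [h x] \<in> rels T (Label a)" if "x \<in> cov (v, hc v)" for x a
  proof (cases "x = v")
    case True
    then show ?thesis using hv lab by (simp add: labels_iff)
  next
    case False
    then have "\<exists>i\<in>?J. x \<in> D (?c i)" using that C by auto
    then obtain i where "i \<in> ?J" "x \<in> D (?c i)" by blast
    then show ?thesis using sisoD(8)[OF hs, of i x a] hD by (simp add: cov_light)
  qed
  then have "siso (v, hc v) (v', hc v') h"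
    unfolding siso_def using bij h0 hv hh hc0 rel maps by simp
  then show ?thesis by blast
qed

section \<open>Encoding patterns by words\<close>

text \<open>The symbol \<^const>\<open>None\<close> stands for a split in two; the first argument bounds the recursion.\<close>

primrec word :: "nat \<Rightarrow> nat \<times> nat \<Rightarrow> ('a set \<times> nat set \<times> nat set) option list" where
  "word 0 p = []"
| "word (Suc f) p = (case p of (v, z) \<Rightarrow>
     if z = hc v then Some (labels v, light_idx v, heavy_idx v) #
       concat (map (\<lambda>i. word f (child v i, 0)) (sorted_list_of_set (light_idx v)))
     else let m = (if peak v z = v then hc v else peak v z) in None # word f (v, m) @ word f (m, z))"

lemma finite_light_idx [simp]: "finite (light_idx v)"
  by (simp add: light_idx_def)

lemma word_single:
  "word (Suc f) (v, hc v) = Some (labels v, light_idx v, heavy_idx v) #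
     concat (map (\<lambda>i. word f (child v i, 0)) (sorted_list_of_set (light_idx v)))"
  by simp

lemma word_binary:
  "z \<noteq> hc v \<Longrightarrow> m = (if peak v z = v then hc v else peak v z) \<Longrightarrow>
   word (Suc f) (v, z) = None # word f (v, m) @ word f (m, z)"
  by (simp add: Let_def)

lemma child_valid: "i \<in> light_idx v \<Longrightarrow> (child v i, 0) \<in> H\<^sup>+"
  using H_to_zero light_V child_light(1) by blast

text \<open>Every covered node contributes one symbol, and there are fewer binary splits than nodes.
  The additive 1 pays for the symbol of a binary split in the induction.\<close>

lemma word_length: "p \<in> H\<^sup>+ \<Longrightarrow> length (word f p) + 1 \<le> 2 * card (cov p)"
proof (induction f arbitrary: p)
  case 0
  then have "cov p \<noteq> {}" using valid_fst_cov by blast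
  then have "0 < card (cov p)" by (simp add: card_gt_0_iff)
  then show ?case unfolding word.simps list.size by linarith
next
  case (Suc f)
  from Suc.prems show ?case
  proof (cases rule: kids_cases)
    case (single v)
    let ?J = "light_idx v"
    have "length (word f (child v i, 0)) \<le> 2 * sz (child v i)" if "i \<in> ?J" for i
      using Suc.IH[OF child_valid[OF that]] by (simp add: cov_light)
    then have "(\<Sum>i\<in>?J. length (word f (child v i, 0))) \<le> (\<Sum>i\<in>?J. 2 * sz (child v i))"
      by (rule sum_mono)
    also have "\<dots> = 2 * (\<Sum>u\<in>light v. sz u)"
      by (simp add: light_eq sum.reindex[OF child_inj] sum_distrib_left)
    finally have "(\<Sum>i\<in>?J. length (word f (child v i, 0))) \<le> 2 * (\<Sum>u\<in>light v. sz u)" .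
    moreover have "length (word (Suc f) p) = 1 + (\<Sum>i\<in>?J. length (word f (child v i, 0)))"
      unfolding single(2) word_single
      by (simp add: length_concat o_def sum_list_distinct_conv_sum_set)
    moreover have "card (cov p) = 1 + (\<Sum>u\<in>light v. sz u)"
      using weight_eq[OF single(1)] by (simp add: single(2) cov_single card_bag)
    ultimately show ?thesis by linarith
  next
    case (binary v m z)
    have "card (cov p) = card (cov (v, m)) + card (cov (m, z))"
      using cov_binary[OF binary(3,4)] by (simp add: binary(1) card_Un_disjoint)
    moreover have "length (word (Suc f) p) = 1 + length (word f (v, m)) + length (word f (m, z))"
      using word_binary[OF binary(2,7)] by (simp add: binary(1))
    ultimately show ?thesis using Suc.IH[OF binary(3)] Suc.IH[OF binary(4)] by linarith
  qed
qed

text \<open>It depends on k and A but not on the tree, so its size is a constant in the final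
  bound.\<close>

definition alphabet :: "('a set \<times> nat set \<times> nat set) option set" where
  "alphabet = insert None (Some ` (Pow A \<times> Pow {1..k} \<times> Pow {1..k}))"

lemma word_alphabet: "set (word f p) \<subseteq> alphabet"
proof (induction f arbitrary: p)
  case (Suc f)
  obtain v z where p: "p = (v, z)" by fastforce
  have "Some (labels v, light_idx v, heavy_idx v) \<in> alphabet"
    by (auto simp: alphabet_def labels_def light_idx_def heavy_idx_def)
  moreover have "None \<in> alphabet" by (simp add: alphabet_def)
  ultimately show ?case
    using Suc.IH unfolding p word.simps(2) by (auto simp: Let_def split del: if_split split: if_splits)
qed simp

text \<open>The code is prefix-free: the first symbol tells the kind of the pattern and how many
  words follow. The trailing lists let the induction run through concatenations, and the bounds by f
  ensure that the recursion of \<open>word\<close> was not cut short.\<close>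

lemma word_parse:
  assumes "p \<in> H\<^sup>+" "q \<in> H\<^sup>+" "card (cov p) \<le> f" "card (cov q) \<le> f" "word f p @ xs = word f q @ ys"
  shows "(\<exists>h. siso p q h) \<and> xs = ys"
  using assms
proof (induction f arbitrary: p q xs ys)
  case 0
  then have "cov p \<noteq> {}" using valid_fst_cov by blast
  then have "card (cov p) \<noteq> 0" by simp
  then show ?case using 0 by simp
next
  case (Suc f)
  have small: "card (cov q') \<le> f" if "p' \<in> H\<^sup>+" "q' \<in> kids p'" "card (cov p') \<le> Suc f" for p' q'
    using psubset_card_mono[OF finite_cov kids_psubset[OF that(1,2)]] that(3) by linarith
  from Suc.prems(1) show ?case
  proof (cases rule: kids_cases)
    case p: (single v)
    from Suc.prems(2) show ?thesis
    proof (cases rule: kids_cases)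
      case q: (single v')
      have wd: "word (Suc f) p @ xs = Some (labels v, light_idx v, heavy_idx v) #
          concat (map (\<lambda>i. word f (child v i, 0)) (sorted_list_of_set (light_idx v))) @ xs"
        "word (Suc f) q @ ys = Some (labels v', light_idx v', heavy_idx v') #
          concat (map (\<lambda>i. word f (child v' i, 0)) (sorted_list_of_set (light_idx v'))) @ ys"
        unfolding p(2) q(2) word_single by simp_all
      then have eqs: "labels v = labels v'" "light_idx v = light_idx v'" "heavy_idx v = heavy_idx v'"
        using Suc.prems(5) by simp_all
      have c: "concat (map (\<lambda>i. word f (child v i, 0)) (sorted_list_of_set (light_idx v))) @ xs =
          concat (map (\<lambda>i. word f (child v' i, 0)) (sorted_list_of_set (light_idx v))) @ ys"
        using wd Suc.prems(5) eqs by simp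
      have child: "card (cov (child v i, 0)) \<le> f" "card (cov (child v' i, 0)) \<le> f" if "i \<in> light_idx v" for i
      proof -
        have "(child v i, 0) \<in> kids p" "(child v' i, 0) \<in> kids q"
          unfolding p(3) q(3) using child_light(1) that eqs(2) by auto
        then show "card (cov (child v i, 0)) \<le> f" "card (cov (child v' i, 0)) \<le> f"
          using small Suc.prems by blast+
      qed
      \<comment> \<open>The words of the light children are peeled off one at a time; the words not
        yet read join the trailing lists.\<close>
      have "(\<forall>i\<in>set is. \<exists>h. siso (child v i, 0) (child v' i, 0) h) \<and> xs = ys"
        if "set is \<subseteq> light_idx v" "concat (map (\<lambda>i. word f (child v i, 0)) is) @ xs =
          concat (map (\<lambda>i. word f (child v' i, 0)) is) @ ys" for "is"
        using that
      proof (induction "is")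
        case (Cons i "is")
        have i: "i \<in> light_idx v" "i \<in> light_idx v'" using Cons.prems eqs by auto
        have "word f (child v i, 0) @ (concat (map (\<lambda>i. word f (child v i, 0)) is) @ xs) =
          word f (child v' i, 0) @ (concat (map (\<lambda>i. word f (child v' i, 0)) is) @ ys)"
          using Cons.prems(2) by simp
        from Suc.IH[OF child_valid[OF i(1)] child_valid[OF i(2)] child[OF i(1)] this]
        show ?case using Cons.IH Cons.prems(1) by simp
      qed simp
      from this[OF _ c] have iso: "\<forall>i\<in>light_idx v. \<exists>h. siso (child v i, 0) (child v' i, 0) h" and "xs = ys"
        by simp_all
      from bchoice[OF iso] obtain g where "\<forall>i\<in>light_idx v. siso (child v i, 0) (child v' i, 0) (g i)" ..
      then have "\<exists>h. siso (v, hc v) (v', hc v') h"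
        using siso_node[OF p(1) q(1) eqs] by blast
      then show ?thesis using \<open>xs = ys\<close> by (simp add: p(2) q(2))
    next
      case q: (binary v' m' z')
      have "word (Suc f) p @ xs \<noteq> word (Suc f) q @ ys"
        unfolding p(2) q(1) word_single word_binary[OF q(2,7)] by simp
      then show ?thesis using Suc.prems(5) by blast
    qed
  next
    case p: (binary v m z)
    from Suc.prems(2) show ?thesis
    proof (cases rule: kids_cases)
      case q: (single v')
      have "word (Suc f) p @ xs \<noteq> word (Suc f) q @ ys"
        unfolding p(1) q(2) word_single word_binary[OF p(2,7)] by simp
      then show ?thesis using Suc.prems(5) by blast
    next
      case q: (binary v' m' z')
      have wd: "word f (v, m) @ (word f (m, z) @ xs) = word f (v', m') @ (word f (m', z') @ ys)"
        using Suc.prems(5) unfolding p(1) q(1) word_binary[OF p(2,7)] word_binary[OF q(2,7)] by simp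
      have sm: "card (cov (v, m)) \<le> f" "card (cov (m, z)) \<le> f" "card (cov (v', m')) \<le> f" "card (cov (m', z')) \<le> f"
        using small[OF Suc.prems(1) _ Suc.prems(3)] small[OF Suc.prems(2) _ Suc.prems(4)] p(6) q(6) by simp_all
      have 1: "(\<exists>h. siso (v, m) (v', m') h) \<and> word f (m, z) @ xs = word f (m', z') @ ys"
        using Suc.IH[OF p(3) q(3) sm(1,3) wd] .
      then have 2: "(\<exists>h. siso (m, z) (m', z') h) \<and> xs = ys"
        using Suc.IH[OF p(4) q(4) sm(2,4)] by blast
      have "kids (v, z) = {(v, m), (m, z)}" "kids (v', z') = {(v', m'), (m', z')}"
        using p(1,6) q(1,6) by simp_all
      then have "\<exists>h. siso (v, z) (v', z') h"
        using siso_glue[OF p(3,4) _ q(3,4)] 1 2 by blast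
      then show ?thesis using 2 by (simp add: p(1) q(1))
    qed
  qed
qed

section \<open>Equivalence classes of patterns\<close>

lemma subpatterns_mk: "p \<in> P0 \<Longrightarrow> subpatterns T P (mk p) = mk ` (K\<^sup>* `` {p})"
proof -
  assume p: "p \<in> P0"
  have "mk q \<in> subpatterns T P (mk p) \<longleftrightarrow> q \<in> K\<^sup>* `` {p}" if "q \<in> P0" for q
    using P0_subset_iff[OF p that] that by (simp add: subpatterns_def P_def pattern_le_mk)
  moreover have "subpatterns T P (mk p) \<subseteq> mk ` P0" by (auto simp: subpatterns_def P_def)
  moreover have "K\<^sup>* `` {p} \<subseteq> P0" using P0_K[OF p] by blast
  ultimately show ?thesis by (intro image_restrict[where A = P0])
qed

text \<open>Only tuples of the right arity need attention: any other tuple is in no relation, and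
  neither is its image.\<close>

lemma siso_pattern_iso:
  assumes p: "p \<in> P0" and q: "q \<in> P0" and h: "siso p q h"
  shows "pattern_iso T P (mk p) (mk q) h"
  unfolding pattern_iso_def
proof (intro conjI allI impI)
  show "bij_betw h (covered T (mk p)) (covered T (mk q))"
    using sisoD(1)[OF h] by (simp add: covered_mk)
next
  fix s xs assume "set xs \<subseteq> covered T (mk p)"
  then have xs: "set xs \<subseteq> cov p" by (simp add: covered_mk)
  show "xs \<in> rels T s \<longleftrightarrow> map h xs \<in> rels T s"
  proof (cases "\<exists>r. tree_vocabulary k A s = Some r \<and> length xs = r")
    case False
    then show ?thesis using rels_arity[of xs s] rels_arity[of "map h xs" s] by auto
  next
    case True
    show ?thesis
    proof (cases s)
      case (Edge i)
      then have "length xs = Suc (Suc 0)" using True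
        by (auto simp: tree_vocabulary_def split: if_splits)
      then obtain x y where xy: "xs = [x, y]" by (auto simp only: length_Suc_conv length_0_conv)
      then have "(x, y) \<in> edges T i \<longleftrightarrow> (h x, h y) \<in> edges T i" using xs sisoD(6)[OF h] by simp
      then show ?thesis using Edge xy by (simp add: edges_def)
    next
      case Anc
      then obtain x y where xy: "xs = [x, y]" using True
        by (auto simp: tree_vocabulary_def length_Suc_conv numeral_2_eq_2)
      then have "y \<in> D x \<longleftrightarrow> h y \<in> D (h x)" using xs sisoD(7)[OF h] by simp
      then show ?thesis using Anc xy by (simp add: D_eq descendants_def)
    next
      case (Label a)
      then have "length xs = Suc 0" using True
        by (auto simp: tree_vocabulary_def split: if_splits)
      then obtain x where x: "xs = [x]" by (auto simp only: length_Suc_conv length_0_conv)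
      then show ?thesis using xs sisoD(8)[OF h] Label by simp
    qed
  qed
next
  \<comment> \<open>As \<open>mk\<close> reads 0 as a missing hole, h has to send 0, and no other
    hole, to 0.\<close>
  have "map_pattern h (mk p') = mk (map_prod h h p')" if "p' \<in> K\<^sup>* `` {p}" for p'
  proof -
    have "snd p' \<in> insert 0 (insert (snd p) (cov p))"
      using K_components that P0_valid[OF p] by blast
    then have "snd p' = 0 \<longleftrightarrow> h (snd p') = 0"
      using sisoD(2,4,5)[OF h] cov_nz sisoD(10)[OF h] by (metis insert_iff)
    then show ?thesis by (cases p') (simp add: mk_def)
  qed
  then have "map_pattern h ` mk ` (K\<^sup>* `` {p}) = mk ` map_prod h h ` (K\<^sup>* `` {p})"
    by (simp add: image_image)
  then show "map_pattern h ` subpatterns T P (mk p) = subpatterns T P (mk q)"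
    using subpatterns_mk p q sisoD(9)[OF h] by simp
qed

lemma pattern_iso_comp:
  assumes h: "pattern_iso T Q p q h" and g: "pattern_iso T Q q s g"
  shows "pattern_iso T Q p s (g \<circ> h)"
  unfolding pattern_iso_def
proof (intro conjI allI impI)
  have bij: "bij_betw h (covered T p) (covered T q)" "bij_betw g (covered T q) (covered T s)"
    using h g by (simp_all add: pattern_iso_def)
  then show "bij_betw (g \<circ> h) (covered T p) (covered T s)" by (rule bij_betw_trans)
  fix t xs assume xs: "set xs \<subseteq> covered T p"
  then have "set (map h xs) \<subseteq> covered T q" using bij(1) by (auto simp: bij_betw_def)
  then have "map h xs \<in> rels T t \<longleftrightarrow> map g (map h xs) \<in> rels T t"
    using g unfolding pattern_iso_def by blast
  moreover have "xs \<in> rels T t \<longleftrightarrow> map h xs \<in> rels T t"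
    using h xs unfolding pattern_iso_def by blast
  ultimately show "xs \<in> rels T t \<longleftrightarrow> map (g \<circ> h) xs \<in> rels T t" by simp
next
  show "map_pattern (g \<circ> h) ` subpatterns T Q p = subpatterns T Q s"
    using h g by (simp add: pattern_iso_def pattern.map_comp[symmetric] image_image[symmetric])
qed

text \<open>Parsing in both directions gives isomorphisms both ways, so equality of the classes
  needs composition only and no inverses.\<close>

lemma word_class:
  assumes p: "p \<in> P0" and q: "q \<in> P0" and eq: "word (usize T) p = word (usize T) q"
  shows "equivalent_patterns T P `` {mk p} = equivalent_patterns T P `` {mk q}"
proof -
  have c: "card (cov x) \<le> usize T" for x
  proof -
    have "cov x \<subseteq> universe T" using cov_V by blast
    then have "card (cov x) \<le> card (universe T)" by (rule card_mono[OF fin])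
    then show ?thesis by (simp add: universe_def)
  qed
  have "(\<exists>h. siso p q h)" "(\<exists>h. siso q p h)"
    using word_parse[OF P0_valid[OF p] P0_valid[OF q] c c, of "[]" "[]"]
      word_parse[OF P0_valid[OF q] P0_valid[OF p] c c, of "[]" "[]"] eq by simp_all
  then obtain g h where gh: "siso p q g" "siso q p h" by blast
  have sub: "equivalent_patterns T P `` {mk x} \<subseteq> equivalent_patterns T P `` {mk y}"
    if "x \<in> P0" "y \<in> P0" "siso y x j" for x y j
  proof
    fix s assume "s \<in> equivalent_patterns T P `` {mk x}"
    then obtain i where i: "s \<in> P" "pattern_iso T P (mk x) s i"
      by (auto simp: equivalent_patterns_def)
    have "pattern_iso T P (mk y) s (i \<circ> j)"
      using pattern_iso_comp[OF siso_pattern_iso[OF that(2,1,3)] i(2)] .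
    moreover have "mk y \<in> P" using that(2) by (simp add: P_def)
    ultimately show "s \<in> equivalent_patterns T P `` {mk y}"
      using i(1) unfolding equivalent_patterns_def by blast
  qed
  show ?thesis using sub[OF p q gh(2)] sub[OF q p gh(1)] by (rule subset_antisym)
qed

text \<open>Large patterns are counted one by one, small ones through their words, whose length is
  at most 2 * s.\<close>

lemma num_inequivalent_le:
  assumes A: "finite A"
  shows "num_inequivalent T P \<le> card {p \<in> P0. s \<le> card (cov p)} + (card alphabet + 1) ^ (2 * s)"
proof -
  let ?f = "\<lambda>p. equivalent_patterns T P `` {mk p}"
  let ?B = "{p \<in> P0. s \<le> card (cov p)}" and ?S = "{p \<in> P0. card (cov p) < s}"
  have "P // equivalent_patterns T P = ?f ` P0" by (auto simp: quotient_def P_def)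
  also have "P0 = ?B \<union> ?S" by auto
  also have "?f ` (?B \<union> ?S) = ?f ` ?B \<union> ?f ` ?S" by (rule image_Un)
  finally have "num_inequivalent T P \<le> card (?f ` ?B) + card (?f ` ?S)"
    unfolding num_inequivalent_def by (simp only: card_Un_le)
  moreover have "card (?f ` ?B) \<le> card ?B" using finite_P0 by (intro card_image_le) simp
  moreover have "card (?f ` ?S) \<le> (card alphabet + 1) ^ (2 * s)"
  proof -
    have finA: "finite alphabet" using A by (simp add: alphabet_def)
    have sub: "word (usize T) ` ?S \<subseteq> {xs. set xs \<subseteq> alphabet \<and> length xs \<le> 2 * s}"
    proof
      fix x assume "x \<in> word (usize T) ` ?S"
      then obtain p where "p \<in> ?S" and x: "x = word (usize T) p" by blast
      then have "length x + 1 \<le> 2 * s" using word_length[of p "usize T"] P0_valid by fastforce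
      then show "x \<in> {xs. set xs \<subseteq> alphabet \<and> length xs \<le> 2 * s}"
        using word_alphabet x by simp
    qed
    have "card (?f ` ?S) \<le> card (word (usize T) ` ?S)"
      using finite_P0 word_class by (intro card_image_via) auto
    also have "\<dots> \<le> card {xs. set xs \<subseteq> alphabet \<and> length xs \<le> 2 * s}"
      using sub finite_lists_length_le[OF finA] by (rule card_mono[rotated])
    also have "\<dots> \<le> (card alphabet + 1) ^ (2 * s)"
      unfolding card_lists_length_le[OF finA] by (rule sum_powers_le)
    finally show ?thesis .
  qed
  ultimately show ?thesis by linarith
qed

end

section \<open>Comparing cardinalities with the majority quantifier\<close>

text \<open>A discrete intermediate value theorem: the count starts at 0 and grows by at most one
  per step.\<close>

lemma prefix_card_surj:
  assumes "0 \<notin> R" "\<rho> \<le> card {a \<in> R. a \<le> (N::nat)}"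
  shows "\<exists>r\<le>N. card {a \<in> R. a \<le> r} = \<rho>"
  using assms(2)
proof (induction N)
  case 0
  have e: "{a \<in> R. a \<le> 0} = {}" using assms(1) by auto
  have "card {a \<in> R. a \<le> 0} = \<rho>" using 0 unfolding e by simp
  then show ?case by blast
next
  case (Suc N)
  show ?case
  proof (cases "\<rho> \<le> card {a \<in> R. a \<le> N}")
    case True
    then show ?thesis using Suc.IH le_SucI by blast
  next
    case False
    have "{a \<in> R. a \<le> Suc N} \<subseteq> insert (Suc N) {a \<in> R. a \<le> N}" by (auto simp: le_Suc_eq)
    then have "card {a \<in> R. a \<le> Suc N} \<le> card (insert (Suc N) {a \<in> R. a \<le> N})"
      by (rule card_mono[rotated]) simp
    also have "\<dots> \<le> Suc (card {a \<in> R. a \<le> N})" by (rule card_insert_le_m1) simp_all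
    finally have "card {a \<in> R. a \<le> Suc N} = \<rho>" using False Suc.prems by linarith
    then show ?thesis by blast
  qed
qed

text \<open>Pad the two differences \<open>X - Y\<close> and \<open>Y - X\<close> with the same initial part of the remaining
  elements.  If \<open>X\<close> is larger than \<open>Y\<close>, then for some padding only the former is a majority.\<close>

lemma card_le_via_majority:
  fixes X Y :: "nat set" and n :: nat
  defines "R \<equiv> {a \<in> {1..n}. a \<in> X \<longleftrightarrow> a \<in> Y}"
  assumes XY: "X \<subseteq> {1..n}" "Y \<subseteq> {1..n}" and n: "1 \<le> n"
  shows "(\<forall>r\<in>{1..n}.
      (n < 2 * card ((X - Y) \<union> {a \<in> R. a \<le> r}) \<longrightarrow> n < 2 * card ((Y - X) \<union> {a \<in> R. a \<le> r})) \<and>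
      (n < 2 * card ((X - Y) \<union> {a \<in> R. a < r}) \<longrightarrow> n < 2 * card ((Y - X) \<union> {a \<in> R. a < r})))
    \<longleftrightarrow> card X \<le> card Y"
proof -
  have fin: "finite X" "finite Y" using XY finite_subset by auto
  have finR: "finite R" by (simp add: R_def)
  have split: "card X = card (X \<inter> Y) + card (X - Y)" "card Y = card (X \<inter> Y) + card (Y - X)"
    using card_Int_Diff[OF fin(1), of Y] card_Int_Diff[OF fin(2), of X] by (simp_all add: Int_commute)
  have un: "card ((X - Y) \<union> S) = card (X - Y) + card S" "card ((Y - X) \<union> S) = card (Y - X) + card S"
    if "S \<subseteq> R" for S
    using that fin finite_subset[OF that finR] by (auto simp: R_def intro!: card_Un_disjoint)
  have sub: "{a \<in> R. a \<le> r} \<subseteq> R" "{a \<in> R. a < r} \<subseteq> R" for r by auto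
  have total: "card (X - Y) + card (Y - X) + card R = n"
  proof -
    have "card ((X - Y) \<union> ((Y - X) \<union> R)) = card (X - Y) + card ((Y - X) \<union> R)"
      using fin finR by (intro card_Un_disjoint) (auto simp: R_def)
    moreover have "(X - Y) \<union> ((Y - X) \<union> R) = {1..n}" using XY by (auto simp: R_def)
    ultimately show ?thesis using un(2)[of R] by simp
  qed
  show ?thesis
  proof
    assume L: "\<forall>r\<in>{1..n}.
      (n < 2 * card ((X - Y) \<union> {a \<in> R. a \<le> r}) \<longrightarrow> n < 2 * card ((Y - X) \<union> {a \<in> R. a \<le> r})) \<and>
      (n < 2 * card ((X - Y) \<union> {a \<in> R. a < r}) \<longrightarrow> n < 2 * card ((Y - X) \<union> {a \<in> R. a < r}))"
    show "card X \<le> card Y"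
    proof (rule ccontr)
      assume "\<not> card X \<le> card Y"
      then have light: "card (Y - X) < card (X - Y)" using split by linarith
      \<comment> \<open>Pad Y - X up to half of the domain but not beyond; the larger X - Y then
        passes the half. If all of R is used up, X - Y and R together are the complement of Y - X,
        which is less than half of the domain.\<close>
      define \<rho> where "\<rho> = min (n div 2 - card (Y - X)) (card R)"
      have \<rho>: "2 * (card (Y - X) + \<rho>) \<le> n" "n < 2 * (card (X - Y) + \<rho>)"
        using light total unfolding \<rho>_def by (simp_all add: min_def) linarith+
      have "{a \<in> R. a \<le> n} = R" by (auto simp: R_def)
      then have "\<rho> \<le> card {a \<in> R. a \<le> n}" by (simp add: \<rho>_def)
      then obtain r where r: "r \<le> n" "card {a \<in> R. a \<le> r} = \<rho>"
        using prefix_card_surj[of R \<rho> n] by (auto simp: R_def)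
      have L': "n < 2 * (card (X - Y) + card {a \<in> R. a \<le> b}) \<longrightarrow> n < 2 * (card (Y - X) + card {a \<in> R. a \<le> b})"
        "n < 2 * (card (X - Y) + card {a \<in> R. a < b}) \<longrightarrow> n < 2 * (card (Y - X) + card {a \<in> R. a < b})"
        if "b \<in> {1..n}" for b
        using bspec[OF L that] unfolding un[OF sub(1)] un[OF sub(2)] by blast+
      show False
      \<comment> \<open>The empty padding: 0 is not in the domain, but the strict bound 1 describes
        the same set.\<close>
      proof (cases "r = 0")
        case True
        then have "{a \<in> R. a \<le> r} = {a \<in> R. a < 1}" by auto
        then have "card {a \<in> R. a < 1} = \<rho>" using r by simp
        moreover have "1 \<in> {1..n}" using n by simp
        ultimately show False using L'(2)[of 1] \<rho> by simp
      next
        case False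
        then have "r \<in> {1..n}" using r by simp
        then show False using L'(1)[of r] \<rho> r(2) by simp
      qed
    qed
  next
    assume "card X \<le> card Y"
    then have "card (X - Y) \<le> card (Y - X)" using split by linarith
    then show "\<forall>r\<in>{1..n}.
      (n < 2 * card ((X - Y) \<union> {a \<in> R. a \<le> r}) \<longrightarrow> n < 2 * card ((Y - X) \<union> {a \<in> R. a \<le> r})) \<and>
      (n < 2 * card ((X - Y) \<union> {a \<in> R. a < r}) \<longrightarrow> n < 2 * card ((Y - X) \<union> {a \<in> R. a < r}))"
      unfolding un[OF sub(1)] un[OF sub(2)] by auto
  qed
qed

section \<open>Derived connectives and the comparison formula\<close>

definition fOr :: "'r fom \<Rightarrow> 'r fom \<Rightarrow> 'r fom" where
  "fOr \<phi> \<psi> = Neg (Conj (Neg \<phi>) (Neg \<psi>))"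

definition fImp :: "'r fom \<Rightarrow> 'r fom \<Rightarrow> 'r fom" where
  "fImp \<phi> \<psi> = Neg (Conj \<phi> (Neg \<psi>))"

definition fAll :: "nat \<Rightarrow> 'r fom \<Rightarrow> 'r fom" where
  "fAll x \<phi> = Neg (Exists x (Neg \<phi>))"

definition fLe :: "nat \<Rightarrow> nat \<Rightarrow> 'r fom" where
  "fLe x y = fOr (Less x y) (Eq x y)"

text \<open>The padding is drawn from the elements on which the two formulas agree, so it is
  disjoint from both differences.\<close>

definition fPad :: "nat \<Rightarrow> 'r fom \<Rightarrow> 'r fom \<Rightarrow> 'r fom \<Rightarrow> 'r fom" where
  "fPad z \<phi> \<psi> \<chi> = Majority z (fOr (Conj \<phi> (Neg \<psi>)) (Conj (Conj (fImp \<phi> \<psi>) (fImp \<psi> \<phi>)) \<chi>))"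

definition fCard_le :: "nat \<Rightarrow> nat \<Rightarrow> 'r fom \<Rightarrow> 'r fom \<Rightarrow> 'r fom" where
  "fCard_le z r \<phi> \<psi> = fAll r
     (Conj (fImp (fPad z \<phi> \<psi> (fLe z r)) (fPad z \<psi> \<phi> (fLe z r)))
           (fImp (fPad z \<phi> \<psi> (Less z r)) (fPad z \<psi> \<phi> (Less z r))))"

lemma sat_connectives [simp]:
  "sat S e (fOr \<phi> \<psi>) \<longleftrightarrow> sat S e \<phi> \<or> sat S e \<psi>"
  "sat S e (fImp \<phi> \<psi>) \<longleftrightarrow> (sat S e \<phi> \<longrightarrow> sat S e \<psi>)"
  "sat S e (fAll x \<phi>) \<longleftrightarrow> (\<forall>a\<in>universe S. sat S (e(x := a)) \<phi>)"
  "sat S e (fLe x y) \<longleftrightarrow> e x \<le> e y"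
  by (auto simp: fOr_def fImp_def fAll_def fLe_def)

lemma fv_connectives [simp]:
  "fv (fOr \<phi> \<psi>) = fv \<phi> \<union> fv \<psi>" "fv (fImp \<phi> \<psi>) = fv \<phi> \<union> fv \<psi>" "fv (fAll x \<phi>) = fv \<phi> - {x}"
  "fv (fLe x y) = {x, y}" "fv (fPad z \<phi> \<psi> \<chi>) = (fv \<phi> \<union> fv \<psi> \<union> fv \<chi>) - {z}"
  "fv (fCard_le z r \<phi> \<psi>) = (fv \<phi> \<union> fv \<psi>) - {z, r}"
  by (auto simp: fOr_def fImp_def fAll_def fLe_def fPad_def fCard_le_def)

lemma over_connectives [simp]:
  "fom_over \<sigma> (fOr \<phi> \<psi>) \<longleftrightarrow> fom_over \<sigma> \<phi> \<and> fom_over \<sigma> \<psi>"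
  "fom_over \<sigma> (fImp \<phi> \<psi>) \<longleftrightarrow> fom_over \<sigma> \<phi> \<and> fom_over \<sigma> \<psi>"
  "fom_over \<sigma> (fAll x \<phi>) \<longleftrightarrow> fom_over \<sigma> \<phi>"
  "fom_over \<sigma> (fLe x y)"
  "fom_over \<sigma> (fCard_le z r \<phi> \<psi>) \<longleftrightarrow> fom_over \<sigma> \<phi> \<and> fom_over \<sigma> \<psi>"
  by (auto simp: fOr_def fImp_def fAll_def fLe_def fPad_def fCard_le_def)

lemma sat_cong: "(\<And>x. x \<in> fv \<phi> \<Longrightarrow> e x = e' x) \<Longrightarrow> sat S e \<phi> \<longleftrightarrow> sat S e' \<phi>"
proof (induction \<phi> arbitrary: e e')
  case (Rel R xs)
  then have "map e xs = map e' xs" by simp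
  then show ?case by (simp only: sat.simps)
next
  case (Conj \<phi> \<psi>)
  then show ?case by (metis UnI1 UnI2 fv.simps(6) sat.simps(6))
next
  case (Exists x \<phi>)
  have "sat S (e(x := a)) \<phi> \<longleftrightarrow> sat S (e'(x := a)) \<phi>" for a
    using Exists.prems by (intro Exists.IH) auto
  then show ?case by simp
next
  case (Majority x \<phi>)
  have "sat S (e(x := a)) \<phi> \<longleftrightarrow> sat S (e'(x := a)) \<phi>" for a
    using Majority.prems by (intro Majority.IH) auto
  then show ?case by simp
next
  case (Neg \<phi>)
  have "sat S e \<phi> \<longleftrightarrow> sat S e' \<phi>" by (rule Neg.IH, rule Neg.prems, simp)
  then show ?case by (simp only: sat.simps)
next
  case (Eq x y)
  have "e x = e' x" "e y = e' y" by (rule Eq; simp)+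
  then show ?case by (simp only: sat.simps)
next
  case (Less x y)
  have "e x = e' x" "e y = e' y" by (rule Less; simp)+
  then show ?case by (simp only: sat.simps)
next
  case (Bit x y)
  have "e x = e' x" "e y = e' y" by (rule Bit; simp)+
  then show ?case by (simp only: sat.simps)
qed

lemma sat_fCard_le:
  assumes r: "r \<notin> fv \<phi>" "r \<notin> fv \<psi>" "r \<noteq> z" and S: "1 \<le> usize S"
  shows "sat S e (fCard_le z r \<phi> \<psi>) \<longleftrightarrow>
    card {a \<in> universe S. sat S (e(z := a)) \<phi>} \<le> card {a \<in> universe S. sat S (e(z := a)) \<psi>}"
proof -
  let ?X = "{a \<in> universe S. sat S (e(z := a)) \<phi>}" and ?Y = "{a \<in> universe S. sat S (e(z := a)) \<psi>}"
  let ?n = "usize S"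
  let ?R = "{a \<in> {1..?n}. a \<in> ?X \<longleftrightarrow> a \<in> ?Y}"
  have c: "card (universe S) = ?n" by (simp add: universe_def)
  have e: "sat S (e(r := b, z := a)) \<phi> = sat S (e(z := a)) \<phi>"
    "sat S (e(r := b, z := a)) \<psi> = sat S (e(z := a)) \<psi>" for a b
    using r by (auto intro!: sat_cong)
  have pad: "sat S (e(r := b)) (fPad z \<phi> \<psi> \<chi>) \<longleftrightarrow> ?n < 2 * card ((?X - ?Y) \<union> {a \<in> ?R. sat S (e(r := b, z := a)) \<chi>})"
    "sat S (e(r := b)) (fPad z \<psi> \<phi> \<chi>) \<longleftrightarrow> ?n < 2 * card ((?Y - ?X) \<union> {a \<in> ?R. sat S (e(r := b, z := a)) \<chi>})"
    for b \<chi>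
  proof -
    have "{a \<in> universe S. (sat S (e(z := a)) \<phi> \<and> \<not> sat S (e(z := a)) \<psi>) \<or>
        ((sat S (e(z := a)) \<phi> \<longrightarrow> sat S (e(z := a)) \<psi>) \<and> (sat S (e(z := a)) \<psi> \<longrightarrow> sat S (e(z := a)) \<phi>)) \<and>
        sat S (e(r := b, z := a)) \<chi>} = (?X - ?Y) \<union> {a \<in> ?R. sat S (e(r := b, z := a)) \<chi>}"
      "{a \<in> universe S. (sat S (e(z := a)) \<psi> \<and> \<not> sat S (e(z := a)) \<phi>) \<or>
        ((sat S (e(z := a)) \<psi> \<longrightarrow> sat S (e(z := a)) \<phi>) \<and> (sat S (e(z := a)) \<phi> \<longrightarrow> sat S (e(z := a)) \<psi>)) \<and>
        sat S (e(r := b, z := a)) \<chi>} = (?Y - ?X) \<union> {a \<in> ?R. sat S (e(r := b, z := a)) \<chi>}"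
      unfolding universe_def by blast+
    then show "sat S (e(r := b)) (fPad z \<phi> \<psi> \<chi>) \<longleftrightarrow> ?n < 2 * card ((?X - ?Y) \<union> {a \<in> ?R. sat S (e(r := b, z := a)) \<chi>})"
      "sat S (e(r := b)) (fPad z \<psi> \<phi> \<chi>) \<longleftrightarrow> ?n < 2 * card ((?Y - ?X) \<union> {a \<in> ?R. sat S (e(r := b, z := a)) \<chi>})"
      by (simp_all only: fPad_def sat.simps sat_connectives e c)
  qed
  have z: "(e(r := b, z := a)) z = a" "(e(r := b, z := a)) r = b" for a b using r by simp_all
  have "sat S e (fCard_le z r \<phi> \<psi>) \<longleftrightarrow> (\<forall>b\<in>{1..?n}.
      (?n < 2 * card ((?X - ?Y) \<union> {a \<in> ?R. a \<le> b}) \<longrightarrow> ?n < 2 * card ((?Y - ?X) \<union> {a \<in> ?R. a \<le> b})) \<and>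
      (?n < 2 * card ((?X - ?Y) \<union> {a \<in> ?R. a < b}) \<longrightarrow> ?n < 2 * card ((?Y - ?X) \<union> {a \<in> ?R. a < b})))"
    unfolding fCard_le_def sat_connectives sat.simps pad z universe_def[of S, symmetric] ..
  also have "\<dots> \<longleftrightarrow> card ?X \<le> card ?Y"
    using S by (intro card_le_via_majority) (auto simp: universe_def)
  finally show ?thesis .
qed


section \<open>The formulas\<close>

text \<open>To avoid capture, a formula is only applied to variables below those that it binds; this is
  what the numerical bounds in the lemmas on satisfaction say.  The exceptions are \<open>10\<close>, \<open>11\<close>
  and \<open>12\<close>, which are bound in the last three formulas.\<close>

primrec fEdge :: "nat \<Rightarrow> nat \<Rightarrow> nat \<Rightarrow> 'a tree_sym fom" where
  "fEdge 0 x y = Less x x"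
| "fEdge (Suc i) x y = fOr (fEdge i x y) (Rel (Edge (Suc i)) [x, y])"

definition fAnc :: "nat \<Rightarrow> nat \<Rightarrow> 'a tree_sym fom" where
  "fAnc x y = Rel Anc [x, y]"

definition fSize_le :: "nat \<Rightarrow> nat \<Rightarrow> 'a tree_sym fom" where
  "fSize_le x y = fCard_le 100 101 (fAnc x 100) (fAnc y 100)"

text \<open>The number c is represented by the set of the c elements up to c.\<close>

definition fSize_ge :: "nat \<Rightarrow> nat \<Rightarrow> 'a tree_sym fom" where
  "fSize_ge c x = fCard_le 100 101 (fLe 100 c) (fAnc x 100)"

definition fHeavy :: "nat \<Rightarrow> nat \<Rightarrow> nat \<Rightarrow> 'a tree_sym fom" where
  "fHeavy k x y = Conj (fEdge k x y) (fAll 90 (fImp (fEdge k x 90)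
     (Conj (fSize_le 90 y) (fImp (fSize_le y 90) (fLe y 90)))))"

text \<open>For a leaf the second condition is vacuous, in accordance with a missing heavy child of
  size 0.\<close>

definition fInterval :: "nat \<Rightarrow> nat \<Rightarrow> nat \<Rightarrow> 'a tree_sym fom" where
  "fInterval k x c = Conj (fSize_ge c x) (fAll 80 (fImp (fHeavy k x 80) (Neg (fSize_ge c 80))))"

text \<open>Positions start at 1, so j stands for the exponent j - 1.\<close>

definition fDvd :: "nat \<Rightarrow> nat \<Rightarrow> 'a tree_sym fom" where
  "fDvd j c = fAll 80 (fImp (Less 80 j) (Neg (Bit c 80)))"

definition fMult :: "nat \<Rightarrow> nat \<Rightarrow> nat \<Rightarrow> 'a tree_sym fom" where
  "fMult k j x = Exists 70 (Conj (fInterval k x 70) (fDvd j 70))"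

definition fEv_le :: "nat \<Rightarrow> nat \<Rightarrow> nat \<Rightarrow> 'a tree_sym fom" where
  "fEv_le k x y = fAll 60 (fImp (fMult k 60 x) (fMult k 60 y))"

definition fPath :: "nat \<Rightarrow> nat \<Rightarrow> nat \<Rightarrow> 'a tree_sym fom" where
  "fPath k x y = Conj (fAnc x y) (fAll 50 (fImp (Conj (fAnc x 50) (Conj (Neg (Eq 50 x)) (fAnc 50 y)))
     (Exists 51 (fHeavy k 51 50))))"

definition fTop :: "nat \<Rightarrow> nat \<Rightarrow> nat \<Rightarrow> 'a tree_sym fom" where
  "fTop k v m = fOr (Eq v m) (fAll 12 (fImp (fHeavy k 12 v) (fEv_le k m 12)))"

text \<open>For z = 0 the condition \<open>zmax\<close> is trivial, and \<open>shape\<close> reduces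
  to \<open>fTop\<close>.\<close>

definition fSubtree :: "nat \<Rightarrow> 'a tree_sym fom" where
  "fSubtree k = Exists 10 (Conj (fPath k 0 10)
     (Conj (fAll 11 (fImp (Conj (fPath k 0 11) (Neg (Eq 11 10))) (Neg (fEv_le k 10 11))))
       (fTop k 0 10)))"

text \<open>By acyclicity, x is strictly above z iff it reaches z and differs from it, so
  \<open>fPath\<close> suffices to describe the segment. The last disjunction is
  \<open>shape\<close> for z different from 0.\<close>

definition fContext :: "nat \<Rightarrow> 'a tree_sym fom" where
  "fContext k = Exists 10 (Conj (Conj (fPath k 0 10) (Conj (fPath k 10 1) (Neg (Eq 10 1))))
     (Conj (fAll 11 (fImp (Conj (Conj (fPath k 0 11) (Conj (fPath k 11 1) (Neg (Eq 11 1)))) (Neg (Eq 11 10)))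
         (Neg (fEv_le k 10 11))))
       (fOr (Conj (Eq 0 10) (fHeavy k 10 1)) (Conj (fEv_le k 10 1) (fTop k 0 10)))))"

section \<open>Free variables and vocabularies of the formulas\<close>

lemma fv_fEdge: "fv (fEdge i x y) \<subseteq> {x, y}"
  by (induction i) auto

lemma fv_formulas:
  "fv (fAnc x y) = {x, y}"
  "fv (fSize_le x y) \<subseteq> {x, y}"
  "fv (fSize_ge x y) \<subseteq> {x, y}"
  "fv (fDvd x y) \<subseteq> {x, y}"
  by (auto simp: fAnc_def fSize_le_def fSize_ge_def fDvd_def)

lemma fv_fHeavy: "fv (fHeavy k x y) \<subseteq> {x, y}"
  using fv_fEdge fv_formulas(2) unfolding fHeavy_def by fastforce

lemma fv_fEv_le: "fv (fEv_le k x y) \<subseteq> {x, y}"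
proof -
  have "fv (fInterval k x y) \<subseteq> {x, y}" for x y
    using fv_fHeavy[of k x 80] fv_formulas(3)[of y] unfolding fInterval_def by auto
  then have "fv (fMult k j x) \<subseteq> {j, x}" for j x
    using fv_formulas(4)[of j 70] unfolding fMult_def by fastforce
  then show ?thesis unfolding fEv_le_def by fastforce
qed

lemma fv_fPath: "fv (fPath k x y) \<subseteq> {x, y}"
  using fv_fHeavy[of k 51 50] fv_formulas(1) unfolding fPath_def by auto

lemma fv_fTop: "fv (fTop k x y) \<subseteq> {x, y}"
  using fv_fHeavy[of k 12 x] fv_fEv_le[of k y 12] unfolding fTop_def by auto

lemma fv_fSubtree: "fv (fSubtree k) \<subseteq> {0}"
  using fv_fPath[of k 0 10] fv_fPath[of k 0 11] fv_fEv_le[of k 10 11] fv_fTop[of k 0 10]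
  unfolding fSubtree_def by auto

lemma fv_fContext: "fv (fContext k) \<subseteq> {0, 1}"
  using fv_fPath[of k 0 10] fv_fPath[of k 0 11] fv_fPath[of k 10 1] fv_fPath[of k 11 1]
    fv_fEv_le[of k 10 11] fv_fEv_le[of k 10 1] fv_fTop[of k 0 10] fv_fHeavy[of k 10 1]
  unfolding fContext_def by auto

lemma over_fEdge: "j \<le> k \<Longrightarrow> fom_over (tree_vocabulary k A) (fEdge j x y)"
  by (induction j) (auto simp: tree_vocabulary_def)

lemma over_formulas:
  "fom_over (tree_vocabulary k A) (fAnc x y)"
  "fom_over (tree_vocabulary k A) (fSize_le x y)"
  "fom_over (tree_vocabulary k A) (fSize_ge x y)"
  "fom_over (tree_vocabulary k A) (fHeavy k x y)"
  "fom_over (tree_vocabulary k A) (fEv_le k x y)"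
  "fom_over (tree_vocabulary k A) (fPath k x y)"
  "fom_over (tree_vocabulary k A) (fTop k x y)"
  "fom_over (tree_vocabulary k A) (fSubtree k)"
  "fom_over (tree_vocabulary k A) (fContext k)"
  by (simp_all add: fAnc_def fSize_le_def fSize_ge_def fHeavy_def fInterval_def fDvd_def fMult_def
      fEv_le_def fPath_def fTop_def fSubtree_def fContext_def over_fEdge)
    (simp_all add: tree_vocabulary_def)

lemma dvd_iff_no_low_bits: "2 ^ m dvd (c::nat) \<longleftrightarrow> (\<forall>i<m. \<not> bit c i)"
  by (simp add: take_bit_eq_0_iff[symmetric] bit_eq_iff bit_take_bit_iff)

section \<open>Semantics of the formulas\<close>

context ord_tree
begin

lemma usize_pos: "1 \<le> usize T"
  using T_struc by (simp add: STRUC_def)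

lemma sat_fEdge: "sat T e (fEdge j x y) \<longleftrightarrow> (\<exists>i\<in>{1..j}. (e x, e y) \<in> edges T i)"
  by (induction j) (auto simp: edges_def atLeastAtMostSuc_conv)

lemma sat_fEdge_k: "sat T e (fEdge k x y) \<longleftrightarrow> (e x, e y) \<in> tree_edges T"
  using sat_fEdge tree_edges_index edges_sub by blast

lemma sat_fAnc: "sat T e (fAnc x y) \<longleftrightarrow> e y \<in> D (e x)"
  by (simp add: fAnc_def D_eq descendants_def)

lemma univ_D: "{a \<in> universe T. a \<in> D x} = D x"
  using D_subset_V by blast

lemma sat_fSize_le: "x < 100 \<Longrightarrow> y < 100 \<Longrightarrow> sat T e (fSize_le x y) \<longleftrightarrow> sz (e x) \<le> sz (e y)"
  unfolding fSize_le_def using usize_pos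
  by (subst sat_fCard_le) (auto simp: fv_formulas sat_fAnc univ_D)

lemma sat_fSize_ge:
  assumes "c < 100" "x < 100" "e c \<in> universe T"
  shows "sat T e (fSize_ge c x) \<longleftrightarrow> e c \<le> sz (e x)"
proof -
  have "{a \<in> universe T. a \<le> e c} = {1..e c}" using assms(3) by (auto simp: universe_def)
  then show ?thesis
    unfolding fSize_ge_def using usize_pos assms
    by (subst sat_fCard_le) (auto simp: fv_formulas sat_fAnc univ_D)
qed

lemma sat_fHeavy:
  assumes "x < 90" "y < 90" "e y \<in> universe T"
  shows "sat T e (fHeavy k x y) \<longleftrightarrow> hc (e x) = e y"
proof -
  have "sat T e (fHeavy k x y) \<longleftrightarrow> (e x, e y) \<in> tree_edges T \<and>
    (\<forall>u\<in>universe T. (e x, u) \<in> tree_edges T \<longrightarrow> sz u \<le> sz (e y) \<and> (sz (e y) \<le> sz u \<longrightarrow> e y \<le> u))"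
    using assms by (simp add: fHeavy_def sat_fEdge_k sat_fSize_le)
  also have "\<dots> \<longleftrightarrow> heavy (e x) (e y)"
  proof -
    have "sz u \<le> sz (e y) \<and> (sz (e y) \<le> sz u \<longrightarrow> e y \<le> u) \<longleftrightarrow>
      sz u < sz (e y) \<or> (sz u = sz (e y) \<and> e y \<le> u)" for u by linarith
    then show ?thesis unfolding heavy_def using E_V(2) by blast
  qed
  finally show ?thesis using hc_heavy V_nz[OF assms(3)] by simp
qed

lemma sat_fInterval:
  assumes "x < 80" "c < 80" "e c \<in> universe T"
  shows "sat T e (fInterval k x c) \<longleftrightarrow> sz (hc (e x)) < e c \<and> e c \<le> sz (e x)"
proof -
  have "sat T e (fInterval k x c) \<longleftrightarrow>
    e c \<le> sz (e x) \<and> (\<forall>u\<in>universe T. hc (e x) = u \<longrightarrow> \<not> e c \<le> sz u)"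
    using assms by (simp add: fInterval_def sat_fSize_ge sat_fHeavy cong: ball_cong)
  moreover have "(\<forall>u\<in>universe T. hc (e x) = u \<longrightarrow> \<not> e c \<le> sz u) \<longleftrightarrow> \<not> e c \<le> sz (hc (e x))"
  proof (cases "hc (e x) = 0")
    \<comment> \<open>For a leaf no domain element is the heavy child, and the right-hand side holds
      because the number is positive while \<open>sz 0\<close> is 0.\<close>
    case True
    then show ?thesis using V_nz assms(3) by auto
  next
    case False
    then have "hc (e x) \<in> universe T" using hc_edge E_V(2) by blast
    then show ?thesis by blast
  qed
  ultimately show ?thesis by auto
qed

lemma sat_fDvd:
  assumes "j < 80" "c < 80" "e j \<in> universe T"
  shows "sat T e (fDvd j c) \<longleftrightarrow> 2 ^ (e j - 1) dvd e c"
proof -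
  have "sat T e (fDvd j c) \<longleftrightarrow> (\<forall>i\<in>universe T. i < e j \<longrightarrow> \<not> bit (e c) (i - 1))"
    using assms by (simp add: fDvd_def)
  also have "\<dots> \<longleftrightarrow> (\<forall>i<e j - 1. \<not> bit (e c) i)"
  proof safe
    fix i assume a: "\<forall>i\<in>universe T. i < e j \<longrightarrow> \<not> bit (e c) (i - 1)" "i < e j - 1" "bit (e c) i"
    then have "Suc i \<in> universe T" "Suc i < e j" using assms(3) by (auto simp: universe_def)
    then show False using a(1,3) by fastforce
  next
    fix i assume a: "\<forall>i<e j - 1. \<not> bit (e c) i" "i \<in> universe T" "i < e j" "bit (e c) (i - 1)"
    then have "i - 1 < e j - 1" by (auto simp: universe_def)
    then show False using a by blast
  qed
  finally show ?thesis by (simp only: dvd_iff_no_low_bits)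
qed

lemma sat_fMult:
  assumes "j < 70" "x < 70" "e j \<in> universe T"
  shows "sat T e (fMult k j x) \<longleftrightarrow> has_mult (e j - 1) (e x)"
proof -
  have "sat T e (fMult k j x) \<longleftrightarrow>
    (\<exists>c\<in>universe T. (sz (hc (e x)) < c \<and> c \<le> sz (e x)) \<and> 2 ^ (e j - 1) dvd c)"
    using assms by (simp add: fMult_def sat_fInterval sat_fDvd cong: bex_cong)
  also have "\<dots> \<longleftrightarrow> has_mult (e j - 1) (e x)"
  proof
    assume "\<exists>c\<in>universe T. (sz (hc (e x)) < c \<and> c \<le> sz (e x)) \<and> 2 ^ (e j - 1) dvd c"
    then obtain c where "sz (hc (e x)) < c" "c \<le> sz (e x)" "2 ^ (e j - 1) dvd c" by blast
    moreover from this(3) obtain d where "c = d * 2 ^ (e j - 1)" by (metis dvd_div_mult_self)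
    ultimately show "has_mult (e j - 1) (e x)" unfolding has_mult_def by blast
  next
    assume "has_mult (e j - 1) (e x)"
    then obtain d where d: "sz (hc (e x)) < d * 2 ^ (e j - 1)" "d * 2 ^ (e j - 1) \<le> sz (e x)"
      by (auto simp: has_mult_def)
    \<comment> \<open>The multiple is positive and at most the size of a subtree, hence itself an
      element of the domain.\<close>
    moreover have "d * 2 ^ (e j - 1) \<in> universe T"
    proof -
      have "card (universe T) = usize T" by (simp add: universe_def)
      then have "d * 2 ^ (e j - 1) \<le> usize T" "0 < d * 2 ^ (e j - 1)"
        using d sz_le[of "e x"] by linarith+
      then show ?thesis by (simp add: universe_def)
    qed
    ultimately show "\<exists>c\<in>universe T. (sz (hc (e x)) < c \<and> c \<le> sz (e x)) \<and> 2 ^ (e j - 1) dvd c"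
      using dvd_triv_right by blast
  qed
  finally show ?thesis .
qed

lemma sat_fEv_le:
  assumes "x < 60" "y < 60" "e x \<in> universe T" "e y \<in> universe T"
  shows "sat T e (fEv_le k x y) \<longleftrightarrow> ev (e x) \<le> ev (e y)"
proof -
  have "sat T e (fEv_le k x y) \<longleftrightarrow> (\<forall>j\<in>universe T. has_mult (j - 1) (e x) \<longrightarrow> has_mult (j - 1) (e y))"
    using assms by (simp add: fEv_le_def sat_fMult cong: ball_cong)
  also have "\<dots> \<longleftrightarrow> (\<forall>j\<in>universe T. j - 1 \<le> ev (e x) \<longrightarrow> j - 1 \<le> ev (e y))"
    using assms by (simp add: has_mult_iff)
  also have "\<dots> \<longleftrightarrow> ev (e x) \<le> ev (e y)"
  proof
    assume a: "\<forall>j\<in>universe T. j - 1 \<le> ev (e x) \<longrightarrow> j - 1 \<le> ev (e y)"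
    \<comment> \<open>Exponents are shifted by one, so the domain has to reach one beyond the
      priority. It does, since a priority p satisfies p < 2^p and 2^p is at most the number of
      nodes.\<close>
    have "ev (e x) < 2 ^ ev (e x)" by (rule less_exp)
    also have "\<dots> \<le> card (universe T)" using ev_le[OF assms(3)] sz_le by (rule order_trans)
    finally have "Suc (ev (e x)) \<in> universe T" by (simp add: universe_def)
    then show "ev (e x) \<le> ev (e y)" using a by fastforce
  qed auto
  finally show ?thesis .
qed

lemma sat_fPath:
  assumes "x < 50" "y < 50" "e x \<in> universe T" "e y \<in> universe T"
  shows "sat T e (fPath k x y) \<longleftrightarrow> (e x, e y) \<in> H\<^sup>*"
proof -
  have "sat T e (fPath k x y) \<longleftrightarrow> e y \<in> D (e x) \<and>
    (\<forall>a\<in>universe T. a \<in> D (e x) \<and> a \<noteq> e x \<and> e y \<in> D a \<longrightarrow> (\<exists>u\<in>universe T. hc u = a))"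
    using assms by (simp add: fPath_def sat_fAnc sat_fHeavy cong: ball_cong)
  also have "\<dots> \<longleftrightarrow> e y \<in> D (e x) \<and>
    (\<forall>a. a \<in> D (e x) \<and> a \<noteq> e x \<and> e y \<in> D a \<longrightarrow> (\<exists>u. hc u = a))"
  proof -
    have "(\<exists>u\<in>universe T. hc u = a) \<longleftrightarrow> (\<exists>u. hc u = a)" if "a \<in> universe T" for a
      using that hc_outside V_nz by metis
    moreover have "a \<in> universe T" if "a \<in> D (e x)" for a using that D_subset_V by blast
    ultimately show ?thesis by blast
  qed
  also have "\<dots> \<longleftrightarrow> (e x, e y) \<in> H\<^sup>*" using H_star_iff[OF assms(3) V_nz[OF assms(4)]] by simp
  finally show ?thesis .
qed

lemma sat_fTop:
  assumes "v < 50" "m < 50" "v \<noteq> 12" "m \<noteq> 12" "e v \<in> universe T" "e m \<in> universe T"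
  shows "sat T e (fTop k v m) \<longleftrightarrow> e v = e m \<or> vmax (e v) (e m)"
proof -
  have "sat T e (fTop k v m) \<longleftrightarrow> e v = e m \<or> (\<forall>x\<in>universe T. hc x = e v \<longrightarrow> ev (e m) \<le> ev x)"
    using assms by (simp add: fTop_def sat_fHeavy sat_fEv_le cong: ball_cong)
  also have "(\<forall>x\<in>universe T. hc x = e v \<longrightarrow> ev (e m) \<le> ev x) \<longleftrightarrow> vmax (e v) (e m)"
    unfolding vmax_def using hc_outside V_nz[OF assms(5)] by metis
  finally show ?thesis .
qed

lemma mk_P: "mk p \<in> P \<longleftrightarrow> p \<in> P0"
  using mk_inj unfolding P_def by blast

lemma sat_fSubtree:
  assumes v: "e 0 \<in> universe T"
  shows "sat T e (fSubtree k) \<longleftrightarrow> Subtree (e 0) \<in> P"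
proof -
  have "sat T e (fSubtree k) \<longleftrightarrow> (\<exists>m\<in>universe T. (e 0, m) \<in> H\<^sup>* \<and>
    (\<forall>x\<in>universe T. (e 0, x) \<in> H\<^sup>* \<and> x \<noteq> m \<longrightarrow> \<not> ev m \<le> ev x) \<and> (e 0 = m \<or> vmax (e 0) m))"
    using v by (simp add: fSubtree_def sat_fPath sat_fEv_le sat_fTop cong: bex_cong ball_cong)
  also have "\<dots> \<longleftrightarrow> (\<exists>m\<in>seg (e 0) 0. (\<forall>x\<in>seg (e 0) 0. x \<noteq> m \<longrightarrow> ev x < ev m) \<and> shape (e 0) 0 m)"
  proof -
    have "x \<in> seg (e 0) 0 \<longleftrightarrow> x \<in> universe T \<and> (e 0, x) \<in> H\<^sup>*" for x
      using H_to_zero seg_V by (auto simp: seg_def)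
    moreover have "shape (e 0) 0 m \<longleftrightarrow> e 0 = m \<or> vmax (e 0) m" for m
      by (auto simp: shape_def zmax_def)
    ultimately show ?thesis by (simp only: not_le Bex_def Ball_def) blast
  qed
  also have "\<dots> \<longleftrightarrow> (e 0, 0) \<in> P0" by (rule P0_iff_ex[symmetric])
  also have "\<dots> \<longleftrightarrow> Subtree (e 0) \<in> P" using mk_P[of "(e 0, 0)"] by (simp add: mk_def)
  finally show ?thesis .
qed

lemma sat_fContext:
  assumes v: "e 0 \<in> universe T" "e 1 \<in> universe T"
  shows "sat T e (fContext k) \<longleftrightarrow> Context (e 0) (e 1) \<in> P"
proof -
  let ?s = "\<lambda>x. (e 0, x) \<in> H\<^sup>* \<and> (x, e 1) \<in> H\<^sup>* \<and> x \<noteq> e 1"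
  have e1: "e (Suc 0) \<in> universe T" using v by simp
  have "sat T e (fContext k) \<longleftrightarrow> (\<exists>m\<in>universe T. ?s m \<and>
    (\<forall>x\<in>universe T. ?s x \<and> x \<noteq> m \<longrightarrow> \<not> ev m \<le> ev x) \<and>
    ((e 0 = m \<and> hc m = e 1) \<or> (ev m \<le> ev (e 1) \<and> (e 0 = m \<or> vmax (e 0) m))))"
    using v e1 by (simp add: fContext_def sat_fPath sat_fEv_le sat_fHeavy sat_fTop cong: bex_cong ball_cong)
  also have "\<dots> \<longleftrightarrow> (\<exists>m\<in>seg (e 0) (e 1). (\<forall>x\<in>seg (e 0) (e 1). x \<noteq> m \<longrightarrow> ev x < ev m) \<and>
    shape (e 0) (e 1) m)"
  proof -
    have "x \<in> seg (e 0) (e 1) \<longleftrightarrow> x \<in> universe T \<and> ?s x" for x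
    proof -
      have "(x, e 1) \<in> H\<^sup>+ \<longleftrightarrow> (x, e 1) \<in> H\<^sup>* \<and> x \<noteq> e 1"
        using H_acyclic by (metis rtranclD trancl_into_rtrancl)
      then show ?thesis using seg_V[of x "e 0" "e 1"] by (auto simp: seg_def)
    qed
    moreover have "shape (e 0) (e 1) m \<longleftrightarrow>
      (e 0 = m \<and> hc m = e 1) \<or> (ev m \<le> ev (e 1) \<and> (e 0 = m \<or> vmax (e 0) m))" for m
      using V_nz[OF v(2)] by (auto simp: shape_def zmax_def)
    ultimately show ?thesis by (simp only: not_le Bex_def Ball_def) blast
  qed
  also have "\<dots> \<longleftrightarrow> (e 0, e 1) \<in> P0" by (rule P0_iff_ex[symmetric])
  also have "\<dots> \<longleftrightarrow> Context (e 0) (e 1) \<in> P"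
    using mk_P[of "(e 0, e 1)"] V_nz[OF v(2)] by (simp add: mk_def)
  finally show ?thesis .
qed

end

section \<open>The interpretation\<close>

text \<open>One-dimensional with a trivial domain formula: the numbering of tuples is the identity,
  so the output has the same nodes and tree relations, and only the two pattern relations are
  computed.\<close>

definition hier_interp :: "nat \<Rightarrow> ('a tree_sym, 'a hier_sym) fom_interp" where
  "hier_interp k = \<lparr>dimension = 1, dom_formula = Eq 0 0,
     rel_formula = (\<lambda>s. case s of
         Tree_Rel t \<Rightarrow> (case t of Edge i \<Rightarrow> Rel t [0, 1] | Anc \<Rightarrow> Rel t [0, 1] | Label a \<Rightarrow> Rel t [0])
       | Subtree_Patterns \<Rightarrow> fSubtree k
       | Context_Patterns \<Rightarrow> fContext k)\<rparr>"

lemma interp_tuples_unary: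
  assumes "dimension I = 1" "dom_formula I = Eq 0 0"
  shows "interp_tuples I S = (\<lambda>a. [a]) ` universe S"
  using assms by (auto simp: interp_tuples_def length_Suc_conv)

lemma tuple_index_unary:
  assumes "dimension I = 1" "dom_formula I = Eq 0 0" "a \<in> universe S"
  shows "tuple_index I S [a] = a"
proof -
  have "{ys \<in> interp_tuples I S. (ys, [a]) \<in> lex less_than} = (\<lambda>b. [b]) ` {1..<a}"
    using assms by (auto simp: interp_tuples_unary universe_def)
  moreover have "card ((\<lambda>b. [b]) ` {1..<a}) = card {1..<a}" by (rule card_image) (simp add: inj_on_def)
  ultimately show ?thesis using assms(3) by (simp add: tuple_index_def universe_def)
qed

lemma interp_rel_unary:
  assumes I: "dimension I = 1" "dom_formula I = Eq 0 0"
  shows "{map (tuple_index I S) xss | xss. length xss = n \<and> set xss \<subseteq> interp_tuples I S \<and>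
      sat S (nth (concat xss)) \<phi>} = {xs. length xs = n \<and> set xs \<subseteq> universe S \<and> sat S (nth xs) \<phi>}"
    (is "?L = ?R")
proof (intro set_eqI iffI)
  fix xs assume "xs \<in> ?R"
  then have xs: "length xs = n" "set xs \<subseteq> universe S" "sat S (nth xs) \<phi>" by auto
  have c: "concat (map (\<lambda>a. [a]) xs) = xs" by (induction xs) auto
  have "map (tuple_index I S) (map (\<lambda>a. [a]) xs) = xs"
    using xs(2) tuple_index_unary[OF I] by (auto intro!: map_idI)
  moreover have "set (map (\<lambda>a. [a]) xs) \<subseteq> interp_tuples I S"
    using xs(2) by (auto simp: interp_tuples_unary[OF I])
  ultimately show "xs \<in> ?L"
    using xs c by (intro CollectI exI[of _ "map (\<lambda>a. [a]) xs"]) auto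
next
  fix ys assume "ys \<in> ?L"
  then obtain xss where xss: "ys = map (tuple_index I S) xss" "length xss = n"
    "set xss \<subseteq> (\<lambda>a. [a]) ` universe S" "sat S (nth (concat xss)) \<phi>"
    by (auto simp: interp_tuples_unary[OF I])
  have "ys = concat xss \<and> length (concat xss) = length xss \<and> set (concat xss) \<subseteq> universe S"
    using xss(3) unfolding xss(1) by (induction xss) (auto simp: tuple_index_unary[OF I])
  then show "ys \<in> ?R" using xss(2,4) by auto
qed

lemma hier_interp_valid: "fom_interpretation (tree_vocabulary k A) (hier_vocabulary k A) (hier_interp k)"
  unfolding fom_interpretation_def
proof (intro conjI allI impI)
  fix s r assume s: "hier_vocabulary k A s = Some r"
  show "fom_over (tree_vocabulary k A) (rel_formula (hier_interp k) s)"
    using s over_formulas(8,9)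
    by (auto simp: hier_interp_def hier_vocabulary_def tree_vocabulary_def split: hier_sym.splits tree_sym.splits if_splits)
  show "fv (rel_formula (hier_interp k) s) \<subseteq> {..<r * dimension (hier_interp k)}"
    using s fv_fSubtree[of k] fv_fContext[of k]
    by (auto simp: hier_interp_def hier_vocabulary_def tree_vocabulary_def split: hier_sym.splits tree_sym.splits if_splits)
qed (auto simp: hier_interp_def)

context ord_tree
begin

lemma rels_case: "case tree_vocabulary k A t of None \<Rightarrow> rels T t = {}
    | Some r \<Rightarrow> rels T t \<subseteq> {xs. length xs = r \<and> set xs \<subseteq> universe T}"
  using T_struc unfolding STRUC_def by blast

lemma rels_sub: "tree_vocabulary k A t = Some r \<Longrightarrow> rels T t \<subseteq> {xs. length xs = r \<and> set xs \<subseteq> universe T}"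
  using rels_case[of t] by simp

lemma rels_none: "tree_vocabulary k A t = None \<Longrightarrow> rels T t = {}"
  using rels_case[of t] by simp

lemma P_is_pattern: "p \<in> P \<Longrightarrow> is_pattern T p"
  using P_hierarchical by (simp add: hierarchical_definition_def)

lemma Context_universe: "Context v z \<in> P \<Longrightarrow> v \<in> universe T \<and> z \<in> universe T"
  using P_is_pattern[of "Context v z"] D_subset_V by (auto simp: D_eq[symmetric])

lemma Subtree_universe: "Subtree v \<in> P \<Longrightarrow> v \<in> universe T"
  using P_is_pattern by fastforce

lemma hier_struc_eq: "hier_struc T P = interp_struc (hier_vocabulary k A) (hier_interp k) T"
proof -
  let ?I = "hier_interp k :: ('a tree_sym, 'a hier_sym) fom_interp"
  have I: "dimension ?I = 1" "dom_formula ?I = Eq 0 0" by (simp_all add: hier_interp_def)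
  have "card ((\<lambda>a. [a]) ` universe T) = card (universe T)" by (rule card_image) (simp add: inj_on_def)
  then have size: "card (interp_tuples ?I T) = usize T"
    unfolding interp_tuples_unary[OF I] by (simp add: universe_def)
  have two: "length xs = 2 \<longleftrightarrow> (\<exists>x y. xs = [x, y])" for xs :: "nat list"
    by (auto simp: numeral_2_eq_2 length_Suc_conv)
  have one: "length xs = 1 \<longleftrightarrow> (\<exists>x. xs = [x])" for xs :: "nat list"
    by (auto simp: length_Suc_conv)
  have "rels (hier_struc T P) s = (case hier_vocabulary k A s of None \<Rightarrow> {} | Some r \<Rightarrow>
      {xs. length xs = r \<and> set xs \<subseteq> universe T \<and> sat T (nth xs) (rel_formula ?I s)})" for s
  proof (cases s)
    case (Tree_Rel t)
    show ?thesis
    proof (cases "tree_vocabulary k A t")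
      case None
      then show ?thesis using Tree_Rel rels_none by (simp add: hier_struc_def hier_vocabulary_def)
    next
      case (Some r)
      have "sat T (nth xs) (rel_formula ?I s) \<longleftrightarrow> xs \<in> rels T t" if r: "length xs = r" for xs
      proof (cases t)
        case (Label a)
        then have "\<exists>x. xs = [x]" using r Some one by (auto simp: tree_vocabulary_def split: if_splits)
        then show ?thesis using Tree_Rel Label by (auto simp: hier_interp_def)
      next
        case (Edge i)
        then have "\<exists>x y. xs = [x, y]" using r Some two by (auto simp: tree_vocabulary_def split: if_splits)
        then show ?thesis using Tree_Rel Edge by (auto simp: hier_interp_def)
      next
        case Anc
        then have "\<exists>x y. xs = [x, y]" using r Some two by (auto simp: tree_vocabulary_def)
        then show ?thesis using Tree_Rel Anc by (auto simp: hier_interp_def)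
      qed
      then show ?thesis
        using Tree_Rel Some rels_sub[OF Some] by (auto simp: hier_struc_def hier_vocabulary_def)
    qed
  next
    case Subtree_Patterns
    have "xs \<in> {[v] | v. Subtree v \<in> P} \<longleftrightarrow>
      length xs = 1 \<and> set xs \<subseteq> universe T \<and> sat T (nth xs) (fSubtree k)" for xs
      using sat_fSubtree[of "nth xs"] Subtree_universe unfolding one by auto
    then show ?thesis using Subtree_Patterns
      by (auto simp: hier_struc_def hier_vocabulary_def hier_interp_def)
  next
    case Context_Patterns
    have "xs \<in> {[v, z] | v z. Context v z \<in> P} \<longleftrightarrow>
      length xs = 2 \<and> set xs \<subseteq> universe T \<and> sat T (nth xs) (fContext k)" for xs
      using sat_fContext[of "nth xs"] Context_universe unfolding two by auto
    then show ?thesis using Context_Patterns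
      by (auto simp: hier_struc_def hier_vocabulary_def hier_interp_def)
  qed
  then have "rels (hier_struc T P) = (\<lambda>s. case hier_vocabulary k A s of None \<Rightarrow> {} | Some r \<Rightarrow>
      {xs. length xs = r \<and> set xs \<subseteq> universe T \<and> sat T (nth xs) (rel_formula ?I s)})" by (rule ext)
  moreover have "usize (hier_struc T P) = usize T" by (simp add: hier_struc_def)
  ultimately show ?thesis
    unfolding interp_struc_def interp_rel_unary[OF I] size by simp
qed

lemma hier_struc_STRUC: "hier_struc T P \<in> STRUC (hier_vocabulary k A)"
proof -
  have "case hier_vocabulary k A s of None \<Rightarrow> rels (hier_struc T P) s = {}
    | Some r \<Rightarrow> rels (hier_struc T P) s \<subseteq> {xs. length xs = r \<and> set xs \<subseteq> universe (hier_struc T P)}" for s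
  proof (cases s)
    case (Tree_Rel t)
    then show ?thesis
      using rels_none[of t] rels_sub[of t]
      by (auto simp: hier_struc_def hier_vocabulary_def universe_def split: option.splits)
  next
    case Subtree_Patterns
    then show ?thesis using Subtree_universe
      by (auto simp: hier_struc_def hier_vocabulary_def universe_def)
  next
    case Context_Patterns
    then show ?thesis using Context_universe
      by (auto simp: hier_struc_def hier_vocabulary_def universe_def)
  qed
  moreover have "1 \<le> usize (hier_struc T P)" using usize_pos by (simp add: hier_struc_def)
  ultimately show ?thesis unfolding STRUC_def by blast
qed

end


section \<open>Asymptotics\<close>

text \<open>Patterns count as small up to size \<open>4 * 2 ^ F\<close>, which is a small multiple of \<open>ln n\<close>, so that
  there are at most \<open>sqrt n\<close> encodings of small patterns.\<close>

lemma small_pattern_size: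
  fixes n k C :: nat
  assumes C: "2 \<le> C" and k: "1 \<le> k" and n: "4 * (real k + 1) * (16 * ln C) \<le> ln n"
  shows "\<exists>F. \<forall>x. x * ((2 ^ F - 1) div k) \<le> 9 * n \<longrightarrow>
    real (x + C ^ (2 * (4 * 2 ^ F))) \<le> (36 * real k * (16 * ln C) + 2) * (real n / ln n)"
proof -
  \<comment> \<open>Words of length 8 * 2^F over C letters number exp (8 * 2^F * ln C). With 2^F at
    most ln n / a this is at most exp (ln n / 2), the square root of n.\<close>
  define a where "a = 16 * ln (real C)"
  define t where "t = ln n / a"
  define F where "F = floor_log (nat \<lfloor>t\<rfloor>)"
  define L where "L = (2::real) ^ F"
  have a: "a > 0" using C by (simp add: a_def)
  have t: "4 * (real k + 1) \<le> t" using n a by (simp add: t_def a_def pos_le_divide_eq)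
  have "1 \<le> t" using t by (smt (verit) of_nat_0_le_iff)
  then have t1: "1 \<le> nat \<lfloor>t\<rfloor>" by (intro le_nat_floor) simp
  have "2 ^ F \<le> nat \<lfloor>t\<rfloor>" "nat \<lfloor>t\<rfloor> < 2 * 2 ^ F"
    using floor_log_exp2_le[of "nat \<lfloor>t\<rfloor>"] floor_log_exp2_gt[of "nat \<lfloor>t\<rfloor>"] t1
    unfolding F_def by linarith+
  then have "real (2 ^ F) \<le> real (nat \<lfloor>t\<rfloor>)" "real (nat \<lfloor>t\<rfloor>) + 1 \<le> real (2 * 2 ^ F)"
    by linarith+
  then have "L \<le> real (nat \<lfloor>t\<rfloor>)" "real (nat \<lfloor>t\<rfloor>) + 1 \<le> 2 * L"
    unfolding L_def by (simp_all only: of_nat_power of_nat_mult of_nat_numeral)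
  moreover have "real (nat \<lfloor>t\<rfloor>) \<le> t" "t < real (nat \<lfloor>t\<rfloor>) + 1" using \<open>1 \<le> t\<close> by linarith+
  ultimately have L: "L \<le> t" "t < 2 * L" by linarith+
  \<comment> \<open>Rounding in the division by k loses less than k, which is now less than half of
    L; hence d * k is at least L / 2.\<close>
  have Lk: "2 * (real k + 1) < L" using L t by linarith
  have lnn: "0 < ln (real n)" using t a unfolding t_def
    by (metis add_nonneg_pos less_le_trans mult_pos_pos of_nat_0_le_iff zero_less_divide_iff zero_less_numeral zero_less_one order.asym)
  have npos: "0 < real n" using lnn by (metis ln_0 of_nat_0_less_iff of_nat_0 less_irrefl neq0_conv)
  define d where "d = (2 ^ F - 1) div k"
  have "(2 ^ F - 1::nat) < (d + 1) * k" unfolding d_def using k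
    by (metis Suc_eq_plus1 dividend_less_times_div mult.commute mult_Suc_right less_le_trans zero_less_one)
  then have "(2::nat) ^ F \<le> (d + 1) * k" by linarith
  then have "real (2 ^ F) \<le> real ((d + 1) * k)" by (rule of_nat_mono)
  then have "L \<le> (real d + 1) * real k" by (simp add: L_def algebra_simps)
  then have dk: "L \<le> 2 * (real d * real k)" using Lk by (simp add: algebra_simps)
  have y: "real C ^ (8 * 2 ^ F) * ln n \<le> 2 * n"
  proof -
    let ?y = "real C ^ (8 * 2 ^ F)"
    have y0: "0 < ?y" using C by simp
    have "ln ?y = 8 * L * ln C" using C by (simp add: ln_realpow L_def)
    also have "\<dots> = L * a / 2" by (simp add: a_def)
    also have "\<dots> \<le> t * a / 2" using L(1) a by (simp add: mult_right_mono)
    also have "\<dots> = ln n / 2" using a by (simp add: t_def)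
    also have "\<dots> = ln (sqrt n)" using npos by (simp add: ln_sqrt)
    finally have "?y \<le> sqrt n" using y0 npos by simp
    \<comment> \<open>This turns the square root of n into a multiple of n / ln n.\<close>
    moreover have "ln n \<le> 2 * sqrt n"
    proof -
      have "ln (sqrt n) \<le> sqrt n" using npos ln_le_minus_one[of "sqrt n"] by simp
      then show ?thesis using npos by (simp add: ln_sqrt)
    qed
    ultimately have "?y * ln n \<le> sqrt n * (2 * sqrt n)"
      using y0 lnn by (intro mult_mono) auto
    also have "\<dots> = 2 * (sqrt n * sqrt n)" by (simp only: mult.left_commute)
    also have "\<dots> = 2 * n" by simp
    finally show ?thesis .
  qed
  have "real (x + C ^ (2 * (4 * 2 ^ F))) \<le> (36 * real k * a + 2) * (real n / ln n)"
    if x: "x * d \<le> 9 * n" for x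
  proof -
    have "real (x * d) \<le> real (9 * n)" using x by (rule of_nat_mono)
    then have xd: "real x * real d \<le> 9 * n" by simp
    \<comment> \<open>The factor 36 is 9 times 2 from rounding t to a power of two times 2 from the
      division by k.\<close>
    have "real x * ln n = real x * t * a" using a by (simp add: t_def)
    also have "\<dots> \<le> real x * (2 * L) * a" using L(2) a by (intro mult_right_mono mult_left_mono) auto
    also have "\<dots> \<le> real x * (2 * (2 * (real d * real k))) * a"
      using dk a by (intro mult_right_mono mult_left_mono) auto
    also have "\<dots> = (real x * real d) * (4 * real k * a)" by simp
    also have "\<dots> \<le> (9 * n) * (4 * real k * a)" using xd a by (intro mult_right_mono) auto
    finally have "real x * ln n \<le> 36 * real k * a * n" by (simp add: mult_ac)
    moreover have "real (C ^ (2 * (4 * 2 ^ F))) = real C ^ (8 * 2 ^ F)" by simp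
    ultimately have "real (x + C ^ (2 * (4 * 2 ^ F))) * ln n \<le> (36 * real k * a + 2) * n"
      using y by (simp add: algebra_simps)
    then show ?thesis using lnn by (simp add: pos_le_divide_eq)
  qed
  then show ?thesis unfolding d_def a_def by blast
qed

theorem theorem4p6:
  fixes k :: nat and A :: "'a set"
  assumes "k \<ge> 1" and "finite A"
  shows "\<exists>(f :: 'a tree_sym struc \<Rightarrow> 'a hier_sym struc) (D :: nat \<Rightarrow> real) (N :: nat \<Rightarrow> real).
     FOM_computable (tree_vocabulary k A) (hier_vocabulary k A) (ordered_trees k A) f \<and>
     D \<in> O(\<lambda>n. ln (real n)) \<and>
     N \<in> O(\<lambda>n. real n / ln (real n)) \<and>
     (\<forall>T\<in>ordered_trees k A. \<exists>P.
        f T = hier_struc T P \<and>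
        hierarchical_definition T P \<and>
        normal_form T P \<and>
        real (hier_depth T P) \<le> D (usize T) \<and>
        real (num_inequivalent T P) \<le> N (usize T))"
proof -
  define C where "C = card (ord_tree.alphabet k A) + 1"
  define b where "b = 4 * (real k + 1) * (16 * ln C)"
  define B where "B = 36 * real k * (16 * ln C) + 2"
  define f :: "'a tree_sym struc \<Rightarrow> 'a hier_sym struc" where "f T = hier_struc T (ord_tree.P T)" for T
  define dep where "dep n = 6 * log 2 (real n) + 2" for n :: nat
  \<comment> \<open>Below the threshold, where \<open>small_pattern_size\<close> says nothing, the
    total number of patterns is bound enough; only finitely many n are affected.\<close>
  define num where "num n = (if b \<le> ln n then B * (real n / ln n) else 3 * real n + 1)" for n :: nat
  have tree: "ord_tree k A T" if "T \<in> ordered_trees k A" for T :: "'a tree_sym struc"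
    using that by (rule ord_tree.intro)
  have comp: "FOM_computable (tree_vocabulary k A) (hier_vocabulary k A) (ordered_trees k A) f"
    unfolding FOM_computable_def
  proof (intro conjI exI ballI)
    show "ordered_trees k A \<subseteq> STRUC (tree_vocabulary k A)" by (auto simp: ordered_trees_def)
    show "f ` ordered_trees k A \<subseteq> STRUC (hier_vocabulary k A)"
      using ord_tree.hier_struc_STRUC[OF tree] by (auto simp: f_def)
    show "fom_interpretation (tree_vocabulary k A) (hier_vocabulary k A) (hier_interp k)"
      by (rule hier_interp_valid)
    show "f T = interp_struc (hier_vocabulary k A) (hier_interp k) T" if "T \<in> ordered_trees k A" for T
      using ord_tree.hier_struc_eq[OF tree[OF that]] by (simp add: f_def)
  qed
  have dep: "dep \<in> O(\<lambda>n. ln (real n))"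
  proof (rule bigoI)
    show "\<forall>\<^sub>F n in sequentially. norm (dep n) \<le> (6 / ln 2 + 2) * norm (ln (real n))"
    \<comment> \<open>From 3 on the logarithm is at least 1 and absorbs the additive constant
      2.\<close>
    proof (rule eventually_sequentiallyI[of 3])
      fix n :: nat assume n: "3 \<le> n"
      have "exp 1 \<le> real n" using exp_le n by linarith
      then have "1 \<le> ln (real n)" using n by (subst ln_ge_iff) auto
      then show "norm (dep n) \<le> (6 / ln 2 + 2) * norm (ln (real n))"
        by (simp add: dep_def log_def algebra_simps)
    qed
  qed
  have num: "num \<in> O(\<lambda>n. real n / ln (real n))"
  proof (rule bigoI)
    have "\<forall>\<^sub>F n in sequentially. b \<le> ln (real n)"
      using filterlim_compose[OF ln_at_top filterlim_real_sequentially]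
      unfolding filterlim_at_top by blast
    then show "\<forall>\<^sub>F n in sequentially. norm (num n) \<le> \<bar>B\<bar> * norm (real n / ln (real n))"
      by (rule eventually_mono) (simp add: num_def abs_mult)
  qed
  have "\<exists>P. f T = hier_struc T P \<and> hierarchical_definition T P \<and> normal_form T P \<and>
      real (hier_depth T P) \<le> dep (usize T) \<and> real (num_inequivalent T P) \<le> num (usize T)"
    if T: "T \<in> ordered_trees k A" for T
  proof -
    interpret ord_tree k A T using tree[OF T] .
    let ?n = "usize T"
    have cV: "card (universe T) = ?n" by (simp add: universe_def)
    have "2 ^ floor_log ?n \<le> ?n" using usize_pos by (intro floor_log_exp2_le) simp
    then have "real (2 ^ floor_log ?n) \<le> real ?n" by (rule of_nat_mono)
    then have "real (floor_log ?n) \<le> log 2 (real ?n)" by (intro le_log_of_power) simp_all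
    moreover have "real (hier_depth T P) \<le> real (6 * floor_log ?n + 2)" using P_depth by (rule of_nat_mono)
    ultimately have depth: "real (hier_depth T P) \<le> dep ?n" by (simp add: dep_def)
    have "real (num_inequivalent T P) \<le> num ?n"
    proof (cases "b \<le> ln ?n")
      case True
      have "None \<in> alphabet" "Some ({}, {}, {}) \<in> alphabet" by (auto simp: alphabet_def)
      then have "alphabet \<noteq> {}" by blast
      moreover have "finite alphabet" using assms(2) by (simp add: alphabet_def)
      ultimately have "2 \<le> C" by (simp add: C_def Suc_le_eq card_gt_0_iff)
      then obtain F where F: "\<And>x. x * ((2 ^ F - 1) div k) \<le> 9 * ?n \<Longrightarrow>
          real (x + C ^ (2 * (4 * 2 ^ F))) \<le> B * (real ?n / ln ?n)"
        using small_pattern_size[of C k ?n] assms(1) True unfolding b_def B_def by blast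
      have "card {p \<in> P0. 4 * 2 ^ F \<le> card (cov p)} * ((2 ^ F - 1) div k) \<le> 9 * ?n"
        using card_large_patterns[OF degree assms(1), of F] cV by simp
      then have "real (card {p \<in> P0. 4 * 2 ^ F \<le> card (cov p)} + C ^ (2 * (4 * 2 ^ F))) \<le> num ?n"
        using F True by (simp add: num_def)
      moreover have "real (num_inequivalent T P) \<le>
          real (card {p \<in> P0. 4 * 2 ^ F \<le> card (cov p)} + C ^ (2 * (4 * 2 ^ F)))"
        using num_inequivalent_le[OF assms(2), of "4 * 2 ^ F"] unfolding C_def by (rule of_nat_mono)
      ultimately show ?thesis by linarith
    next
      case False
      have "num_inequivalent T P \<le> 3 * ?n + 1"
        using num_inequivalent_le[OF assms(2), of 0] card_P0 cV by simp
      then have "real (num_inequivalent T P) \<le> real (3 * ?n + 1)" by (rule of_nat_mono)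
      then show ?thesis using False by (simp add: num_def)
    qed
    then show ?thesis using P_hierarchical P_normal depth by (auto simp: f_def)
  qed
  then show ?thesis using comp dep num by blast
qed

end
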